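(* Let $\{\lambda_n\}_{n\ge 1}$ be an interpolating sequence (for $H^\infty$) in $\mathbb{D}$ and let $\Theta$ be an inner function. Suppose that $\kappa:=\sup_n|\Theta(\lambda_n)|<1$. Then the following statements (1)–(6) are equivalent: (1) $\{\lambda_n\}$ is an $EIS_{H^2}$ sequence; (2) $\{\lambda_n\}$ is a thin interpolating sequence; (3) either (a) $\{k_{\lambda_n}^\Theta\}_{n\ge 1}$ is an $AOB$, or (b) there exists $p\ge 2$ such that $\{k_{\lambda_n}^\Theta\}_{n\ge p}$ is a complete $AOB$ in $K_\Theta$; (4) $\{\lambda_n\}$ is an $AIS_{H^2}$ sequence; (5) the measure $\mu_N=\sum_{k\ge N}(1-|\lambda_k|^2)\,\delta_{\lambda_k}$ is a Carleson measure for $H^2$ with Carleson embedding constant $\mathcal{C}(\mu_N)$ satisfying $\mathcal{C}(\mu_N)\to 1$ as $N\to\infty$; (6) the measure $\nu_N=\sum_{k\ge N}\frac{1-|\lambda_k|^2}{\delta_k}\,\delta_{\lambda_k}$ is a Carleson measure for $H^2$ with embedding constant $\mathcal{R}(\nu_N)$ on reproducing kernels satisfying $\mathcal{R}(\nu_N)\to 1$ as $N\to\infty$. Further, the following two statements are equivalent to each other and imply each of the statements (1)–(6): (7) $\{\lambda_n\}$ is an $EIS_{K_\Theta}$ sequence; (8) $\{\lambda_n\}$ is an $AIS_{K_\Theta}$ sequence. If, in addition, $\Theta(\lambda_n)\to 0$ as $n\to\infty$, then (1)–(8) are all equivalent.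
   Context: $\mathbb{D}$ is the open unit disc, $H^2$ the Hardy space on $\mathbb{D}$ with norm $\|\cdot\|_2$, and $H^\infty$ the algebra of bounded analytic functions on $\mathbb{D}$. An inner function is a function in $H^\infty$ with boundary values of modulus $1$ a.e. on the unit circle; $\Theta$ is taken nonconstant (automatic from $\kappa<1$). A sequence $\{\lambda_j\}\subset\mathbb{D}$ is an interpolating sequence (for $H^\infty$) if for every $w\in\ell^\infty$ there is $f\in H^\infty$ with $f(\lambda_j)=w_j$ for all $j$. Put $$\delta_j=\prod_{k\ne j}\left|\frac{\lambda_j-\lambda_k}{1-\overline{\lambda_k}\lambda_j}\right|.$$ The sequence is thin if $\lim_{j\to\infty}\delta_j=1$. A thin interpolating sequence is an interpolating sequence that is thin. The symbol $\delta_{\lambda_k}$ denotes the unit point mass at $\lambda_k$, while $\delta_k$ is the number $\prod_{j\ne k}\left|\frac{\lambda_k-\lambda_j}{1-\overline{\lambda_j}\lambda_k}\right|$. The model space is $K_\Theta=H^2\ominus\Theta H^2$, with the $H^2$ norm. Its reproducing kernel at $\lambda\in\mathbb{D}$ is $K_\lambda^\Theta(z)=\frac{1-\overline{\Theta(\lambda)}\Theta(z)}{1-\overline{\lambda}z}$ and its normalized reproducing kernel is $k_\lambda^\Theta=\sqrt{\frac{1-|\lambda|^2}{1-|\Theta(\lambda)|^2}}\,K_\lambda^\Theta$. The reproducing kernel of $H^2$ at $\lambda$ is $K_\lambda(z)=\frac{1}{1-\overline{\lambda}z}$, with normalized kernel $k_\lambda(z)=\frac{(1-|\lambda|^2)^{1/2}}{1-\overline{\lambda}z}$.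 For $a=\{a_n\}\in\ell^2$ put $\|a\|_{N,\ell^2}=\left(\sum_{j\ge N}|a_j|^2\right)^{1/2}$. Let $\mathcal{H}$ be a reproducing kernel Hilbert space of analytic functions on $\mathbb{D}$ with reproducing kernel $K^{\mathcal{H}}_\lambda$ at $\lambda$ (here $\mathcal{H}=H^2$ with $K^{\mathcal H}_\lambda=K_\lambda$, or $\mathcal{H}=K_\Theta$ with $K^{\mathcal H}_\lambda=K^\Theta_\lambda$). - $\{\lambda_n\}$ is an $EIS_{\mathcal{H}}$ (eventual $1$-interpolating sequence for $\mathcal{H}$) if for every $\varepsilon>0$ there exists $N$ such that for each $a=\{a_n\}\in\ell^2$ there exists $f_{N,a}\in\mathcal{H}$ with $f_{N,a}(\lambda_n)K^{\mathcal{H}}_{\lambda_n}(\lambda_n)^{-1/2}=a_n$ for all $n\ge N$ and $\|f_{N,a}\|_{\mathcal{H}}\le(1+\varepsilon)\|a\|_{N,\ell^2}$. - $\{\lambda_n\}$ is an $AIS_{\mathcal{H}}$ (strong asymptotic interpolating sequence for $\mathcal{H}$) if for every $\varepsilon>0$ there exists $N$ such that for all $a=\{a_n\}\in\ell^2$ with $\|a\|_{N,\ell^2}\neq 0$ there exists $G_{N,a}\in\mathcal{H}$ with $\|G_{N,a}\|_{\mathcal{H}}\le\|a\|_{N,\ell^2}$ and $\|\{G_{N,a}(\lambda_n)K^{\mathcal{H}}_{\lambda_n}(\lambda_n)^{-1/2}-a_n\}\|_{N,\ell^2}<\varepsilon\|a\|_{N,\ell^2}$. A sequence $\{x_n\}_{n\ge1}$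 in a Hilbert space $\mathcal{K}$ is an $AOB$ if for every $N\ge 1$ there are positive constants $c_N,C_N$ with $$c_N\sum_{n\ge N}|a_n|^2\le\Big\|\sum_{n\ge N}a_nx_n\Big\|_{\mathcal{K}}^2\le C_N\sum_{n\ge N}|a_n|^2\quad\text{for all }\{a_n\}\in\ell^2,$$ where $c_N\to1$ and $C_N\to1$ as $N\to\infty$. For a sequence $\{x_n\}_{n\ge p}$ the definition is applied after re-indexing to start at $1$. A sequence is complete in $\mathcal{K}$ if its closed linear span is $\mathcal{K}$. For a non-negative measure $\mu$ on $\mathbb{D}$, put $$\mathcal{C}(\mu)=\sup_{f\in H^2,\,f\ne0}\frac{\|f\|^2_{L^2(\mathbb{D},\mu)}}{\|f\|_2^2},\qquad \mathcal{R}(\mu)=\sup_{z\in\mathbb{D}}\|k_z\|_{L^2(\mathbb{D},\mu)}.$$ The measure $\mu$ is a Carleson measure for $H^2$ if $\mathcal{C}(\mu)<\infty$. *)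

theory Defs
  imports "HOL-Complex_Analysis.Complex_Analysis"
begin

text \<open>
  Functions on the disc are total functions on the complex plane; their values off the disc play no
  role. Sequences are indexed by the positive integers, so their entries at 0 play no role either.
\<close>

abbreviation unit_disc :: "complex set" where
  "unit_disc \<equiv> ball 0 1"

definition H_inf :: "(complex \<Rightarrow> complex) set" where
  "H_inf = {f. f holomorphic_on unit_disc \<and> bounded (f ` unit_disc)}"

definition taylor_coeff :: "(complex \<Rightarrow> complex) \<Rightarrow> nat \<Rightarrow> complex" where
  "taylor_coeff f n = (deriv ^^ n) f 0 / fact n"

definition H2 :: "(complex \<Rightarrow> complex) set" where
  "H2 = {f. f holomorphic_on unit_disc \<and> summable (\<lambda>n. (norm (taylor_coeff f n))\<^sup>2)}"

definition H2_inner :: "(complex \<Rightarrow> complex) \<Rightarrow> (complex \<Rightarrow> complex) \<Rightarrow> complex" where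
  "H2_inner f g = (\<Sum>n. taylor_coeff f n * cnj (taylor_coeff g n))"

definition H2_norm :: "(complex \<Rightarrow> complex) \<Rightarrow> real" where
  "H2_norm f = sqrt (\<Sum>n. (norm (taylor_coeff f n))\<^sup>2)"

text \<open>Boundary values are radial limits.\<close>

definition inner_function :: "(complex \<Rightarrow> complex) \<Rightarrow> bool" where
  "inner_function \<Theta> \<longleftrightarrow> \<Theta> \<in> H_inf \<and>
     (AE t in lborel. t \<in> {0..2 * pi} \<longrightarrow>
        (\<exists>u. norm u = 1 \<and> ((\<lambda>r. \<Theta> (of_real r * cis t)) \<longlongrightarrow> u) (at_left 1)))"

definition model_space :: "(complex \<Rightarrow> complex) \<Rightarrow> (complex \<Rightarrow> complex) set" where
  "model_space \<Theta> = {f \<in> H2. \<forall>g\<in>H2. H2_inner f (\<lambda>z. \<Theta> z * g z) = 0}"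

definition H2_kernel :: "complex \<Rightarrow> complex \<Rightarrow> complex" where
  "H2_kernel w z = 1 / (1 - cnj w * z)"

definition H2_normalized_kernel :: "complex \<Rightarrow> complex \<Rightarrow> complex" where
  "H2_normalized_kernel w z = of_real (sqrt (1 - (norm w)\<^sup>2)) / (1 - cnj w * z)"

definition model_kernel :: "(complex \<Rightarrow> complex) \<Rightarrow> complex \<Rightarrow> complex \<Rightarrow> complex" where
  "model_kernel \<Theta> w z = (1 - cnj (\<Theta> w) * \<Theta> z) / (1 - cnj w * z)"

definition model_normalized_kernel :: "(complex \<Rightarrow> complex) \<Rightarrow> complex \<Rightarrow> complex \<Rightarrow> complex" where
  "model_normalized_kernel \<Theta> w z =
     of_real (sqrt ((1 - (norm w)\<^sup>2) / (1 - (norm (\<Theta> w))\<^sup>2))) * model_kernel \<Theta> w z"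

definition interpolating :: "(nat \<Rightarrow> complex) \<Rightarrow> bool" where
  "interpolating lam \<longleftrightarrow> (\<forall>j\<ge>1. lam j \<in> unit_disc) \<and>
     (\<forall>w :: nat \<Rightarrow> complex. bounded (w ` {1..}) \<longrightarrow> (\<exists>f\<in>H_inf. \<forall>j\<ge>1. f (lam j) = w j))"

text \<open>
  The partial products decrease, so the limit exists for every sequence in the disc. The constant
  \<open>prodinf\<close> is unsuitable for this definition: it is unspecified if the product diverges to 0.
\<close>

definition delta :: "(nat \<Rightarrow> complex) \<Rightarrow> nat \<Rightarrow> real" where
  "delta lam j =
     lim (\<lambda>n. \<Prod>k\<in>{1..n} - {j}. norm ((lam j - lam k) / (1 - cnj (lam k) * lam j)))"

definition thin :: "(nat \<Rightarrow> complex) \<Rightarrow> bool" where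
  "thin lam \<longleftrightarrow> delta lam \<longlonglongrightarrow> 1"

definition ell2 :: "(nat \<Rightarrow> complex) set" where
  "ell2 = {a. (\<lambda>n. (norm (a n))\<^sup>2) summable_on {1..}}"

definition tail_norm :: "nat \<Rightarrow> (nat \<Rightarrow> complex) \<Rightarrow> real" where
  "tail_norm N a = sqrt (\<Sum>\<^sub>\<infinity>j\<in>{N..}. (norm (a j))\<^sup>2)"

text \<open>
  Below, a Hilbert space of functions is given by its set of elements \<open>H\<close>, its norm \<open>nrm\<close> and,
  where needed, its reproducing kernel \<open>K\<close>, with \<open>K w\<close> the kernel function at \<open>w\<close>. The number
  \<open>K w w\<close> is real and nonnegative, hence the real part in the next definition.
\<close>

definition normalized_value ::
    "(complex \<Rightarrow> complex \<Rightarrow> complex) \<Rightarrow> (complex \<Rightarrow> complex) \<Rightarrow> complex \<Rightarrow> complex" where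
  "normalized_value K f w = f w / of_real (sqrt (Re (K w w)))"

definition EIS ::
    "(complex \<Rightarrow> complex) set \<Rightarrow> ((complex \<Rightarrow> complex) \<Rightarrow> real) \<Rightarrow>
     (complex \<Rightarrow> complex \<Rightarrow> complex) \<Rightarrow> (nat \<Rightarrow> complex) \<Rightarrow> bool" where
  "EIS H nrm K lam \<longleftrightarrow>
     (\<forall>\<epsilon>>0. \<exists>N\<ge>1. \<forall>a\<in>ell2. \<exists>f\<in>H.
        (\<forall>n\<ge>N. normalized_value K f (lam n) = a n) \<and>
        nrm f \<le> (1 + \<epsilon>) * tail_norm N a)"

text \<open>
  The summability condition says that the error sequence has a finite norm: \<open>tail_norm\<close> is 0 for
  sequences that are not square summable.
\<close>

definition AIS ::
    "(complex \<Rightarrow> complex) set \<Rightarrow> ((complex \<Rightarrow> complex) \<Rightarrow> real) \<Rightarrow>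
     (complex \<Rightarrow> complex \<Rightarrow> complex) \<Rightarrow> (nat \<Rightarrow> complex) \<Rightarrow> bool" where
  "AIS H nrm K lam \<longleftrightarrow>
     (\<forall>\<epsilon>>0. \<exists>N\<ge>1. \<forall>a\<in>ell2. tail_norm N a \<noteq> 0 \<longrightarrow>
        (\<exists>G\<in>H. nrm G \<le> tail_norm N a \<and>
           (\<lambda>n. (norm (normalized_value K G (lam n) - a n))\<^sup>2) summable_on {N..} \<and>
           tail_norm N (\<lambda>n. normalized_value K G (lam n) - a n) < \<epsilon> * tail_norm N a))"

text \<open>The function \<open>g\<close> is the sum of the series \<open>\<Sum>n\<ge>N. a n * x n\<close>, which converges in norm.\<close>

definition AOB ::
    "(complex \<Rightarrow> complex) set \<Rightarrow> ((complex \<Rightarrow> complex) \<Rightarrow> real) \<Rightarrow>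
     (nat \<Rightarrow> complex \<Rightarrow> complex) \<Rightarrow> bool" where
  "AOB H nrm x \<longleftrightarrow> (\<forall>n\<ge>1. x n \<in> H) \<and>
     (\<exists>c C :: nat \<Rightarrow> real.
        (\<forall>N\<ge>1. 0 < c N \<and> 0 < C N \<and>
           (\<forall>a\<in>ell2. \<exists>g\<in>H.
              (\<lambda>M. nrm (\<lambda>z. g z - (\<Sum>n=N..M. a n * x n z))) \<longlonglongrightarrow> 0 \<and>
              c N * (\<Sum>\<^sub>\<infinity>n\<in>{N..}. (norm (a n))\<^sup>2) \<le> (nrm g)\<^sup>2 \<and>
              (nrm g)\<^sup>2 \<le> C N * (\<Sum>\<^sub>\<infinity>n\<in>{N..}. (norm (a n))\<^sup>2))) \<and>
        c \<longlonglongrightarrow> 1 \<and> C \<longlonglongrightarrow> 1)"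

definition complete_in ::
    "(complex \<Rightarrow> complex) set \<Rightarrow> ((complex \<Rightarrow> complex) \<Rightarrow> real) \<Rightarrow>
     (nat \<Rightarrow> complex \<Rightarrow> complex) \<Rightarrow> bool" where
  "complete_in H nrm x \<longleftrightarrow> (\<forall>n\<ge>1. x n \<in> H) \<and>
     (\<forall>f\<in>H. \<forall>\<epsilon>>0. \<exists>M c. nrm (\<lambda>z. f z - (\<Sum>n=1..M. c n * x n z)) < \<epsilon>)"

text \<open>The sum over \<open>k \<ge> N\<close> of \<open>w k\<close> times the unit point mass at \<open>lam k\<close>.\<close>

definition point_masses :: "(nat \<Rightarrow> complex) \<Rightarrow> (nat \<Rightarrow> real) \<Rightarrow> nat \<Rightarrow> complex measure" where
  "point_masses lam w N =
     distr (point_measure {N..} (\<lambda>k. ennreal (w k))) (restrict_space borel unit_disc) lam"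

definition L2_norm_sq :: "complex measure \<Rightarrow> (complex \<Rightarrow> complex) \<Rightarrow> ennreal" where
  "L2_norm_sq \<mu> f = (\<integral>\<^sup>+ z. ennreal ((norm (f z))\<^sup>2) \<partial>\<mu>)"

definition ennreal_sqrt :: "ennreal \<Rightarrow> ennreal" where
  "ennreal_sqrt x = (if x = \<infinity> then \<infinity> else ennreal (sqrt (enn2real x)))"

definition carleson_const :: "complex measure \<Rightarrow> ennreal" where
  "carleson_const \<mu> =
     (SUP f \<in> {f \<in> H2. \<exists>z\<in>unit_disc. f z \<noteq> 0}. L2_norm_sq \<mu> f / ennreal ((H2_norm f)\<^sup>2))"

definition kernel_const :: "complex measure \<Rightarrow> ennreal" where
  "kernel_const \<mu> = (SUP z \<in> unit_disc. ennreal_sqrt (L2_norm_sq \<mu> (H2_normalized_kernel z)))"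

definition carleson_measure :: "complex measure \<Rightarrow> bool" where
  "carleson_measure \<mu> \<longleftrightarrow> carleson_const \<mu> < \<infinity>"

end

theory Submission
  imports Defs
begin

text \<open>
  All eight statements are equivalent to thinness; they all express that the Gram matrix of the tail
  of a sequence of normalized kernels is close to the identity. The Gram matrix of the model kernels
  is \<open>W (G - D* G D) W\<close>, where \<open>G\<close> is that of the Hardy space kernels, \<open>D\<close> is the diagonal matrix with
  entries \<open>\<Theta> (lam n)\<close> and \<open>W = (1 - D* D) powr (-1/2)\<close> is bounded because \<open>\<kappa> < 1\<close>. So it suffices to study \<open>G\<close>.

  If the sequence is thin, Earl's theorem interpolates any choice of signs on a tail by a multiplier of
  norm close to 1. The adjoint multipliers are almost contractive, so changing the signs of the
  coefficients hardly changes the norm of a combination of kernels; averaging over the signs gives both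
  bounds for \<open>G\<close>. Conversely, an upper bound close to 1 makes the row sums of \<open>1 - \<rho>\<^sup>2\<close> small, by Bessel's
  inequality, which is thinness. A lower bound close to 1 does the same once some upper bound is known,
  and Earl's theorem provides one: the functions dual to the kernels, divided by Blaschke products,
  bound the products of the \<open>\<rho>\<close> from below.

  For alternative (b) of (3), let \<open>p\<close> be least such that the kernels from \<open>p\<close> on form a Riesz sequence. If
  \<open>p \<ge> 2\<close>, every function in the model space vanishing at \<open>lam n\<close> for all \<open>n \<ge> p\<close> also vanishes at
  \<open>lam (p - 1)\<close>. Dividing by the Blaschke factor at that point stays within the class of such functions,
  so that it can be repeated forever; hence the function is 0.
\<close>

section \<open>Brouwer's theorem and interpolation by products of automorphisms\<close>

text \<open>The quantity 1 - rho^2 is chosen because for the Hardy space kernels it is exactly the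
  squared modulus of a Gram entry, and for the model kernels it is at most that; so one row-sum
  criterion serves both spaces. To reach thinness from it, the inequality prod rho^2 >= 1 - sum (1 -
  rho^2) controls the indices from N on, and the finitely many earlier factors tend to 1 because
  every delta is positive.

  When G is close to the identity, the main part of the Gram matrix of the model kernels is W (1 -
  D* D) W, which is the identity exactly; \<open>\<kappa>\<close> enters only in the size of the
  error.

  The Hardy space is the model space of the symbol 0. As 0 is not inner, the theory of model spaces
  rests on three properties shared by 0 and the inner functions.

  All spaces are described by Taylor coefficients. Radial limits of \<Theta> enter only through the
  fact that multiplication by \<Theta> is isometric, and limit functions are constructed by
  coefficientwise weak compactness.\<close>

text \<open>The dimension \<open>n\<close> is a variable, so points are functions on the naturals of
  which the first \<open>n\<close> values count, and continuity is sequential in these coordinates.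
  On the grid of mesh 1/(m+1), \<open>kuhn_lemma\<close> yields one small cell containing, for every
  coordinate, two points whose displacements have opposite signs; a limit of such cells is a fixed
  point.\<close>

lemma brouwer_cube:
  fixes f :: "(nat \<Rightarrow> real) \<Rightarrow> nat \<Rightarrow> real"
  assumes range: "\<And>x i. \<lbrakk>\<forall>j<n. x j \<in> {0..1}; i < n\<rbrakk> \<Longrightarrow> f x i \<in> {0..1}"
    and cont: "\<And>X x i. \<lbrakk>\<forall>m. \<forall>j<n. X m j \<in> {0..1}; \<forall>j<n. (\<lambda>m. X m j) \<longlonglongrightarrow> x j; i < n\<rbrakk>
                \<Longrightarrow> (\<lambda>m. f (X m) i) \<longlonglongrightarrow> f x i"
  shows "\<exists>x. (\<forall>j<n. x j \<in> {0..1}) \<and> (\<forall>i<n. f x i = x i)"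
proof -
  define sc :: "nat \<Rightarrow> (nat \<Rightarrow> nat) \<Rightarrow> nat \<Rightarrow> real" where "sc = (\<lambda>m q j. real (q j) / real (Suc m))"
  define cell :: "(nat \<Rightarrow> nat) \<Rightarrow> (nat \<Rightarrow> nat) \<Rightarrow> bool"
    where "cell = (\<lambda>q r. \<forall>j<n. q j \<le> r j \<and> r j \<le> q j + 1)"
  have sc01: "sc m x j \<in> {0..1}" if "x j \<le> Suc m" for m x j
    using that unfolding sc_def by (auto simp: divide_le_eq)
  have f01: "f (sc m x) i \<in> {0..1}" if "\<forall>j<n. x j \<le> Suc m" "i < n" for m x i
    using that sc01 by (intro range) auto
  have "\<exists>q. (\<forall>i<n. q i < Suc m) \<and>
          (\<forall>i<n. \<exists>r s. cell q r \<and> cell q s \<and> f (sc m r) i \<ge> sc m r i \<and> f (sc m s) i \<le> sc m s i)"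
              for m
  proof -
    \<comment> \<open>Label 1 guarantees that coordinate \<open>i\<close> does not grow under
      \<open>f\<close>, label 0 that it does not decrease. On the two opposite faces the label is
      prescribed, and there the inequality holds because \<open>f\<close> stays in the cube.\<close>
    define label :: "(nat \<Rightarrow> nat) \<Rightarrow> nat \<Rightarrow> nat"
      where "label = (\<lambda>x i. if x i = Suc m \<or> (x i \<noteq> 0 \<and> f (sc m x) i < sc m x i) then 1 else 0)"
    have lab1: "f (sc m x) i \<le> sc m x i" if "label x i = 1" "\<forall>j<n. x j \<le> Suc m" "i < n" for x i
      using that(1) f01[OF that(2,3)]
      by (cases "x i = Suc m") (auto simp: label_def sc_def split: if_splits)
    have lab0: "f (sc m x) i \<ge> sc m x i" if "label x i = 0" "\<forall>j<n. x j \<le> Suc m" "i < n" for x i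
      using that(1) f01[OF that(2,3)]
      by (cases "x i = 0") (auto simp: label_def sc_def split: if_splits)
    obtain q where q: "\<forall>i<n. q i < Suc m"
      and l: "\<forall>i<n. \<exists>r s. (\<forall>j<n. q j \<le> r j \<and> r j \<le> q j + 1) \<and> (\<forall>j<n. q j \<le> s j \<and> s j \<le> q j + 1)
          \<and> label r i \<noteq> label s i"
      by (rule kuhn_lemma[of "Suc m" n label]) (auto simp: label_def)
    have "\<exists>r s. cell q r \<and> cell q s \<and> f (sc m r) i \<ge> sc m r i \<and> f (sc m s) i \<le> sc m s i" if i: "i
        < n" for i
    proof -
      obtain r s where rs: "cell q r" "cell q s" "label r i \<noteq> label s i"
        using l i unfolding cell_def by blast
      have b: "\<forall>j<n. x j \<le> Suc m" if "cell q x" for x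
        using that q unfolding cell_def by (metis Suc_eq_plus1 Suc_leI le_trans)
      have "label x i = 0 \<or> label x i = 1" for x by (simp add: label_def)
      then consider "label r i = 0" "label s i = 1" | "label r i = 1" "label s i = 0"
        using rs(3) by metis
      then show ?thesis
      proof cases
        case 1 then show ?thesis using lab0[OF 1(1) b[OF rs(1)] i] lab1[OF 1(2) b[OF rs(2)] i] rs
            by blast
      next
        case 2 then show ?thesis using lab0[OF 2(2) b[OF rs(2)] i] lab1[OF 2(1) b[OF rs(1)] i] rs
            by blast
      qed
    qed
    then show ?thesis using q by blast
  qed
  then obtain q where q: "\<And>m i. i < n \<Longrightarrow> q m i < Suc m"
    and ex: "\<forall>m. \<forall>i<n. \<exists>r s. cell (q m) r \<and> cell (q m) s \<and> f (sc m r) i \<ge> sc m r i \<and> f (sc m s) i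
        \<le> sc m s i"
    by metis
  obtain r s where rs: "\<And>m i. i < n \<Longrightarrow> cell (q m) (r m i) \<and> cell (q m) (s m i)
      \<and> f (sc m (r m i)) i \<ge> sc m (r m i) i \<and> f (sc m (s m i)) i \<le> sc m (s m i) i"
    using ex by metis
  have "norm (sc m (q m) j) \<le> 1" if "j \<in> {..<n}" for m j
    using sc01[of "q m" j m] q[of j m] that by auto
  then obtain k where k: "strict_mono (k :: nat \<Rightarrow> nat)"
    and lim: "\<And>j. j \<in> {..<n} \<Longrightarrow> \<exists>l. (\<lambda>m. sc (k m) (q (k m)) j) \<longlonglongrightarrow> l"
    using function_convergent_subsequence[of "{..<n}" "\<lambda>m. sc m (q m)" 1]
        by (metis countable_finite finite_lessThan)
  obtain x where x: "\<And>j. j < n \<Longrightarrow> (\<lambda>m. sc (k m) (q (k m)) j) \<longlonglongrightarrow> x j"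
    using lim by (metis lessThan_iff)
  have inv: "(\<lambda>m. 1 / real (Suc (k m))) \<longlonglongrightarrow> 0"
    using LIMSEQ_subseq_LIMSEQ[OF LIMSEQ_inverse_real_of_nat k]
        by (simp add: o_def inverse_eq_divide)
  \<comment> \<open>The cells shrink, so points chosen from them converge to the limit
    \<open>x\<close> of their lower corners.\<close>
  have conv: "(\<lambda>m. sc (k m) (t m) j) \<longlonglongrightarrow> x j" if j: "j < n" and t: "\<And>m. cell (q (k m)) (t m)" for t j
  proof -
    have "(\<lambda>m. sc (k m) (q (k m)) j + 1 / real (Suc (k m))) \<longlonglongrightarrow> x j + 0"
      by (intro tendsto_add x j inv)
    then have up: "(\<lambda>m. sc (k m) (q (k m)) j + 1 / real (Suc (k m))) \<longlonglongrightarrow> x j" by simp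
    show ?thesis
    proof (rule tendsto_sandwich[OF _ _ x[OF j] up])
      show "\<forall>\<^sub>F m in sequentially. sc (k m) (q (k m)) j \<le> sc (k m) (t m) j"
        using t j by (intro always_eventually) (auto simp: cell_def sc_def divide_right_mono)
      show "\<forall>\<^sub>F m in sequentially. sc (k m) (t m) j \<le> sc (k m) (q (k m)) j + 1 / real (Suc (k m))"
      proof (intro always_eventually allI)
        fix m
        have "real (t m j) \<le> real (q (k m) j) + 1" using t[of m] j unfolding cell_def by fastforce
        then show "sc (k m) (t m) j \<le> sc (k m) (q (k m)) j + 1 / real (Suc (k m))"
          unfolding sc_def add_divide_distrib[symmetric] by (intro divide_right_mono) auto
      qed
    qed
  qed
  have cube: "sc (k m) t j \<in> {0..1}" if "cell (q (k m)) t" "j < n" for t m j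
    by (rule sc01) (use that q[OF that(2), of "k m"] in \<open>force simp: cell_def\<close>)
  have "x j \<in> {0..1}" if "j < n" for j
    using x[OF that] by (rule closed_sequentially[OF closed_atLeastAtMost, rotated])
      (rule cube[unfolded cell_def], use that in auto)
  moreover have "f x i = x i" if i: "i < n" for i
  proof (rule antisym)
    have c: "(\<lambda>m. f (sc (k m) (t m)) i) \<longlonglongrightarrow> f x i" if t: "\<And>m. cell (q (k m)) (t m)" for t
      by (rule cont) (use conv[OF _ t] cube[OF t] i in auto)
    show "x i \<le> f x i"
      by (rule LIMSEQ_le[OF conv[of i "\<lambda>m. r (k m) i"] c[of "\<lambda>m. r (k m) i"]]) (use rs i in auto)
    show "f x i \<le> x i"
      by (rule LIMSEQ_le[OF c[of "\<lambda>m. s (k m) i"] conv[of i "\<lambda>m. s (k m) i"]]) (use rs i in auto)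
  qed
  ultimately show ?thesis by blast
qed

text \<open>Each complex coordinate is coded by two numbers in [0,1] that describe the square around
  the disc (\<open>raw\<close>), and is then retracted radially onto the disc (\<open>c\<close>). A
  fixed point of the coded map satisfies T (c x) = raw x; as \<open>T\<close> maps into the disc,
  raw x already lies there and the retraction does nothing to it.\<close>

lemma brouwer_discs:
  fixes T :: "(nat \<Rightarrow> complex) \<Rightarrow> nat \<Rightarrow> complex"
  assumes l: "l > 0"
    and range: "\<And>u i. \<lbrakk>\<forall>j<n. norm (u j) \<le> l; i < n\<rbrakk> \<Longrightarrow> norm (T u i) \<le> l"
    and cont: "\<And>X u i. \<lbrakk>\<forall>m. \<forall>j<n. norm (X m j) \<le> l; \<forall>j<n. (\<lambda>m. X m j) \<longlonglongrightarrow> u j; i < n\<rbrakk>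
                \<Longrightarrow> (\<lambda>m. T (X m) i) \<longlonglongrightarrow> T u i"
  shows "\<exists>u. \<forall>i<n. norm (u i) \<le> l \<and> T u i = u i"
proof -
  define raw :: "(nat \<Rightarrow> real) \<Rightarrow> nat \<Rightarrow> complex"
    where "raw = (\<lambda>x j. Complex (l * (2 * x (2*j) - 1)) (l * (2 * x (2*j+1) - 1)))"
  define c where "c = (\<lambda>x j. raw x j * of_real (l / max l (norm (raw x j))))"
  define f :: "(nat \<Rightarrow> real) \<Rightarrow> nat \<Rightarrow> real"
    where "f = (\<lambda>x i. ((if even i then Re (T (c x) (i div 2)) else Im (T (c x) (i div 2))) / l
        + 1) / 2)"
  have cl: "norm (c x j) \<le> l" for x j
  proof (cases "norm (raw x j) \<le> l")
    case False
    then have "norm (c x j) = norm (raw x j) * (l / norm (raw x j))"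
      using l unfolding c_def norm_mult by (simp add: max_def norm_divide)
    then show ?thesis using l False by simp
  qed (use l in \<open>simp add: c_def max_def\<close>)
  have "\<exists>x. (\<forall>j<2*n. x j \<in> {0..1}) \<and> (\<forall>i<2*n. f x i = x i)"
  proof (rule brouwer_cube)
    fix x i assume "i < 2 * n"
    then have "i div 2 < n" by auto
    then have "norm (T (c x) (i div 2)) \<le> l" using range cl by blast
    then have "\<bar>Re (T (c x) (i div 2))\<bar> \<le> l" "\<bar>Im (T (c x) (i div 2))\<bar> \<le> l"
      using abs_Re_le_cmod abs_Im_le_cmod order_trans by blast+
    then have "- l \<le> Re (T (c x) (i div 2))" "Re (T (c x) (i div 2)) \<le> l"
       "- l \<le> Im (T (c x) (i div 2))" "Im (T (c x) (i div 2)) \<le> l" by linarith+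
    then have "- 1 \<le> Re (T (c x) (i div 2)) / l" "Re (T (c x) (i div 2)) / l \<le> 1"
       "- 1 \<le> Im (T (c x) (i div 2)) / l" "Im (T (c x) (i div 2)) / l \<le> 1"
      using l by (simp_all add: le_divide_eq divide_le_eq)
    then show "f x i \<in> {0..1}" unfolding f_def by auto
  next
    fix X :: "nat \<Rightarrow> nat \<Rightarrow> real" and x i assume lim: "\<forall>j<2*n. (\<lambda>m. X m j) \<longlonglongrightarrow> x j" and i: "i < 2 * n"
    have i2: "i div 2 < n" using i by auto
    have "(\<lambda>m. c (X m) j) \<longlonglongrightarrow> c x j" if "j < n" for j
    proof -
      have "(\<lambda>m. raw (X m) j) \<longlonglongrightarrow> raw x j"
        unfolding raw_def using lim that
        by (intro tendsto_Complex tendsto_intros) auto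
      then show ?thesis unfolding c_def using l by (intro tendsto_intros) auto
    qed
    then have "(\<lambda>m. T (c (X m)) (i div 2)) \<longlonglongrightarrow> T (c x) (i div 2)"
      using cl i2 by (intro cont) auto
    then show "(\<lambda>m. f (X m) i) \<longlonglongrightarrow> f x i"
      unfolding f_def using l by (cases "even i") (auto intro!: tendsto_intros)
  qed
  then obtain x where x: "\<And>i. i < 2 * n \<Longrightarrow> f x i = x i" by blast
  have "T (c x) j = c x j" if j: "j < n" for j
  proof -
    have "f x (2*j) = x (2*j)" "f x (2*j+1) = x (2*j+1)" using x j by auto
    then have "Re (T (c x) j) = l * (2 * x (2*j) - 1)" "Im (T (c x) j) = l * (2 * x (2*j+1) - 1)"
      unfolding f_def using l by (simp_all add: field_simps)
    then have e: "T (c x) j = raw x j" by (simp add: raw_def complex_eq_iff)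
    moreover have "norm (T (c x) j) \<le> l" using range cl j by blast
    ultimately show ?thesis using l by (simp add: c_def max_def)
  qed
  then show ?thesis using cl by blast
qed

section \<open>Disc automorphisms and Earl's interpolation\<close>

text \<open>The customary unimodular constant is left out: the arguments use moduli and the two
  values \<open>blaschke_factor a a = 0\<close> and
  \<open>blaschke_factor (- u) 0 = u\<close>.\<close>

definition blaschke_factor :: "complex \<Rightarrow> complex \<Rightarrow> complex" where
  "blaschke_factor a z = (z - a) / (1 - cnj a * z)"

lemma one_minus_cnj_mult_nonzero:
  fixes a z :: complex
  assumes "norm a * norm z < 1"
  shows "1 - cnj a * z \<noteq> 0"
proof
  assume "1 - cnj a * z = 0"
  then have "cnj a * z = 1" by simp
  then have "norm (cnj a * z) = 1" by simp
  then show False using assms by (simp add: norm_mult)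
qed

lemma one_minus_cnj_mult_nonzero':
  fixes a z :: complex
  assumes "norm a < 1" "norm z \<le> 1"
  shows "1 - cnj a * z \<noteq> 0"
proof (rule one_minus_cnj_mult_nonzero)
  have "norm a * norm z \<le> norm a * 1" using assms by (intro mult_left_mono) auto
  then show "norm a * norm z < 1" using assms by simp
qed

text \<open>For z in the disc the right-hand side is the squared modulus of the inner product of the
  normalized Hardy space kernels at \<open>a\<close> and \<open>z\<close>; this is how
  pseudohyperbolic distances enter the Gram matrix. For z on the circle it gives modulus 1.\<close>

lemma one_minus_blaschke_factor:
  assumes "norm a < 1" "norm z \<le> 1"
  shows "1 - (norm (blaschke_factor a z))\<^sup>2 =
    (1 - (norm a)\<^sup>2) * (1 - (norm z)\<^sup>2) / (norm (1 - cnj a * z))\<^sup>2"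
proof -
  have nz: "norm (1 - cnj a * z) \<noteq> 0" using one_minus_cnj_mult_nonzero'[OF assms] by simp
  have "(norm (1 - cnj a * z))\<^sup>2 - (norm (z - a))\<^sup>2 = (1 - (norm a)\<^sup>2) * (1 - (norm z)\<^sup>2)"
    unfolding cmod_power2 by (simp add: power2_eq_square algebra_simps)
  moreover have "1 - (norm (blaschke_factor a z))\<^sup>2 =
      ((norm (1 - cnj a * z))\<^sup>2 - (norm (z - a))\<^sup>2) / (norm (1 - cnj a * z))\<^sup>2"
    using nz by (simp only: blaschke_factor_def norm_divide power_divide diff_divide_distrib[of
        "(norm (1 - cnj a * z))\<^sup>2"]) simp
  ultimately show ?thesis by simp
qed

lemma norm_blaschke_factor_le_1:
  assumes "norm a < 1" "norm z \<le> 1"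
  shows "norm (blaschke_factor a z) \<le> 1"
proof -
  have "1 - (norm (blaschke_factor a z))\<^sup>2 \<ge> 0"
    unfolding one_minus_blaschke_factor[OF assms] using assms
    by (intro divide_nonneg_nonneg mult_nonneg_nonneg) (auto simp: power_le_one)
  then have "(norm (blaschke_factor a z))\<^sup>2 \<le> 1\<^sup>2" by simp
  then show ?thesis by (rule power2_le_imp_le) simp
qed

lemma norm_blaschke_factor_commute:
  "norm (blaschke_factor a z) = norm (blaschke_factor z a)"
proof -
  have "1 - cnj z * a = cnj (1 - cnj a * z)" by simp
  then have "norm (1 - cnj z * a) = norm (1 - cnj a * z)" by (metis complex_mod_cnj)
  then show ?thesis by (simp add: blaschke_factor_def norm_divide norm_minus_commute)
qed

lemma holomorphic_blaschke_factor:
  assumes "norm a < 1"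
  shows "blaschke_factor a holomorphic_on ball 0 1"
  unfolding blaschke_factor_def[abs_def]
  by (intro holomorphic_intros) (use assms one_minus_cnj_mult_nonzero' in auto)

text \<open>The Blaschke factor on the real line. For l <= x <= 1 and 0 < l < 1 it is the least
  modulus of \<open>blaschke_factor u b\<close> over norm u <= l and norm b = x.\<close>

definition hyp_diff :: "real \<Rightarrow> real \<Rightarrow> real" where
  "hyp_diff l x = (x - l) / (1 - l * x)"

lemma divide_le_divideI:
  fixes a b c d :: real
  assumes "0 < b" "0 < d" "a * d \<le> c * b"
  shows "a / b \<le> c / d"
  using assms by (simp add: divide_le_eq le_divide_eq)

text \<open>For two factors x and y the cross-multiplied difference is l (1 + l) (1 - x y) (1 - x)
  (1 - y), which is nonnegative. The assumption on the whole product forces every single factor to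
  be at least \<open>l\<close>, so that all \<open>hyp_diff\<close> involved are nonnegative and the
  induction can multiply inequalities.\<close>

lemma hyp_diff_prod:
  assumes l: "0 < l" "l < 1" and F: "finite F"
    and x: "\<And>k. k \<in> F \<Longrightarrow> 0 \<le> x k \<and> x k \<le> 1" and P: "l \<le> (\<Prod>k\<in>F. x k)"
  shows "hyp_diff l (\<Prod>k\<in>F. x k) \<le> (\<Prod>k\<in>F. hyp_diff l (x k))"
  using F x P
proof (induction F)
  case empty
  then show ?case using l by (simp add: hyp_diff_def)
next
  case (insert a F)
  define Q where "Q = (\<Prod>k\<in>F. x k)"
  have Q: "0 \<le> Q" "Q \<le> 1" unfolding Q_def using insert.prems by (auto intro: prod_nonneg prod_le_1)
  have xa: "0 \<le> x a" "x a \<le> 1" using insert.prems by auto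
  have lQ: "l \<le> x a * Q" using insert by (simp add: Q_def)
  have "x a * Q \<le> 1 * Q" "x a * Q \<le> x a * 1" using Q xa
      by (intro mult_right_mono mult_left_mono; simp)+
  then have l2: "l \<le> x a" "l \<le> Q" using lQ by auto
  have IH: "hyp_diff l Q \<le> (\<Prod>k\<in>F. hyp_diff l (x k))" using insert l2 by (simp add: Q_def)
  have pos: "1 - l * y > 0" if "0 \<le> y" "y \<le> 1" for y
  proof -
    have "l * y \<le> l * 1" using that l by (intro mult_left_mono) auto
    then show ?thesis using l(2) by linarith
  qed
  have h0: "hyp_diff l (x a) \<ge> 0" unfolding hyp_diff_def using l2 pos[OF xa] by simp
  have "(x a - l) * (Q - l) * (1 - l * (x a * Q)) - (x a * Q - l) * ((1 - l * x a) * (1 - l * Q))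
      = l * (1 + l) * ((1 - x a * Q) * ((1 - x a) * (1 - Q)))" by (simp add: algebra_simps)
  also have "\<dots> \<ge> 0" using l xa Q by (intro mult_nonneg_nonneg) (auto simp: mult_le_one)
  finally have "(x a * Q - l) * ((1 - l * x a) * (1 - l * Q)) \<le> (x a - l) * (Q - l) * (1
      - l * (x a * Q))" by simp
  then have "hyp_diff l (x a * Q) \<le> hyp_diff l (x a) * hyp_diff l Q"
    unfolding hyp_diff_def times_divide_times_eq
    using pos[OF xa] pos[OF Q] pos[of "x a * Q"] xa Q
    by (intro divide_le_divideI mult_pos_pos) (simp_all add: mult_le_one)
  also have "\<dots> \<le> hyp_diff l (x a) * (\<Prod>k\<in>F. hyp_diff l (x k))" using IH h0 by (rule mult_left_mono)
  finally show ?case using insert by (simp add: Q_def)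
qed

text \<open>With s = norm u and t = norm b, the denominator of \<open>blaschke_factor u b\<close>
  has modulus at least 1 - s t. Inserted into the formula for 1 - (modulus)^2, this gives the lower
  bound (t - s) / (1 - s t), which decreases in s and is thus smallest at s = l.\<close>

lemma norm_blaschke_factor_ge:
  assumes "norm u \<le> l" "0 < l" "l < 1" "l \<le> norm b" "norm b \<le> 1"
  shows "hyp_diff l (norm b) \<le> norm (blaschke_factor u b)"
proof (rule power2_le_imp_le)
  define s t where "s = norm u" "t = norm b"
  have st: "0 \<le> s" "s \<le> l" "l \<le> t" "t \<le> 1" using assms by (auto simp: s_t_def)
  have lt: "l * t \<le> l * 1" using st assms by (intro mult_left_mono) auto
  have stl: "s * t \<le> l * t" using st by (intro mult_right_mono) auto
  have n: "1 - s * t \<le> norm (1 - cnj u * b)"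
    using norm_triangle_ineq2[of 1 "cnj u * b"] by (simp add: norm_mult s_t_def)
  have p: "0 < 1 - s * t" "0 < 1 - l * t" using lt stl assms(3) by linarith+
  have "1 - (norm (blaschke_factor u b))\<^sup>2 = (1 - s\<^sup>2) * (1 - t\<^sup>2) / (norm (1 - cnj u * b))\<^sup>2"
    unfolding s_t_def by (rule one_minus_blaschke_factor) (use assms in auto)
  also have "\<dots> \<le> (1 - s\<^sup>2) * (1 - t\<^sup>2) / (1 - s * t)\<^sup>2"
    using n p st assms by (intro divide_left_mono mult_nonneg_nonneg power_mono mult_pos_pos)
      (auto simp: power_le_one intro: order.strict_trans2)
  also have "(1 - s\<^sup>2) * (1 - t\<^sup>2) = (1 - s * t)\<^sup>2 - (t - s)\<^sup>2"
    by (simp add: power2_eq_square algebra_simps)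
  also have "\<dots> / (1 - s * t)\<^sup>2 = 1 - ((t - s) / (1 - s * t))\<^sup>2"
    using p by (simp add: diff_divide_distrib[of "(1 - s * t)\<^sup>2"] power_divide)
  also have "\<dots> \<le> 1 - (hyp_diff l t)\<^sup>2"
  proof -
    have "(t - s) * (1 - l * t) - (t - l) * (1 - s * t) = (l - s) * (1 - t\<^sup>2)"
        by (simp add: algebra_simps power2_eq_square)
    also have "\<dots> \<ge> 0" using st by (intro mult_nonneg_nonneg) (auto simp: power_le_one)
    finally have "hyp_diff l t \<le> (t - s) / (1 - s * t)"
      unfolding hyp_diff_def using p by (intro divide_le_divideI) simp_all
    moreover have "0 \<le> hyp_diff l t" using st p by (simp add: hyp_diff_def)
    ultimately show ?thesis by (simp add: power_mono)
  qed
  finally show "(hyp_diff l (norm b))\<^sup>2 \<le> (norm (blaschke_factor u b))\<^sup>2" by (simp add: s_t_def)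
qed simp


lemma hyp_diff_mono:
  assumes "0 < l" "l < 1" "x \<le> y" "y \<le> 1"
  shows "hyp_diff l x \<le> hyp_diff l y"
proof -
  have lt: "l * x \<le> l * y" "l * y \<le> l * 1" using assms by (intro mult_left_mono; simp)+
  have "(y - l) * (1 - l * x) - (x - l) * (1 - l * y) = (1 - l\<^sup>2) * (y - x)"
    by (simp add: algebra_simps power2_eq_square)
  also have "\<dots> \<ge> 0" using assms by (intro mult_nonneg_nonneg) (auto simp: power_le_one)
  finally show ?thesis
    unfolding hyp_diff_def using lt assms(2) by (intro divide_le_divideI) linarith+
qed

lemma hyp_diff_pos: "0 < l \<Longrightarrow> l < x \<Longrightarrow> x \<le> 1 \<Longrightarrow> 0 < hyp_diff l x"
proof -
  assume a: "0 < l" "l < x" "x \<le> 1"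
  have "l * x \<le> l * 1" using a by (intro mult_left_mono) auto
  then show ?thesis unfolding hyp_diff_def using a by (intro divide_pos_pos) linarith+
qed

text \<open>The values \<open>u k\<close> of the factors at \<open>z k\<close> are adjusted by Brouwer's theorem until the whole
  product takes the prescribed values.\<close>

lemma earl_interpolation_aux:
  fixes z w :: "nat \<Rightarrow> complex"
  assumes l: "0 < l" "l < d" "d \<le> 1"
    and z: "\<And>j. j < n \<Longrightarrow> norm (z j) < 1"
    and sep: "\<And>j. j < n \<Longrightarrow> d \<le> (\<Prod>k\<in>{..<n} - {j}. norm (blaschke_factor (z k) (z j)))"
    and w: "\<And>j. j < n \<Longrightarrow> norm (w j) \<le> 1"
  shows "\<exists>\<phi>. \<phi> holomorphic_on ball 0 1 \<and> (\<forall>x\<in>ball 0 1. norm (\<phi> x) \<le> 1) \<and>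
           (\<forall>j<n. \<phi> (z j) = of_real (l * hyp_diff l d) * w j)"
proof -
  \<comment> \<open>The product \<open>p\<close> of the other factors has modulus at least
    \<open>hyp_diff l d\<close>, so \<open>c\<close> is the size for which |T u j| <= c / hyp_diff l
    d = l and \<open>T\<close> preserves the discs of radius \<open>l\<close>. A fixed point of
    \<open>T\<close> satisfies u j * p u j = c * w j, and since the automorphism
    \<open>\<psi> u j\<close> sends z j to u j, the left-hand side is the value of the full product
    at z j.\<close>
  define c where "c = l * hyp_diff l d"
  define \<psi> where "\<psi> = (\<lambda>u k x. blaschke_factor (- u k) (blaschke_factor (z k) x))"
  define p where "p = (\<lambda>u j. \<Prod>k\<in>{..<n} - {j}. \<psi> u k (z j))"
  define T where "T = (\<lambda>u j. of_real c * w j / p u j)"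
  have l1: "l < 1" using l by simp
  have hp: "hyp_diff l d > 0" using l by (intro hyp_diff_pos)
  have b1: "norm (blaschke_factor (z k) (z j)) \<le> 1" if "k < n" "j < n" for j k
    using z that by (intro norm_blaschke_factor_le_1) (auto intro: less_imp_le)
  have p_ge: "hyp_diff l d \<le> norm (p u j)" if u: "\<forall>j<n. norm (u j) \<le> l" and j: "j < n" for u j
  proof -
    let ?P = "\<Prod>k\<in>{..<n} - {j}. norm (blaschke_factor (z k) (z j))"
    have P1: "?P \<le> 1" using b1 j by (intro prod_le_1) auto
    have fac: "l \<le> norm (blaschke_factor (z k) (z j))" if k: "k \<in> {..<n} - {j}" for k
    proof -
      have "?P = norm (blaschke_factor (z k) (z j)) * (\<Prod>i\<in>{..<n} - {j}
          - {k}. norm (blaschke_factor (z i) (z j)))"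
        by (rule prod.remove) (use k in auto)
      also have "\<dots> \<le> norm (blaschke_factor (z k) (z j)) * 1"
        using b1 j by (intro mult_left_mono prod_le_1) auto
      finally show ?thesis using sep[OF j] l by simp
    qed
    have "hyp_diff l d \<le> hyp_diff l ?P" by (intro hyp_diff_mono l l1 sep j P1)
    also have "\<dots> \<le> (\<Prod>k\<in>{..<n} - {j}. hyp_diff l (norm (blaschke_factor (z k) (z j))))"
      by (rule hyp_diff_prod) (use l l1 b1 j sep[OF j] in auto)
    also have "\<dots> \<le> (\<Prod>k\<in>{..<n} - {j}. norm (\<psi> u k (z j)))"
    proof (intro prod_mono conjI)
      fix k assume k: "k \<in> {..<n} - {j}"
      have "l * norm (blaschke_factor (z k) (z j)) \<le> l * 1" using b1 k j l
          by (intro mult_left_mono) auto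
      then show "0 \<le> hyp_diff l (norm (blaschke_factor (z k) (z j)))"
        unfolding hyp_diff_def using fac[OF k] l1 by (intro divide_nonneg_nonneg) linarith+
      show "hyp_diff l (norm (blaschke_factor (z k) (z j))) \<le> norm (\<psi> u k (z j))"
        unfolding \<psi>_def by (rule norm_blaschke_factor_ge) (use u k fac[OF k] b1 j l l1 in auto)
    qed
    finally show ?thesis by (simp add: p_def prod_norm)
  qed
  have nz: "1 - cnj (- u) * blaschke_factor (z k) (z j) \<noteq> 0" if "norm u \<le> l" "k < n" "j < n"
      for u k j
    using that b1 l1 by (intro one_minus_cnj_mult_nonzero') auto
  have "\<exists>u. \<forall>i<n. norm (u i) \<le> l \<and> T u i = u i"
  proof (rule brouwer_discs)
    fix u i assume u: "\<forall>j<n. norm (u j :: complex) \<le> l" and i: "i < n"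
    have "norm (T u i) \<le> c * 1 / hyp_diff l d"
      unfolding T_def norm_divide norm_mult using p_ge[OF u i] w[OF i] hp l
      by (intro frac_le mult_mono) (auto simp: c_def norm_mult)
    then show "norm (T u i) \<le> l" using hp by (simp add: c_def)
  next
    fix X :: "nat \<Rightarrow> nat \<Rightarrow> complex" and u i
    assume X: "\<forall>m. \<forall>j<n. norm (X m j) \<le> l" and lim: "\<forall>j<n. (\<lambda>m. X m j) \<longlonglongrightarrow> u j" and i: "i < n"
    have u: "\<forall>j<n. norm (u j) \<le> l"
      using X lim by (auto intro!: LIMSEQ_le_const2[OF tendsto_norm])
    have "(\<lambda>m. p (X m) i) \<longlonglongrightarrow> p u i"
      unfolding p_def \<psi>_def blaschke_factor_def[of "- _"] using lim nz[of "u _" _ i] i u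
      by (intro tendsto_intros) auto
    moreover have "p u i \<noteq> 0" using p_ge[OF u i] hp by auto
    ultimately show "(\<lambda>m. T (X m) i) \<longlonglongrightarrow> T u i"
      unfolding T_def by (intro tendsto_intros)
  qed (use l in auto)
  then obtain u where u: "\<And>i. i < n \<Longrightarrow> norm (u i) \<le> l" and fixp: "\<And>i. i < n \<Longrightarrow> T u i = u i" by blast
  define \<phi> where "\<phi> = (\<lambda>x. \<Prod>k<n. \<psi> u k x)"
  have bn: "norm (blaschke_factor (z k) x) \<le> 1" if "k < n" "x \<in> ball 0 1" for k x
    using that z by (intro norm_blaschke_factor_le_1) auto
  have nz': "1 - cnj (- u k) * blaschke_factor (z k) x \<noteq> 0" if "k < n" "x \<in> ball 0 1" for k x
    using u[OF that(1)] bn[OF that] l1 by (intro one_minus_cnj_mult_nonzero') auto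
  show ?thesis
  proof (intro exI[of _ \<phi>] conjI ballI allI impI)
    show "\<phi> holomorphic_on ball 0 1"
      unfolding \<phi>_def \<psi>_def blaschke_factor_def[of "- _"]
      by (intro holomorphic_intros holomorphic_blaschke_factor)
        (use z nz' in auto)
    show "norm (\<phi> x) \<le> 1" if "x \<in> ball 0 1" for x
      unfolding \<phi>_def prod_norm[symmetric] \<psi>_def
      by (intro prod_le_1 conjI norm_ge_zero norm_blaschke_factor_le_1 bn that)
        (use u l1 in \<open>auto dest: order.strict_trans1\<close>)
    fix j assume j: "j < n"
    have "\<psi> u j (z j) = u j" by (simp add: \<psi>_def blaschke_factor_def)
    then have "\<phi> (z j) = u j * p u j"
      unfolding \<phi>_def p_def using prod.remove[of "{..<n}" j "\<lambda>k. \<psi> u k (z j)"] j by simp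
    moreover have "p u j \<noteq> 0" using p_ge[of u j] u hp j by auto
    ultimately show "\<phi> (z j) = of_real (l * hyp_diff l d) * w j"
      using fixp[OF j] by (simp add: T_def c_def divide_eq_eq)
  qed
qed

lemma earl_interpolation:
  fixes z w :: "nat \<Rightarrow> complex"
  assumes l: "0 < l" "l < d" "d \<le> 1" and F: "finite F"
    and z: "\<And>j. j \<in> F \<Longrightarrow> norm (z j) < 1"
    and sep: "\<And>j. j \<in> F \<Longrightarrow> d \<le> (\<Prod>k\<in>F - {j}. norm (blaschke_factor (z k) (z j)))"
    and w: "\<And>j. j \<in> F \<Longrightarrow> norm (w j) \<le> 1"
  shows "\<exists>\<phi>. \<phi> holomorphic_on ball 0 1 \<and> (\<forall>x\<in>ball 0 1. norm (\<phi> x) \<le> 1) \<and>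
           (\<forall>j\<in>F. \<phi> (z j) = of_real (l * hyp_diff l d) * w j)"
proof -
  obtain h where h: "bij_betw h {..<card F} F"
    using ex_bij_betw_nat_finite[OF F] by (auto simp: lessThan_atLeast0)
  have hF: "h j \<in> F" if "j < card F" for j using h that by (auto simp: bij_betw_def)
  have "\<exists>\<phi>. \<phi> holomorphic_on ball 0 1 \<and> (\<forall>x\<in>ball 0 1. norm (\<phi> x) \<le> 1) \<and>
           (\<forall>j<card F. \<phi> ((z \<circ> h) j) = of_real (l * hyp_diff l d) * (w \<circ> h) j)"
  proof (rule earl_interpolation_aux[OF l])
    fix j assume j: "j < card F"
    have "bij_betw h ({..<card F} - {j}) (F - {h j})"
      using bij_betw_DiffI[OF h, of "{j}" "{h j}"] j hF[OF j] by auto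
    from prod.reindex_bij_betw[OF this, of "\<lambda>k. norm (blaschke_factor (z k) (z (h j)))"]
    show "d \<le> (\<Prod>k\<in>{..<card F} - {j}. norm (blaschke_factor ((z \<circ> h) k) ((z \<circ> h) j)))"
      using sep[OF hF[OF j]] by simp
  qed (use z w hF in auto)
  moreover have "\<exists>i<card F. h i = j" if "j \<in> F" for j
    using h that by (metis bij_betw_imp_surj_on image_iff lessThan_iff)
  ultimately show ?thesis by (metis comp_apply)
qed

section \<open>The Hardy space\<close>

lemma taylor_sums:
  assumes "f holomorphic_on unit_disc" "norm z < 1"
  shows "(\<lambda>n. taylor_coeff f n * z ^ n) sums f z"
  using holomorphic_power_series[OF assms(1), of z] assms(2) by (simp add: taylor_coeff_def)

lemma taylor_coeff_unique:
  assumes "\<And>z. norm z < 1 \<Longrightarrow> (\<lambda>n. a n * z ^ n) sums f z"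
  shows "taylor_coeff f n = a n"
proof -
  have "f has_fps_expansion Abs_fps a"
  proof (rule has_fps_expansionI)
    have "eventually (\<lambda>u. u \<in> ball 0 1) (nhds (0::complex))" by (rule eventually_nhds_in_open) auto
    then show "eventually (\<lambda>u. (\<lambda>n. fps_nth (Abs_fps a) n * u ^ n) sums f u) (nhds 0)"
      by eventually_elim (use assms in auto)
  qed
  from fps_nth_fps_expansion[OF this] show ?thesis by (simp add: taylor_coeff_def)
qed

lemma holomorphic_on_unit_disc_sums:
  assumes "\<And>z. norm z < 1 \<Longrightarrow> (\<lambda>n. a n * z ^ n) sums f z"
  shows "f holomorphic_on unit_disc"
  by (rule power_series_holomorphic[of 0 1 a]) (use assms in auto)

lemma taylor_coeff_cong:
  assumes "f holomorphic_on unit_disc" "\<And>z. norm z < 1 \<Longrightarrow> g z = f z"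
  shows "taylor_coeff g = taylor_coeff f"
  by (intro ext taylor_coeff_unique) (use assms taylor_sums in auto)

lemma taylor_coeff_add:
  assumes "f holomorphic_on unit_disc" "g holomorphic_on unit_disc"
  shows "taylor_coeff (\<lambda>z. f z + g z) n = taylor_coeff f n + taylor_coeff g n"
  by (rule taylor_coeff_unique) (use assms in \<open>auto simp: distrib_right intro!: sums_add
      taylor_sums\<close>)

lemma taylor_coeff_cmult:
  assumes "f holomorphic_on unit_disc"
  shows "taylor_coeff (\<lambda>z. c * f z) n = c * taylor_coeff f n"
  by (rule taylor_coeff_unique) (use assms in \<open>auto simp: mult.assoc intro!: sums_mult taylor_sums\<close>)

lemma taylor_coeff_0 [simp]: "taylor_coeff (\<lambda>z. 0) n = 0"
  by (rule taylor_coeff_unique) auto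


lemma H2_holomorphic: "f \<in> H2 \<Longrightarrow> f holomorphic_on unit_disc"
  by (simp add: H2_def)

lemma H2_summable: "f \<in> H2 \<Longrightarrow> summable (\<lambda>n. (norm (taylor_coeff f n))\<^sup>2)"
  by (simp add: H2_def)


text \<open>Elements of \<open>H2\<close> are total functions with arbitrary values off the disc.
  Factorizations hold only inside it, and this carries them into inner products.\<close>

lemma H2_inner_cong:
  assumes "f \<in> H2" "g \<in> H2" "\<And>z. norm z < 1 \<Longrightarrow> f' z = f z" "\<And>z. norm z < 1 \<Longrightarrow> g' z = g z"
  shows "H2_inner f' g' = H2_inner f g"
  using taylor_coeff_cong[of f f'] taylor_coeff_cong[of g g'] assms
      by (simp add: H2_inner_def H2_def)

lemma H2_norm_cong:
  assumes "f \<in> H2" "\<And>z. norm z < 1 \<Longrightarrow> g z = f z"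
  shows "H2_norm g = H2_norm f"
  using taylor_coeff_cong[of f g] assms by (simp add: H2_norm_def H2_def)

lemma summable_norm_mult:
  fixes a b :: "nat \<Rightarrow> complex"
  assumes "summable (\<lambda>n. (norm (a n))\<^sup>2)" "summable (\<lambda>n. (norm (b n))\<^sup>2)"
  shows "summable (\<lambda>n. norm (a n) * norm (b n))"
proof (rule summable_comparison_test')
  show "summable (\<lambda>n. (norm (a n))\<^sup>2 + (norm (b n))\<^sup>2)" using assms by (rule summable_add)
  show "norm (norm (a n) * norm (b n)) \<le> (norm (a n))\<^sup>2 + (norm (b n))\<^sup>2" if "n \<ge> 0" for n
    using sum_squares_bound[of "norm (a n)" "norm (b n)"] mult_nonneg_nonneg[of "norm (a n)" "norm
        (b n)"]
    by (simp del: mult_nonneg_nonneg)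
qed

lemma H2_add:
  assumes "f \<in> H2" "g \<in> H2" shows "(\<lambda>z. f z + g z) \<in> H2"
proof -
  let ?a = "taylor_coeff f" and ?b = "taylor_coeff g"
  have "summable (\<lambda>n. (norm (?a n + ?b n))\<^sup>2)"
  proof (rule summable_comparison_test')
    show "summable (\<lambda>n. 2 * ((norm (?a n))\<^sup>2 + (norm (?b n))\<^sup>2))"
      using assms by (intro summable_mult summable_add H2_summable)
    fix n :: nat
    have "(norm (?a n + ?b n))\<^sup>2 \<le> (norm (?a n) + norm (?b n))\<^sup>2"
        by (intro power_mono norm_triangle_ineq) auto
    also have "\<dots> \<le> 2 * ((norm (?a n))\<^sup>2 + (norm (?b n))\<^sup>2)"
      using sum_squares_bound[of "norm (?a n)" "norm (?b n)"] by (simp add: power2_sum)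
    finally show "norm ((norm (?a n + ?b n))\<^sup>2) \<le> 2 * ((norm (?a n))\<^sup>2 + (norm (?b n))\<^sup>2)" by simp
  qed
  then show ?thesis using assms
    by (auto simp: H2_def taylor_coeff_add intro!: holomorphic_intros)
qed

lemma H2_cmult:
  assumes "f \<in> H2" shows "(\<lambda>z. c * f z) \<in> H2"
  using assms by (auto simp: H2_def taylor_coeff_cmult norm_mult power_mult_distrib intro!:
      holomorphic_intros summable_mult)

lemma H2_0 [simp]: "(\<lambda>z. 0) \<in> H2"
  by (simp add: H2_def)

lemma H2_diff:
  assumes "f \<in> H2" "g \<in> H2" shows "(\<lambda>z. f z - g z) \<in> H2"
  using H2_add[OF assms(1) H2_cmult[OF assms(2), of "-1"]] by simp

lemma H2_sum:
  assumes "\<And>i. i \<in> F \<Longrightarrow> x i \<in> H2" shows "(\<lambda>z. \<Sum>i\<in>F. c i * x i z) \<in> H2"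
  using assms by (induction F rule: infinite_finite_induct) (auto intro!: H2_add H2_cmult)

lemma H2_inner_sums:
  assumes "f \<in> H2" "g \<in> H2"
  shows "(\<lambda>n. taylor_coeff f n * cnj (taylor_coeff g n)) sums H2_inner f g"
  unfolding H2_inner_def
  by (rule summable_sums, rule summable_norm_cancel)
    (use summable_norm_mult[OF H2_summable H2_summable] assms in \<open>simp add: norm_mult\<close>)

lemma H2_inner_add_left:
  assumes "f \<in> H2" "g \<in> H2" "h \<in> H2"
  shows "H2_inner (\<lambda>z. f z + g z) h = H2_inner f h + H2_inner g h"
proof (rule sums_unique2[OF H2_inner_sums])
  show "(\<lambda>n. taylor_coeff (\<lambda>z. f z + g z) n * cnj (taylor_coeff h n)) sums (H2_inner f h
      + H2_inner g h)"
    using sums_add[OF H2_inner_sums[OF assms(1,3)] H2_inner_sums[OF assms(2,3)]] assms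
    by (simp add: taylor_coeff_add H2_def distrib_right)
qed (use assms H2_add in auto)

lemma H2_inner_cmult_left:
  assumes "f \<in> H2" "h \<in> H2"
  shows "H2_inner (\<lambda>z. c * f z) h = c * H2_inner f h"
proof (rule sums_unique2[OF H2_inner_sums])
  show "(\<lambda>n. taylor_coeff (\<lambda>z. c * f z) n * cnj (taylor_coeff h n)) sums (c * H2_inner f h)"
    using sums_mult[OF H2_inner_sums[OF assms], of c] assms
    by (simp add: taylor_coeff_cmult H2_def mult.assoc)
qed (use assms H2_cmult in auto)

lemma H2_inner_commute:
  assumes "f \<in> H2" "g \<in> H2"
  shows "H2_inner g f = cnj (H2_inner f g)"
proof (rule sums_unique2[OF H2_inner_sums])
  show "(\<lambda>n. taylor_coeff g n * cnj (taylor_coeff f n)) sums cnj (H2_inner f g)"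
    using sums_cnj[THEN iffD2, OF H2_inner_sums[OF assms]] by (simp add: mult.commute)
qed (use assms in auto)

lemma H2_inner_diff_left:
  assumes "f \<in> H2" "g \<in> H2" "h \<in> H2"
  shows "H2_inner (\<lambda>z. f z - g z) h = H2_inner f h - H2_inner g h"
  using H2_inner_add_left[OF assms(1) H2_cmult[OF assms(2), of "-1"] assms(3)]
    H2_inner_cmult_left[OF assms(2,3), of "-1"] by simp

lemma H2_inner_add_right:
  assumes "f \<in> H2" "g \<in> H2" "h \<in> H2"
  shows "H2_inner h (\<lambda>z. f z + g z) = H2_inner h f + H2_inner h g"
  using assms by (simp add: H2_inner_commute[of _ h] H2_add H2_inner_add_left)

lemma H2_inner_diff_right:
  assumes "f \<in> H2" "g \<in> H2" "h \<in> H2"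
  shows "H2_inner h (\<lambda>z. f z - g z) = H2_inner h f - H2_inner h g"
  using assms by (simp add: H2_inner_commute[of _ h] H2_diff H2_inner_diff_left)

lemma H2_inner_cmult_right:
  assumes "f \<in> H2" "h \<in> H2"
  shows "H2_inner h (\<lambda>z. c * f z) = cnj c * H2_inner h f"
  using assms by (simp add: H2_inner_commute[of _ h] H2_cmult H2_inner_cmult_left)

lemma H2_inner_0 [simp]: "H2_inner (\<lambda>z. 0) h = 0" "H2_inner h (\<lambda>z. 0) = 0"
  by (simp_all add: H2_inner_def)

lemma H2_inner_sum_left:
  assumes "\<And>i. i \<in> F \<Longrightarrow> x i \<in> H2" "h \<in> H2"
  shows "H2_inner (\<lambda>z. \<Sum>i\<in>F. c i * x i z) h = (\<Sum>i\<in>F. c i * H2_inner (x i) h)"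
  using assms
proof (induction F rule: infinite_finite_induct)
  case (insert i F)
  have "H2_inner (\<lambda>z. c i * x i z + (\<Sum>i\<in>F. c i * x i z)) h =
      H2_inner (\<lambda>z. c i * x i z) h + H2_inner (\<lambda>z. \<Sum>i\<in>F. c i * x i z) h"
    using insert by (intro H2_inner_add_left H2_sum H2_cmult) auto
  then show ?case using insert by (simp add: H2_inner_cmult_left)
qed auto

lemma H2_inner_sum_right:
  assumes "\<And>i. i \<in> F \<Longrightarrow> x i \<in> H2" "h \<in> H2"
  shows "H2_inner h (\<lambda>z. \<Sum>i\<in>F. c i * x i z) = (\<Sum>i\<in>F. cnj (c i) * H2_inner h (x i))"
proof -
  have "H2_inner h (\<lambda>z. \<Sum>i\<in>F. c i * x i z) = cnj (H2_inner (\<lambda>z. \<Sum>i\<in>F. c i * x i z) h)"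
    using assms by (intro H2_inner_commute H2_sum)
  also have "\<dots> = (\<Sum>i\<in>F. cnj (c i) * H2_inner h (x i))"
    using assms by (simp add: H2_inner_sum_left H2_inner_commute[of _ h])
  finally show ?thesis .
qed

lemma H2_norm_sums:
  assumes "f \<in> H2" shows "(\<lambda>n. (norm (taylor_coeff f n))\<^sup>2) sums (H2_norm f)\<^sup>2"
  using H2_summable[OF assms] by (simp add: H2_norm_def suminf_nonneg summable_sums)

lemma H2_norm_nonneg [simp]: "f \<in> H2 \<Longrightarrow> 0 \<le> H2_norm f"
  using H2_summable[of f] by (simp add: H2_norm_def suminf_nonneg)

lemma H2_norm_partial_sum:
  assumes "f \<in> H2" shows "(\<Sum>n<N. (norm (taylor_coeff f n))\<^sup>2) \<le> (H2_norm f)\<^sup>2"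
  using sum_le_suminf[OF H2_summable[OF assms], of "{..<N}"] sums_unique[OF H2_norm_sums[OF
      assms]] by simp

lemma H2_inner_self:
  assumes "f \<in> H2" shows "H2_inner f f = of_real ((H2_norm f)\<^sup>2)"
proof (rule sums_unique2[OF H2_inner_sums[OF assms assms]])
  show "(\<lambda>n. taylor_coeff f n * cnj (taylor_coeff f n)) sums of_real ((H2_norm f)\<^sup>2)"
    unfolding complex_norm_square[symmetric] by (rule sums_of_real[OF H2_norm_sums[OF assms]])
qed

lemma H2_norm_0 [simp]: "H2_norm (\<lambda>z. 0) = 0"
  by (simp add: H2_norm_def)

lemma H2_norm_cmult:
  assumes "f \<in> H2" shows "H2_norm (\<lambda>z. c * f z) = norm c * H2_norm f"
proof -
  have "(H2_norm (\<lambda>z. c * f z))\<^sup>2 = (norm c * H2_norm f)\<^sup>2"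
  proof (rule sums_unique2[OF H2_norm_sums[OF H2_cmult[OF assms]]])
    show "(\<lambda>n. (norm (taylor_coeff (\<lambda>z. c * f z) n))\<^sup>2) sums (norm c * H2_norm f)\<^sup>2"
      using sums_mult[OF H2_norm_sums[OF assms], of "(norm c)\<^sup>2"] assms
      by (simp add: taylor_coeff_cmult H2_def norm_mult power_mult_distrib)
  qed
  then show ?thesis using assms H2_cmult by (simp add: power2_eq_iff_nonneg)
qed

lemma H2_norm_diff_commute:
  assumes "f \<in> H2" "g \<in> H2"
  shows "H2_norm (\<lambda>z. f z - g z) = H2_norm (\<lambda>z. g z - f z)"
  using H2_norm_cmult[OF H2_diff[OF assms], of "-1"] by simp

lemma H2_Cauchy_Schwarz:
  assumes "f \<in> H2" "g \<in> H2"
  shows "norm (H2_inner f g) \<le> H2_norm f * H2_norm g"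
proof (rule LIMSEQ_le_const2)
  let ?a = "taylor_coeff f" and ?b = "taylor_coeff g"
  show "(\<lambda>N. norm (\<Sum>n<N. ?a n * cnj (?b n))) \<longlonglongrightarrow> norm (H2_inner f g)"
    using H2_inner_sums[OF assms] unfolding sums_def by (rule tendsto_norm)
  have "norm (\<Sum>n<N. ?a n * cnj (?b n)) \<le> H2_norm f * H2_norm g" for N
  proof (rule power2_le_imp_le)
    have "norm (\<Sum>n<N. ?a n * cnj (?b n)) \<le> (\<Sum>n<N. norm (?a n) * norm (?b n))"
      by (rule order_trans[OF norm_sum]) (simp add: norm_mult)
    then have "(norm (\<Sum>n<N. ?a n * cnj (?b n)))\<^sup>2 \<le> (\<Sum>n<N. norm (?a n) * norm (?b n))\<^sup>2"
      by (intro power_mono) auto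
    also have "\<dots> \<le> (\<Sum>n<N. (norm (?a n))\<^sup>2) * (\<Sum>n<N. (norm (?b n))\<^sup>2)"
      by (rule Cauchy_Schwarz_ineq_sum)
    also have "\<dots> \<le> (H2_norm f)\<^sup>2 * (H2_norm g)\<^sup>2"
      by (intro mult_mono H2_norm_partial_sum assms) (auto intro!: sum_nonneg)
    finally show "(norm (\<Sum>n<N. ?a n * cnj (?b n)))\<^sup>2 \<le> (H2_norm f * H2_norm g)\<^sup>2"
      by (simp add: power_mult_distrib)
  qed (use assms in auto)
  then show "\<exists>M. \<forall>N\<ge>M. norm (\<Sum>n<N. ?a n * cnj (?b n)) \<le> H2_norm f * H2_norm g" by blast
qed

lemma H2_norm_add_sq:
  assumes "f \<in> H2" "g \<in> H2"
  shows "(H2_norm (\<lambda>z. f z + g z))\<^sup>2 = (H2_norm f)\<^sup>2 + (H2_norm g)\<^sup>2 + 2 * Re (H2_inner f g)"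
proof -
  have "of_real ((H2_norm (\<lambda>z. f z + g z))\<^sup>2) = H2_inner (\<lambda>z. f z + g z) (\<lambda>z. f z + g z)"
    using assms by (intro H2_inner_self[symmetric] H2_add)
  also have "\<dots> = H2_inner f f + H2_inner g g + (H2_inner f g + cnj (H2_inner f g))"
    using assms by (simp add: H2_inner_add_left H2_inner_add_right H2_add H2_inner_commute[of f g])
  also have "\<dots> = of_real ((H2_norm f)\<^sup>2 + (H2_norm g)\<^sup>2 + 2 * Re (H2_inner f g))"
    using assms by (simp add: H2_inner_self complex_add_cnj)
  finally show ?thesis by (simp only: of_real_eq_iff)
qed

lemma H2_norm_diff_sq:
  assumes "f \<in> H2" "g \<in> H2"
  shows "(H2_norm (\<lambda>z. f z - g z))\<^sup>2 = (H2_norm f)\<^sup>2 + (H2_norm g)\<^sup>2 - 2 * Re (H2_inner f g)"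
  using H2_norm_add_sq[OF assms(1) H2_cmult[OF assms(2), of "-1"]] assms
  by (simp add: H2_norm_cmult[of g "-1", simplified] H2_inner_cmult_right[of g f "-1", simplified])

lemma H2_norm_triangle:
  assumes "f \<in> H2" "g \<in> H2"
  shows "H2_norm (\<lambda>z. f z + g z) \<le> H2_norm f + H2_norm g"
proof (rule power2_le_imp_le)
  have "Re (H2_inner f g) \<le> H2_norm f * H2_norm g"
    using H2_Cauchy_Schwarz[OF assms] complex_Re_le_cmod order_trans by blast
  then show "(H2_norm (\<lambda>z. f z + g z))\<^sup>2 \<le> (H2_norm f + H2_norm g)\<^sup>2"
    using H2_norm_add_sq[OF assms] by (simp add: power2_sum)
qed (use assms in simp)

lemma H2_norm_triangle_diff:
  assumes "f \<in> H2" "g \<in> H2"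
  shows "H2_norm f \<le> H2_norm g + H2_norm (\<lambda>z. f z - g z)"
  using H2_norm_triangle[OF assms(2) H2_diff[OF assms]] by simp

lemma H2_eq_0:
  assumes "f \<in> H2" "H2_norm f = 0" "norm z < 1"
  shows "f z = 0"
proof -
  have "taylor_coeff f n = 0" for n
  proof -
    have "(norm (taylor_coeff f n))\<^sup>2 \<le> (\<Sum>k<Suc n. (norm (taylor_coeff f k))\<^sup>2)"
      by (rule member_le_sum) auto
    also have "\<dots> \<le> 0" using H2_norm_partial_sum[OF assms(1), of "Suc n"] assms(2) by simp
    finally show ?thesis by simp
  qed
  then have "(\<lambda>n. 0) sums f z" using taylor_sums[OF H2_holomorphic[OF assms(1)] assms(3)] by simp
  then show ?thesis using sums_unique2[OF sums_zero] by metis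
qed

section \<open>Reproducing kernels of the Hardy space\<close>

lemma H2_kernel_sums: "norm w < 1 \<Longrightarrow> norm z < 1 \<Longrightarrow> (\<lambda>n. cnj w ^ n * z ^ n) sums H2_kernel w z"
  using geometric_sums[of "cnj w * z"] mult_strict_mono[of "norm w" 1 "norm z" 1]
  by (simp add: H2_kernel_def power_mult_distrib norm_mult)

lemma taylor_coeff_H2_kernel: "norm w < 1 \<Longrightarrow> taylor_coeff (H2_kernel w) n = cnj w ^ n"
  by (rule taylor_coeff_unique) (rule H2_kernel_sums)

lemma H2_kernel_in_H2: "norm w < 1 \<Longrightarrow> H2_kernel w \<in> H2"
proof -
  assume w: "norm w < 1"
  have "H2_kernel w holomorphic_on unit_disc"
    by (rule holomorphic_on_unit_disc_sums) (rule H2_kernel_sums[OF w])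
  moreover have "(norm w)\<^sup>2 < 1" using w by (simp add: abs_square_less_1)
  ultimately show ?thesis using w summable_geometric[of "(norm w)\<^sup>2"]
    by (simp add: H2_def taylor_coeff_H2_kernel norm_power flip: power_mult) (simp add:
        mult.commute)
qed

lemma H2_reproducing:
  assumes "f \<in> H2" "norm w < 1"
  shows "H2_inner f (H2_kernel w) = f w"
  using sums_unique2[OF H2_inner_sums[OF assms(1) H2_kernel_in_H2[OF assms(2)]]] taylor_sums[OF
      H2_holomorphic[OF assms(1)] assms(2)]
  by (simp add: taylor_coeff_H2_kernel assms(2))

section \<open>Circle means and inner functions\<close>

lemma has_integral_cis_mult:
  fixes k :: int
  shows "((\<lambda>t. cis (of_int k * t)) has_integral (if k = 0 then 2 * pi else 0)) {0..2*pi}"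
proof (cases "k = 0")
  case True
  then show ?thesis using has_integral_const_real[of "1::complex" 0 "2*pi"]
      by (simp add: scaleR_conv_of_real)
next
  case False
  define F where "F = (\<lambda>z. exp (\<i> * of_int k * z) / (\<i> * of_int k))"
  have "((\<lambda>t. exp (\<i> * of_int k * of_real t)) has_integral (F (of_real (2*pi))
      - F (of_real 0))) {0..2*pi}"
  proof (rule fundamental_theorem_of_calculus)
    fix t :: real
    have "(F has_field_derivative exp (\<i> * of_int k * of_real t)) (at (of_real t))"
      unfolding F_def using False by (auto intro!: derivative_eq_intros)
    then show "((\<lambda>t. F (of_real t)) has_vector_derivative exp (\<i> * of_int k * of_real t)) (at t
        within {0..2*pi})"
      by (rule has_vector_derivative_real_field)
  qed auto
  moreover have "exp (\<i> * of_int k * of_real (2*pi)) = 1"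
    using exp_integer_2pi[of "of_int k"] by (simp add: mult_ac)
  ultimately have "((\<lambda>t. exp (\<i> * of_int k * of_real t)) has_integral 0) {0..2*pi}"
    by (simp add: F_def)
  moreover have "cis (of_int k * t) = exp (\<i> * of_int k * of_real t)" for t
    by (simp add: cis_conv_exp mult_ac)
  ultimately show ?thesis using False by simp
qed

lemma trig_poly_parseval:
  fixes a :: "nat \<Rightarrow> complex"
  shows "((\<lambda>t. (norm (\<Sum>n<N. a n * cis t ^ n))\<^sup>2) has_integral 2 * pi * (\<Sum>n<N. (norm (a n))\<^sup>2))
      {0..2*pi}"
proof -
  have "((\<lambda>t. \<Sum>m<N. \<Sum>n<N. a m * cnj (a n) * cis (of_int (int m - int n) * t)) has_integral
      (\<Sum>m<N. \<Sum>n<N. a m * cnj (a n) * (if int m - int n = 0 then 2 * pi else 0))) {0..2*pi}"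
    by (intro has_integral_sum has_integral_mult_right has_integral_cis_mult) auto
  also have "(\<Sum>m<N. \<Sum>n<N. a m * cnj (a n) * of_real (if int m - int n = 0 then 2 * pi else 0)) =
      (\<Sum>m<N. a m * cnj (a m) * of_real (2 * pi))"
    by (intro sum.cong refl) (simp add: if_distrib[of of_real] if_distrib[of "\<lambda>x. _ *
        x"] sum.delta cong: if_cong)
  also have "\<dots> = of_real (2 * pi * (\<Sum>n<N. (norm (a n))\<^sup>2))"
    by (simp add: complex_norm_square[symmetric] sum_distrib_left mult.commute del: of_real_power)
  finally have I: "((\<lambda>t. \<Sum>m<N. \<Sum>n<N. a m * cnj (a n) * cis (of_int (int m
      - int n) * t)) has_integral
      of_real (2 * pi * (\<Sum>n<N. (norm (a n))\<^sup>2))) {0..2*pi}" .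
  have "((\<lambda>t. Re (\<Sum>m<N. \<Sum>n<N. a m * cnj (a n) * cis (of_int (int m - int n) * t))) has_integral
      (2 * pi * (\<Sum>n<N. (norm (a n))\<^sup>2))) {0..2*pi}"
    using has_integral_linear[OF I bounded_linear_Re] unfolding o_def Re_complex_of_real .
  moreover have "(norm (\<Sum>n<N. a n * cis t ^ n))\<^sup>2 =
      Re (\<Sum>m<N. \<Sum>n<N. a m * cnj (a n) * cis (of_int (int m - int n) * t))" for t
  proof -
    have "of_real ((norm (\<Sum>n<N. a n * cis t ^ n))\<^sup>2) = (\<Sum>m<N. a m * cis t ^ m) * cnj (\<Sum>n<N. a n *
        cis t ^ n)"
      by (rule complex_norm_square)
    also have "\<dots> = (\<Sum>m<N. \<Sum>n<N. a m * cnj (a n) * (cis t ^ m * cnj (cis t) ^ n))"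
      by (simp add: sum_product mult_ac)
    also have "\<dots> = (\<Sum>m<N. \<Sum>n<N. a m * cnj (a n) * cis (of_int (int m - int n) * t))"
      by (simp add: Complex.DeMoivre cis_cnj cis_mult algebra_simps)
    finally show ?thesis by (metis Re_complex_of_real)
  qed
  ultimately show ?thesis by simp
qed

lemma taylor_coeff_abs_summable:
  assumes "f holomorphic_on unit_disc" "0 \<le> r" "r < 1"
  shows "summable (\<lambda>n. norm (taylor_coeff f n) * r ^ n)"
proof -
  define s where "s = (r + 1) / 2"
  have s: "r < s" "s < 1" using assms by (auto simp: s_def)
  have "summable (\<lambda>n. taylor_coeff f n * of_real s ^ n)"
    using taylor_sums[OF assms(1), of "of_real s"] s assms by (auto simp: sums_iff)
  from powser_insidea[OF this, of "of_real r"] show ?thesis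
    using s assms by (simp add: norm_mult norm_power)
qed

text \<open>The polynomial version passes to the limit by dominated convergence: at a radius below 1
  the Taylor series converges absolutely, and the square of its absolute sum \<open>A\<close>
  dominates all partial sums.\<close>

lemma circle_parseval:
  assumes f: "f holomorphic_on unit_disc" and r: "0 \<le> r" "r < 1"
  shows "summable (\<lambda>n. (norm (taylor_coeff f n))\<^sup>2 * r ^ (2 * n))"
    and "((\<lambda>t. (norm (f (of_real r * cis t)))\<^sup>2) has_integral
      2 * pi * (\<Sum>n. (norm (taylor_coeff f n))\<^sup>2 * r ^ (2 * n))) {0..2*pi}"
proof -
  define a where "a = (\<lambda>n. taylor_coeff f n * of_real r ^ n)"
  define A where "A = (\<Sum>n. norm (a n))"
  have suma: "summable (\<lambda>n. norm (a n))"
    using taylor_coeff_abs_summable[OF assms] r by (simp add: a_def norm_mult norm_power)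
  have leA: "(\<Sum>n<N. norm (a n)) \<le> A" for N
    unfolding A_def by (rule sum_le_suminf[OF suma]) auto
  have a2: "(norm (a n))\<^sup>2 = (norm (taylor_coeff f n))\<^sup>2 * r ^ (2 * n)" for n
    using r by (simp add: a_def norm_mult norm_power power_mult_distrib power_mult[symmetric]
        mult.commute)
  have sum2: "summable (\<lambda>n. (norm (a n))\<^sup>2)"
  proof (rule summable_comparison_test')
    show "summable (\<lambda>n. A * norm (a n))" using suma by (rule summable_mult)
    fix n :: nat
    have "norm (a n) \<le> (\<Sum>k<Suc n. norm (a k))" by (rule member_le_sum) auto
    then have "norm (a n) \<le> A" using leA order_trans by blast
    then show "norm ((norm (a n))\<^sup>2) \<le> A * norm (a n)"
        by (simp add: power2_eq_square mult_right_mono)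
  qed
  then show "summable (\<lambda>n. (norm (taylor_coeff f n))\<^sup>2 * r ^ (2 * n))" by (simp add: a2)
  define p where "p = (\<lambda>N t. (norm (\<Sum>n<N. a n * cis t ^ n))\<^sup>2)"
  have p: "(p N has_integral 2 * pi * (\<Sum>n<N. (norm (a n))\<^sup>2)) {0..2*pi}" for N
    unfolding p_def by (rule trig_poly_parseval)
  have lim: "(\<lambda>N. p N t) \<longlonglongrightarrow> (norm (f (of_real r * cis t)))\<^sup>2" for t
  proof -
    have "(\<lambda>n. taylor_coeff f n * (of_real r * cis t) ^ n) sums f (of_real r * cis t)"
      by (rule taylor_sums[OF f]) (use r in \<open>simp add: norm_mult\<close>)
    then have "(\<lambda>N. \<Sum>n<N. a n * cis t ^ n) \<longlonglongrightarrow> f (of_real r * cis t)"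
      by (simp add: sums_def a_def power_mult_distrib mult.assoc)
    then show ?thesis unfolding p_def by (intro tendsto_intros)
  qed
  have bound: "norm (p N t) \<le> A\<^sup>2" for N t
  proof -
    have "norm (\<Sum>n<N. a n * cis t ^ n) \<le> (\<Sum>n<N. norm (a n))"
      by (rule order_trans[OF norm_sum]) (simp add: norm_mult norm_power)
    also have "\<dots> \<le> A" by (rule leA)
    finally show ?thesis by (simp add: p_def power_mono)
  qed
  have "(\<lambda>t. (norm (f (of_real r * cis t)))\<^sup>2) integrable_on {0..2*pi}"
    and *: "(\<lambda>N. integral {0..2*pi} (p N)) \<longlonglongrightarrow> integral {0..2*pi} (\<lambda>t. (norm (f (of_real r * cis
        t)))\<^sup>2)"
    by (rule dominated_convergence[of p _ "\<lambda>_. A\<^sup>2"]; use p bound lim in \<open>auto simp: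
        has_integral_iff\<close>)+
  moreover have "(\<lambda>N. integral {0..2*pi} (p N)) \<longlonglongrightarrow> 2 * pi * (\<Sum>n. (norm (a n))\<^sup>2)"
    using p by (auto simp: has_integral_iff intro!: tendsto_intros summable_LIMSEQ sum2)
  ultimately show "((\<lambda>t. (norm (f (of_real r * cis t)))\<^sup>2) has_integral
      2 * pi * (\<Sum>n. (norm (taylor_coeff f n))\<^sup>2 * r ^ (2 * n))) {0..2*pi}"
    using LIMSEQ_unique by (simp add: has_integral_iff a2 LIMSEQ_unique)
qed

text \<open>Radii close to 1 suffice, since every partial sum is continuous in r up to r =
  1.\<close>

lemma H2_of_bounded_means:
  assumes f: "f holomorphic_on unit_disc" and r0: "r0 < 1"
    and B: "\<And>r N. \<lbrakk>r0 \<le> r; r < 1; 0 \<le> r\<rbrakk> \<Longrightarrow> (\<Sum>n<N. (norm (taylor_coeff f n))\<^sup>2 * r ^ (2 * n)) \<le> B"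
  shows "f \<in> H2" "(H2_norm f)\<^sup>2 \<le> B"
proof -
  have le: "(\<Sum>n<N. (norm (taylor_coeff f n))\<^sup>2) \<le> B" for N
  proof (rule tendsto_upperbound)
    have "((\<lambda>r. \<Sum>n<N. (norm (taylor_coeff f n))\<^sup>2 * r ^ (2 * n)) \<longlongrightarrow> (\<Sum>n<N. (norm (taylor_coeff f
        n))\<^sup>2 * 1 ^ (2 * n))) (at_left (1::real))"
      by (intro tendsto_intros)
    then show "((\<lambda>r. \<Sum>n<N. (norm (taylor_coeff f n))\<^sup>2 * r ^ (2 * n)) \<longlongrightarrow> (\<Sum>n<N. (norm (taylor_coeff
        f n))\<^sup>2)) (at_left (1::real))"
      by simp
    have "\<forall>\<^sub>F r in at_left (1::real). r \<in> {max r0 0<..<1}"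
      using r0 by (intro eventually_at_leftI[of "max r0 0"]) auto
    then show "\<forall>\<^sub>F r in at_left 1. (\<Sum>n<N. (norm (taylor_coeff f n))\<^sup>2 * r ^ (2 * n)) \<le> B"
      by eventually_elim (use B in auto)
  qed auto
  have s: "summable (\<lambda>n. (norm (taylor_coeff f n))\<^sup>2)"
    by (rule summableI_nonneg_bounded[of _ B]) (use le in auto)
  then show "f \<in> H2" using f by (simp add: H2_def)
  have "(\<Sum>n. (norm (taylor_coeff f n))\<^sup>2) \<le> B" by (rule suminf_le_const[OF s le])
  then show "(H2_norm f)\<^sup>2 \<le> B" using s by (simp add: H2_norm_def suminf_nonneg)
qed

lemma circle_sum_le_H2_norm:
  assumes "f \<in> H2" "0 \<le> r" "r < 1"
  shows "(\<Sum>n. (norm (taylor_coeff f n))\<^sup>2 * r ^ (2 * n)) \<le> (H2_norm f)\<^sup>2"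
proof -
  have "(\<Sum>n. (norm (taylor_coeff f n))\<^sup>2 * r ^ (2 * n)) \<le> (\<Sum>n. (norm (taylor_coeff f n))\<^sup>2)"
    using assms by (intro suminf_le circle_parseval H2_holomorphic H2_summable mult_left_le
        power_le_one) auto
  also have "\<dots> = (H2_norm f)\<^sup>2" using H2_norm_sums[OF assms(1)] by (simp add: sums_iff)
  finally show ?thesis .
qed

text \<open>Comparing the functions on an annulus at the circle is enough, by Parseval on circles
  with radii near 1. This is what allows a division by z - a: away from \<open>a\<close> the divisor
  is bounded below.\<close>

lemma H2_comparison:
  assumes f: "f holomorphic_on unit_disc" and g: "g \<in> H2" and M: "0 \<le> M" and r0: "r0 < 1"
    and le: "\<And>z. \<lbrakk>r0 \<le> norm z; norm z < 1\<rbrakk> \<Longrightarrow> norm (f z) \<le> M * norm (g z)"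
  shows "f \<in> H2" "H2_norm f \<le> M * H2_norm g"
proof -
  have B: "(\<Sum>n<N. (norm (taylor_coeff f n))\<^sup>2 * r ^ (2 * n)) \<le> (M * H2_norm g)\<^sup>2"
    if r: "r0 \<le> r" "r < 1" "0 \<le> r" for r N
  proof -
    have "(\<Sum>n<N. (norm (taylor_coeff f n))\<^sup>2 * r ^ (2 * n)) \<le> (\<Sum>n. (norm (taylor_coeff f n))\<^sup>2 * r
        ^ (2 * n))"
      using r f by (intro sum_le_suminf circle_parseval) auto
    also have "2 * pi * \<dots> \<le> M\<^sup>2 * (2 * pi * (\<Sum>n. (norm (taylor_coeff g n))\<^sup>2 * r ^ (2 * n)))"
    proof (rule has_integral_le[OF circle_parseval(2)[OF f r(3,2)]])
      show "((\<lambda>t. M\<^sup>2 * (norm (g (of_real r * cis t)))\<^sup>2) has_integral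
          M\<^sup>2 * (2 * pi * (\<Sum>n. (norm (taylor_coeff g n))\<^sup>2 * r ^ (2 * n)))) {0..2*pi}"
        using g r by (intro has_integral_mult_right circle_parseval H2_holomorphic)
      fix t
      have "norm (f (of_real r * cis t)) \<le> M * norm (g (of_real r * cis t))"
        using r by (intro le) (auto simp: norm_mult)
      then show "(norm (f (of_real r * cis t)))\<^sup>2 \<le> M\<^sup>2 * (norm (g (of_real r * cis t)))\<^sup>2"
        unfolding power_mult_distrib[symmetric] by (intro power_mono) auto
    qed
    then have "(\<Sum>n. (norm (taylor_coeff f n))\<^sup>2 * r ^ (2 * n)) \<le> M\<^sup>2 * (\<Sum>n. (norm (taylor_coeff g
        n))\<^sup>2 * r ^ (2 * n))"
      by (simp add: mult.left_commute[of "M\<^sup>2"])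
    also have "\<dots> \<le> M\<^sup>2 * (H2_norm g)\<^sup>2"
      using g r by (intro mult_left_mono circle_sum_le_H2_norm) auto
    finally show ?thesis by (simp add: power_mult_distrib)
  qed
  show "f \<in> H2" by (rule H2_of_bounded_means[OF f r0 B])
  have "(H2_norm f)\<^sup>2 \<le> (M * H2_norm g)\<^sup>2" by (rule H2_of_bounded_means[OF f r0 B])
  then show "H2_norm f \<le> M * H2_norm g" by (rule power2_le_imp_le) (use M g in simp)
qed

lemma H2_mult:
  assumes "\<phi> holomorphic_on unit_disc" "\<And>z. norm z < 1 \<Longrightarrow> norm (\<phi> z) \<le> M" "f \<in> H2"
  shows "(\<lambda>z. \<phi> z * f z) \<in> H2" "H2_norm (\<lambda>z. \<phi> z * f z) \<le> M * H2_norm f"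
proof -
  have M: "0 \<le> M" using assms(2)[of 0] norm_ge_zero[of "\<phi> 0"] by (simp del: norm_ge_zero)
  have hol: "(\<lambda>z. \<phi> z * f z) holomorphic_on unit_disc"
    using assms H2_holomorphic by (intro holomorphic_on_mult) auto
  have le: "norm (\<phi> z * f z) \<le> M * norm (f z)" if "norm z < 1" for z
    using assms(2)[OF that] by (simp add: norm_mult mult_right_mono)
  show "(\<lambda>z. \<phi> z * f z) \<in> H2" "H2_norm (\<lambda>z. \<phi> z * f z) \<le> M * H2_norm f"
    by (rule H2_comparison[OF hol assms(3) M, of 0]; use le in auto)+
qed

section \<open>Density of polynomials\<close>

definition taylor_poly :: "(complex \<Rightarrow> complex) \<Rightarrow> nat \<Rightarrow> complex \<Rightarrow> complex" where
  "taylor_poly f N z = (\<Sum>n<N. taylor_coeff f n * z ^ n)"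

lemma taylor_coeff_taylor_poly:
  "taylor_coeff (taylor_poly f N) n = (if n < N then taylor_coeff f n else 0)"
proof (rule taylor_coeff_unique)
  fix z :: complex
  show "(\<lambda>n. (if n < N then taylor_coeff f n else 0) * z ^ n) sums taylor_poly f N z"
    using sums_finite[of "{..<N}" "\<lambda>n. (if n < N then taylor_coeff f n else 0) * z ^ n"]
    by (simp add: taylor_poly_def)
qed

lemma taylor_poly_H2: "taylor_poly f N \<in> H2"
proof -
  have "taylor_poly f N holomorphic_on unit_disc"
    unfolding taylor_poly_def[abs_def] by (intro holomorphic_intros)
  moreover have "summable (\<lambda>n. (norm (taylor_coeff (taylor_poly f N) n))\<^sup>2)"
    by (rule summable_finite[of "{..<N}"]) (auto simp: taylor_coeff_taylor_poly)
  ultimately show ?thesis by (simp add: H2_def)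
qed

lemma H2_norm_taylor_poly: "(H2_norm (taylor_poly f N))\<^sup>2 = (\<Sum>n<N. (norm (taylor_coeff f n))\<^sup>2)"
  by (rule sums_unique2[OF H2_norm_sums[OF taylor_poly_H2]], rule sums_cong[THEN
      iffD2, OF _ sums_If_finite_set[of "{..<N}"]])
    (auto simp: taylor_coeff_taylor_poly)

lemma H2_inner_taylor_poly:
  assumes "f \<in> H2"
  shows "H2_inner f (taylor_poly g N) = (\<Sum>n<N. taylor_coeff f n * cnj (taylor_coeff g n))"
proof -
  have "(\<lambda>n. if n \<in> {..<N} then taylor_coeff f n * cnj (taylor_coeff g n) else 0) sums
      (\<Sum>n<N. taylor_coeff f n * cnj (taylor_coeff g n))"
    by (rule sums_If_finite_set) simp
  moreover have "taylor_coeff f n * cnj (taylor_coeff (taylor_poly g N) n) =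
      (if n \<in> {..<N} then taylor_coeff f n * cnj (taylor_coeff g n) else 0)" for n
    by (simp add: taylor_coeff_taylor_poly)
  ultimately have "(\<lambda>n. taylor_coeff f n * cnj (taylor_coeff (taylor_poly g N) n)) sums
      (\<Sum>n<N. taylor_coeff f n * cnj (taylor_coeff g n))" by (simp only:)
  from sums_unique2[OF H2_inner_sums[OF assms taylor_poly_H2] this] show ?thesis .
qed

lemma taylor_poly_tendsto:
  assumes "f \<in> H2"
  shows "(\<lambda>N. H2_norm (\<lambda>z. f z - taylor_poly f N z)) \<longlonglongrightarrow> 0"
proof -
  have "(H2_norm (\<lambda>z. f z - taylor_poly f N z))\<^sup>2 = (H2_norm f)\<^sup>2
      - (\<Sum>n<N. (norm (taylor_coeff f n))\<^sup>2)" for N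
    using assms by (simp add: H2_norm_diff_sq taylor_poly_H2 H2_norm_taylor_poly
        H2_inner_taylor_poly flip: complex_norm_square)
  moreover have "(\<lambda>N. (H2_norm f)\<^sup>2 - (\<Sum>n<N. (norm (taylor_coeff f n))\<^sup>2)) \<longlonglongrightarrow> (H2_norm f)\<^sup>2
      - (H2_norm f)\<^sup>2"
    using H2_norm_sums[OF assms] unfolding sums_def by (intro tendsto_intros)
  ultimately have "(\<lambda>N. sqrt ((H2_norm (\<lambda>z. f z - taylor_poly f N z))\<^sup>2)) \<longlonglongrightarrow> sqrt 0"
    by (intro tendsto_real_sqrt) simp
  then show ?thesis using assms by (simp add: H2_diff taylor_poly_H2)
qed

lemma H2_norm_tendsto:
  assumes "f \<in> H2" "\<And>n. g n \<in> H2" "(\<lambda>n. H2_norm (\<lambda>z. f z - g n z)) \<longlonglongrightarrow> 0"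
  shows "(\<lambda>n. H2_norm (g n)) \<longlonglongrightarrow> H2_norm f"
proof (rule LIM_zero_cancel, rule Lim_null_comparison[OF _ assms(3)])
  have "norm (H2_norm (g n) - H2_norm f) \<le> H2_norm (\<lambda>z. f z - g n z)" for n
    using H2_norm_triangle_diff[OF assms(1,2), of n] H2_norm_triangle_diff[OF assms(2,1), of n]
      H2_norm_diff_commute[OF assms(1,2), of n] by (simp add: abs_le_iff)
  then show "\<forall>\<^sub>F n in sequentially. norm (H2_norm (g n) - H2_norm f) \<le> H2_norm (\<lambda>z. f z - g n z)"
      by simp
qed


text \<open>Turns radial limits into limits along a sequence, as needed for dominated
  convergence.\<close>

lemma filterlim_radii: "filterlim (\<lambda>m. 1 - 1 / real (m + 2)) (at_left 1) sequentially"
proof -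
  have "filterlim (\<lambda>m. real (m + 2)) at_top sequentially"
    by (intro filterlim_compose[OF filterlim_real_sequentially] filterlim_add_const_nat_at_top)
  then have "(\<lambda>m. 1 / real (m + 2)) \<longlonglongrightarrow> 0"
    by (intro tendsto_divide_0[OF tendsto_const] filterlim_at_top_imp_at_infinity)
  then have "(\<lambda>m. 1 - 1 / real (m + 2)) \<longlonglongrightarrow> 1 - 0" by (intro tendsto_intros)
  then show ?thesis by (intro filterlim_at_withinI[of _ _ _ "{..<1}"]) auto
qed

section \<open>Multiplication by an inner function\<close>

lemma inner_function_holomorphic: "inner_function \<Theta> \<Longrightarrow> \<Theta> holomorphic_on unit_disc"
  by (simp add: inner_function_def H_inf_def)

lemma inner_function_bounded:
  assumes "inner_function \<Theta>"
  obtains M where "\<And>z. norm z < 1 \<Longrightarrow> norm (\<Theta> z) \<le> M"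
proof -
  obtain M where "\<forall>z\<in>unit_disc. norm (\<Theta> z) \<le> M"
    using assms unfolding inner_function_def H_inf_def bounded_iff by auto
  then show ?thesis by (intro that[of M]) auto
qed

text \<open>The one use of the boundary values of \<Theta>. A polynomial p is continuous up to the
  circle, so the moduli of \<Theta> p have the radial limits |p| almost everywhere, and dominated
  convergence sends the circle means of \<Theta> p to those of p on the unit circle. Boundary values
  of general Hardy space functions never occur: these are reached by density.\<close>

lemma inner_isometry_poly:
  assumes \<Theta>: "inner_function \<Theta>"
  shows "H2_norm (\<lambda>z. \<Theta> z * taylor_poly g N z) = H2_norm (taylor_poly g N)"
proof -
  obtain M where M: "\<And>z. norm z < 1 \<Longrightarrow> norm (\<Theta> z) \<le> M"
    using inner_function_bounded[OF \<Theta>] by blast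
  define p where "p = taylor_poly g N"
  define f where "f = (\<lambda>z. \<Theta> z * p z)"
  define P where "P = (\<Sum>n<N. norm (taylor_coeff g n))"
  define r where "r = (\<lambda>m. 1 - 1 / real (m + 2))"
  have r: "0 \<le> r m" "r m < 1" for m by (auto simp: r_def)
  have p: "p \<in> H2" unfolding p_def by (rule taylor_poly_H2)
  have fH: "f \<in> H2" unfolding f_def by (rule H2_mult(1)[OF inner_function_holomorphic[OF \<Theta>] M p])
  have contp: "continuous_on A p" for A
    unfolding p_def taylor_poly_def[abs_def] by (intro continuous_intros)
  have pP: "norm (p z) \<le> P" if "norm z \<le> 1" for z
    unfolding p_def taylor_poly_def P_def
    by (rule order_trans[OF norm_sum], rule sum_mono) (use that in \<open>simp add: norm_mult norm_power
        mult_left_le power_le_one\<close>)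
  define S where "S = (\<lambda>m. \<Sum>n. (norm (taylor_coeff f n))\<^sup>2 * r m ^ (2 * n))"
  have par: "((\<lambda>t. (norm (f (of_real (r m) * cis t)))\<^sup>2) has_integral 2 * pi * S m) {0..2*pi}" for m
    unfolding S_def using fH r by (intro circle_parseval H2_holomorphic)
  have contf: "continuous_on {0..2*pi} (\<lambda>t. (norm (f (of_real (r m) * cis t)))\<^sup>2)" for m
    by (intro continuous_intros continuous_on_compose2[OF holomorphic_on_imp_continuous_on[OF
        H2_holomorphic[OF fH]]])
      (use r in \<open>auto simp: norm_mult\<close>)
  have contp': "continuous_on {0..2*pi} (\<lambda>t. (norm (p (cis t)))\<^sup>2)"
    by (intro continuous_intros continuous_on_compose2[OF contp[of UNIV]]) auto
  let ?I = "indicat_real {0..2*pi}"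
  note si = borel_integrable_atLeastAtMost'
  have LB: "(LINT t:{0..2*pi}|lborel. (norm (f (of_real (r m) * cis t)))\<^sup>2) = 2 * pi * S m" for m
    using set_borel_integral_eq_integral(2)[OF si[OF contf]] par by (simp add: has_integral_iff)
  have "((\<lambda>t. (norm (p (cis t)))\<^sup>2) has_integral 2 * pi * (H2_norm p)\<^sup>2) {0..2*pi}"
    unfolding p_def H2_norm_taylor_poly taylor_poly_def by (rule trig_poly_parseval)
  then have LBp: "(LINT t:{0..2*pi}|lborel. (norm (p (cis t)))\<^sup>2) = 2 * pi * (H2_norm p)\<^sup>2"
    using set_borel_integral_eq_integral(2)[OF si[OF contp']] by (simp add: has_integral_iff)
  have "(\<lambda>m. LINT t:{0..2*pi}|lborel. (norm (f (of_real (r m) * cis t)))\<^sup>2) \<longlonglongrightarrow>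
      (LINT t:{0..2*pi}|lborel. (norm (p (cis t)))\<^sup>2)"
    unfolding set_lebesgue_integral_def
  proof (rule integral_dominated_convergence)
    show "integrable lborel (\<lambda>t. ?I t *\<^sub>R (M * P)\<^sup>2)"
      using si[of 0 "2*pi" "\<lambda>_. (M * P)\<^sup>2"] by (simp add: set_integrable_def)
    show "(\<lambda>t. ?I t *\<^sub>R (norm (p (cis t)))\<^sup>2) \<in> borel_measurable lborel"
      using si[OF contp'] by (auto simp: set_integrable_def dest: borel_measurable_integrable)
    show "(\<lambda>t. ?I t *\<^sub>R (norm (f (of_real (r m) * cis t)))\<^sup>2) \<in> borel_measurable lborel" for m
      using si[OF contf[of m]] by (auto simp: set_integrable_def dest: borel_measurable_integrable)
    have "norm (f (of_real (r m) * cis t)) \<le> M * P" for m t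
      unfolding f_def norm_mult using r[of m] M[of "of_real (r m) * cis t"] pP[of "of_real (r m) *
          cis t"]
      by (intro mult_mono) (auto simp: norm_mult intro: order_trans[OF norm_ge_zero])
    then show "AE t in lborel. norm (?I t *\<^sub>R (norm (f (of_real (r m) * cis t)))\<^sup>2)
        \<le> ?I t *\<^sub>R (M * P)\<^sup>2" for m
      by (intro AE_I2) (auto simp: indicator_def intro!: power_mono)
    have "AE t in lborel. t \<in> {0..2 * pi} \<longrightarrow> (\<exists>u. norm u = 1 \<and> ((\<lambda>r. \<Theta> (of_real r * cis t))
        \<longlongrightarrow> u) (at_left 1))"
      using \<Theta> by (simp add: inner_function_def)
    then show "AE t in lborel. (\<lambda>m. ?I t *\<^sub>R (norm (f (of_real (r m) * cis t)))\<^sup>2) \<longlonglongrightarrow> ?I t *\<^sub>R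
        (norm (p (cis t)))\<^sup>2"
    proof eventually_elim
      case (elim t)
      show ?case
      proof (cases "t \<in> {0..2*pi}")
        case True
        then obtain u where u: "norm u = 1" "((\<lambda>r. \<Theta> (of_real r * cis t)) \<longlongrightarrow> u) (at_left 1)"
            using elim by blast
        have "(\<lambda>m. \<Theta> (of_real (r m) * cis t)) \<longlonglongrightarrow> u"
          using filterlim_compose[OF u(2) filterlim_radii] by (simp add: r_def)
        moreover have "r \<longlonglongrightarrow> 1"
          using filterlim_radii unfolding filterlim_at r_def by auto
        then have "(\<lambda>m. of_real (r m) * cis t) \<longlonglongrightarrow> of_real 1 * cis t"
          by (intro tendsto_intros)
        then have "(\<lambda>m. p (of_real (r m) * cis t)) \<longlonglongrightarrow> p (cis t)"
          using continuous_on_tendsto_compose[OF contp[of UNIV]]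
              by (metis UNIV_I always_eventually mult_1 of_real_1)
        ultimately have "(\<lambda>m. (norm (f (of_real (r m) * cis t)))\<^sup>2) \<longlonglongrightarrow> (norm (u * p (cis t)))\<^sup>2"
          unfolding f_def by (intro tendsto_intros)
        then show ?thesis using True u(1) by (simp add: norm_mult)
      qed simp
    qed
  qed
  then have lim0: "(\<lambda>m. 2 * pi * S m) \<longlonglongrightarrow> 2 * pi * (H2_norm p)\<^sup>2" unfolding LB LBp .
  have lim: "S \<longlonglongrightarrow> (H2_norm p)\<^sup>2"
    using tendsto_mult_left[OF lim0, of "1 / (2 * pi)"] by simp
  \<comment> \<open>The circle means also determine the norm of f. Each \<open>S m\<close> is at
    most its square, and every partial sum of the squared coefficients is a limit of sums bounded by
    \<open>S m\<close>.\<close>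
  have "(H2_norm p)\<^sup>2 \<le> (H2_norm f)\<^sup>2"
    by (rule LIMSEQ_le_const2[OF lim]) (use circle_sum_le_H2_norm[OF fH r] in \<open>auto simp: S_def\<close>)
  moreover have "(H2_norm f)\<^sup>2 \<le> (H2_norm p)\<^sup>2"
  proof -
    have "(\<Sum>n<K. (norm (taylor_coeff f n))\<^sup>2) \<le> (H2_norm p)\<^sup>2" for K
    proof (rule LIMSEQ_le[OF _ lim])
      have "(\<lambda>m. \<Sum>n<K. (norm (taylor_coeff f n))\<^sup>2 * r m ^ (2 * n)) \<longlonglongrightarrow> (\<Sum>n<K. (norm (taylor_coeff f
          n))\<^sup>2 * 1 ^ (2 * n))"
        using filterlim_radii unfolding filterlim_at r_def by (intro tendsto_intros) auto
      then show "(\<lambda>m. \<Sum>n<K. (norm (taylor_coeff f n))\<^sup>2 * r m ^ (2 * n)) \<longlonglongrightarrow> (\<Sum>n<K. (norm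
          (taylor_coeff f n))\<^sup>2)" by simp
      show "\<exists>N. \<forall>m\<ge>N. (\<Sum>n<K. (norm (taylor_coeff f n))\<^sup>2 * r m ^ (2 * n)) \<le> S m"
        unfolding S_def using r fH
            by (intro exI allI impI sum_le_suminf circle_parseval H2_holomorphic) auto
    qed
    then have "(\<Sum>n. (norm (taylor_coeff f n))\<^sup>2) \<le> (H2_norm p)\<^sup>2"
      using suminf_le_const[OF H2_summable[OF fH]] by blast
    then show ?thesis using H2_norm_sums[OF fH] by (simp add: sums_iff)
  qed
  ultimately have "(H2_norm f)\<^sup>2 = (H2_norm p)\<^sup>2" by simp
  then show ?thesis using p fH by (simp add: power2_eq_iff_nonneg f_def p_def)
qed

lemma H2_inner_function_mult:
  assumes "inner_function \<Theta>" "f \<in> H2"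
  shows "(\<lambda>z. \<Theta> z * f z) \<in> H2"
proof -
  obtain M where "\<And>z. norm z < 1 \<Longrightarrow> norm (\<Theta> z) \<le> M" using inner_function_bounded[OF assms(1)]
      by blast
  then show ?thesis using H2_mult(1)[OF inner_function_holomorphic] assms by blast
qed

lemma inner_function_norm:
  assumes \<Theta>: "inner_function \<Theta>" and f: "f \<in> H2"
  shows "H2_norm (\<lambda>z. \<Theta> z * f z) = H2_norm f"
proof (rule LIMSEQ_unique)
  obtain M where M: "\<And>z. norm z < 1 \<Longrightarrow> norm (\<Theta> z) \<le> M" using inner_function_bounded[OF \<Theta>] by blast
  note hol = inner_function_holomorphic[OF \<Theta>]
  show "(\<lambda>N. H2_norm (taylor_poly f N)) \<longlonglongrightarrow> H2_norm f"
    by (rule H2_norm_tendsto[OF f taylor_poly_H2 taylor_poly_tendsto[OF f]])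
  have "(\<lambda>N. H2_norm (\<lambda>z. \<Theta> z * taylor_poly f N z)) \<longlonglongrightarrow> H2_norm (\<lambda>z. \<Theta> z * f z)"
  proof (rule H2_norm_tendsto)
    show "(\<lambda>N. H2_norm (\<lambda>z. \<Theta> z * f z - \<Theta> z * taylor_poly f N z)) \<longlonglongrightarrow> 0"
    proof (rule Lim_null_comparison)
      have "(\<lambda>N. M * H2_norm (\<lambda>z. f z - taylor_poly f N z)) \<longlonglongrightarrow> M * 0"
        by (intro tendsto_intros taylor_poly_tendsto f)
      then show "(\<lambda>N. M * H2_norm (\<lambda>z. f z - taylor_poly f N z)) \<longlonglongrightarrow> 0" by simp
      have "H2_norm (\<lambda>z. \<Theta> z * (f z - taylor_poly f N z)) \<le> M * H2_norm (\<lambda>z. f z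
          - taylor_poly f N z)"
           "(\<lambda>z. \<Theta> z * (f z - taylor_poly f N z)) \<in> H2" for N
        using H2_mult[OF hol M H2_diff[OF f taylor_poly_H2]] by blast+
      then show "\<forall>\<^sub>F N in sequentially. norm (H2_norm (\<lambda>z. \<Theta> z * f z - \<Theta> z * taylor_poly f N z))
          \<le> M * H2_norm (\<lambda>z. f z - taylor_poly f N z)"
        by (intro always_eventually allI) (simp add: right_diff_distrib)
    qed
  qed (use H2_inner_function_mult[OF \<Theta>] f taylor_poly_H2 in auto)
  then show "(\<lambda>N. H2_norm (taylor_poly f N)) \<longlonglongrightarrow> H2_norm (\<lambda>z. \<Theta> z * f z)"
    by (simp add: inner_isometry_poly[OF \<Theta>])
qed

text \<open>Polarization: the norms of sums give the real part, and the function \<i> g in place of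
  g gives the imaginary part.\<close>

lemma inner_function_inner:
  assumes \<Theta>: "inner_function \<Theta>" and f: "f \<in> H2" and g: "g \<in> H2"
  shows "H2_inner (\<lambda>z. \<Theta> z * f z) (\<lambda>z. \<Theta> z * g z) = H2_inner f g"
proof -
  let ?T = "\<lambda>f z. \<Theta> z * f z"
  have T: "?T h \<in> H2" if "h \<in> H2" for h using H2_inner_function_mult[OF \<Theta> that] .
  have *: "Re (H2_inner (?T f) (?T h)) = Re (H2_inner f h)" if h: "h \<in> H2" for h
  proof -
    have "(\<lambda>z. ?T f z + ?T h z) = ?T (\<lambda>z. f z + h z)" by (simp add: distrib_left)
    then have "(H2_norm (\<lambda>z. ?T f z + ?T h z))\<^sup>2 = (H2_norm (\<lambda>z. f z + h z))\<^sup>2"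
      using inner_function_norm[OF \<Theta> H2_add[OF f h]] by simp
    then show ?thesis
      using H2_norm_add_sq[OF f h] H2_norm_add_sq[OF T[OF f] T[OF h]] inner_function_norm[OF \<Theta>] f
          h by simp
  qed
  have "Re (H2_inner (?T f) (\<lambda>z. \<i> * ?T g z)) = Re (H2_inner f (\<lambda>z. \<i> * g z))"
    using *[OF H2_cmult[OF g, of \<i>]] by (simp add: mult.left_commute)
  then have "Im (H2_inner (?T f) (?T g)) = Im (H2_inner f g)"
    using f g T by (simp add: H2_inner_cmult_right)
  then show ?thesis using *[OF g] by (simp add: complex_eq_iff)
qed

text \<open>\<open>H_inf\<close> provides some bound only. The bound 1 follows from the isometry and
  the reproducing property: |\<Theta>(w)| times the squared norm of the kernel k at w is the modulus
  of the inner product of \<Theta> k with k.\<close>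

lemma inner_function_le_1:
  assumes \<Theta>: "inner_function \<Theta>" and w: "norm w < 1"
  shows "norm (\<Theta> w) \<le> 1"
proof -
  define k where "k = H2_kernel w"
  have k: "k \<in> H2" unfolding k_def by (rule H2_kernel_in_H2[OF w])
  have kw: "H2_inner k k = 1 / of_real (1 - (norm w)\<^sup>2)"
    unfolding k_def H2_reproducing[OF H2_kernel_in_H2[OF w] w] using complex_norm_square[of w]
        by (simp add: H2_kernel_def mult.commute)
  have pos: "(norm w)\<^sup>2 < 1" using w by (simp add: abs_square_less_1)
  then have knz: "H2_norm k > 0"
    using kw H2_inner_self[OF k] H2_norm_nonneg[OF k] by (cases "H2_norm k
        = 0") (auto simp flip: of_real_diff of_real_power)
  have "norm (\<Theta> w) * (H2_norm k)\<^sup>2 = norm (\<Theta> w * H2_inner k k)"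
    by (simp add: H2_inner_self[OF k] norm_mult norm_power)
  also have "\<Theta> w * H2_inner k k = H2_inner (\<lambda>z. \<Theta> z * k z) k"
    unfolding k_def using w by (simp add: H2_reproducing H2_kernel_in_H2 H2_inner_function_mult[OF
        \<Theta>])
  also have "norm \<dots> \<le> H2_norm k * H2_norm k"
    using H2_Cauchy_Schwarz[OF H2_inner_function_mult[OF \<Theta> k] k] inner_function_norm[OF \<Theta> k] by simp
  finally show ?thesis using knz by (simp add: power2_eq_square)
qed

section \<open>Weak compactness\<close>

text \<open>Weak lower semicontinuity of the norm, tested against the limit alone: the squared norm
  of g is the limit of the inner products with g, which are at most B times the norm of g.\<close>

lemma H2_weak_limit_norm:
  assumes "g \<in> H2" "\<And>m. f m \<in> H2" "(\<lambda>m. H2_inner (f m) g) \<longlonglongrightarrow> H2_inner g g"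
    and "\<forall>\<^sub>F m in sequentially. H2_norm (f m) \<le> B"
  shows "H2_norm g \<le> B"
proof -
  have "norm (H2_inner g g) \<le> B * H2_norm g"
  proof (rule tendsto_upperbound[OF tendsto_norm[OF assms(3)]])
    show "\<forall>\<^sub>F m in sequentially. norm (H2_inner (f m) g) \<le> B * H2_norm g"
      using assms(4)
    proof eventually_elim
      case (elim m)
      have "norm (H2_inner (f m) g) \<le> H2_norm (f m) * H2_norm g"
          by (rule H2_Cauchy_Schwarz[OF assms(2,1)])
      also have "\<dots> \<le> B * H2_norm g" using elim assms(1) by (intro mult_right_mono) auto
      finally show ?case .
    qed
  qed simp
  then have le: "H2_norm g * H2_norm g \<le> B * H2_norm g"
    by (simp only: H2_inner_self[OF assms(1)] norm_of_real) (simp add: power2_eq_square)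
  obtain m where "H2_norm (f m) \<le> B" using assms(4) eventually_happens'[of sequentially] by auto
  then have "0 \<le> B" using H2_norm_nonneg[OF assms(2)[of m]] by linarith
  then show ?thesis using le H2_norm_nonneg[OF assms(1)]
    by (cases "H2_norm g = 0") auto
qed

text \<open>Bounded coefficients have a subsequence converging at every index; Fatou-type bounds on
  partial sums place the limit in \<open>H2\<close>. Convergence against polynomials is then
  immediate, and boundedness extends it to every h by approximation.\<close>

lemma H2_weak_compact:
  assumes f: "\<And>m. f m \<in> H2" and B: "\<And>m. H2_norm (f m) \<le> B"
  obtains s g where "strict_mono (s :: nat \<Rightarrow> nat)" "g \<in> H2"
    "\<And>h. h \<in> H2 \<Longrightarrow> (\<lambda>m. H2_inner (f (s m)) h) \<longlonglongrightarrow> H2_inner g h"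
proof -
  have B0: "0 \<le> B" using B[of 0] H2_norm_nonneg[OF f[of 0]] by linarith
  have sumB: "(\<Sum>n<K. (norm (taylor_coeff (f m) n))\<^sup>2) \<le> B\<^sup>2" for m K
  proof -
    have "(H2_norm (f m))\<^sup>2 \<le> B\<^sup>2" using B f by (intro power_mono) auto
    then show ?thesis using H2_norm_partial_sum[OF f, of m K] by linarith
  qed
  have cB: "norm (taylor_coeff (f m) n) \<le> B" for m n
  proof (rule power2_le_imp_le[OF _ B0])
    have "(norm (taylor_coeff (f m) n))\<^sup>2 \<le> (\<Sum>k<Suc n. (norm (taylor_coeff (f m) k))\<^sup>2)"
      by (rule member_le_sum) auto
    then show "(norm (taylor_coeff (f m) n))\<^sup>2 \<le> B\<^sup>2" using sumB[of m "Suc n"] by linarith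
  qed
  obtain s where s: "strict_mono (s :: nat \<Rightarrow> nat)"
    and ex: "\<And>n. n \<in> (UNIV :: nat set) \<Longrightarrow> \<exists>l. (\<lambda>m. taylor_coeff (f (s m)) n) \<longlonglongrightarrow> l"
    using function_convergent_subsequence[of UNIV "\<lambda>m. taylor_coeff (f m)" B] cB
        by (metis countableI_type)
  obtain l where l: "\<And>n. (\<lambda>m. taylor_coeff (f (s m)) n) \<longlonglongrightarrow> l n" using ex by (metis UNIV_I)
  have lB: "norm (l n) \<le> B" for n
    by (rule LIMSEQ_le_const2[OF tendsto_norm[OF l]]) (use cB in auto)
  define g where "g = (\<lambda>z. \<Sum>n. l n * z ^ n)"
  have g: "(\<lambda>n. l n * z ^ n) sums g z" if z: "norm z < 1" for z
    unfolding g_def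
  proof (rule summable_sums, rule summable_comparison_test')
    show "summable (\<lambda>n. B * norm z ^ n)" using z by (intro summable_mult summable_geometric) simp
    show "norm (l n * z ^ n) \<le> B * norm z ^ n" if "n \<ge> 0" for n
      using lB by (simp add: norm_mult norm_power mult_right_mono)
  qed
  have tg: "taylor_coeff g n = l n" for n by (rule taylor_coeff_unique) (rule g)
  have "(\<Sum>n<K. (norm (l n))\<^sup>2) \<le> B\<^sup>2" for K
    by (rule LIMSEQ_le_const2[of "\<lambda>m. \<Sum>n<K. (norm (taylor_coeff (f (s m)) n))\<^sup>2"])
      (use sumB in \<open>auto intro!: tendsto_intros l\<close>)
  then have "summable (\<lambda>n. (norm (l n))\<^sup>2)" by (intro summableI_nonneg_bounded[of _ "B\<^sup>2"]) auto
  then have gH: "g \<in> H2" using holomorphic_on_unit_disc_sums[OF g] by (simp add: H2_def tg)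
  have "(\<lambda>m. H2_inner (f (s m)) h) \<longlonglongrightarrow> H2_inner g h" if h: "h \<in> H2" for h
  proof (rule LIMSEQ_I)
    fix e :: real assume e: "0 < e"
    \<comment> \<open>A bound for the norms of f (s m) - g; the summand 1 makes it positive.\<close>
    define C where "C = B + H2_norm g + 1"
    have C: "0 < C" using B0 H2_norm_nonneg[OF gH] by (simp add: C_def)
    have "e / (2 * C) > 0" using e C by simp
    from LIMSEQ_D[OF taylor_poly_tendsto[OF h] this] obtain N
      where "norm (H2_norm (\<lambda>z. h z - taylor_poly h N z) - 0) < e / (2 * C)" by blast
    then have N: "H2_norm (\<lambda>z. h z - taylor_poly h N z) < e / (2 * C)" by simp
    let ?p = "taylor_poly h N"
    have "(\<lambda>m. H2_inner (f (s m)) ?p) \<longlonglongrightarrow> H2_inner g ?p"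
      unfolding H2_inner_taylor_poly[OF f] H2_inner_taylor_poly[OF gH] tg
          by (intro tendsto_intros l)
    from LIMSEQ_D[OF this, of "e / 2"] e
    obtain M where M: "\<And>m. m \<ge> M \<Longrightarrow> norm (H2_inner (f (s m)) ?p - H2_inner g ?p) < e / 2" by auto
    have "norm (H2_inner (f (s m)) h - H2_inner g h) < e" if m: "m \<ge> M" for m
    proof -
      let ?q = "\<lambda>z. h z - ?p z" and ?d = "\<lambda>z. f (s m) z - g z"
      have d: "?d \<in> H2" using f gH by (rule H2_diff)
      have q: "?q \<in> H2" using h taylor_poly_H2 by (rule H2_diff)
      have nd: "H2_norm ?d \<le> C"
        using H2_norm_triangle[OF f H2_cmult[OF gH, of "-1"], of "s m"] B[of "s
            m"] H2_norm_cmult[OF gH, of "-1"]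
        by (simp add: C_def)
      have "H2_inner (f (s m)) h - H2_inner g h = H2_inner ?d ?q + (H2_inner (f (s m)) ?p
          - H2_inner g ?p)"
        using d q f gH h taylor_poly_H2 by (simp add: H2_inner_diff_left H2_inner_diff_right)
      then have "norm (H2_inner (f (s m)) h - H2_inner g h) \<le>
          norm (H2_inner ?d ?q) + norm (H2_inner (f (s m)) ?p - H2_inner g ?p)"
        by (simp only: norm_triangle_ineq)
      moreover have "norm (H2_inner ?d ?q) \<le> C * H2_norm ?q"
        by (rule order_trans[OF H2_Cauchy_Schwarz[OF d q] mult_right_mono[OF nd H2_norm_nonneg[OF
            q]]])
      moreover have "C * H2_norm ?q \<le> C * (e / (2 * C))" using N C by (intro mult_left_mono) auto
      moreover have "C * (e / (2 * C)) = e / 2" using C by simp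
      ultimately show ?thesis using M[OF m] by linarith
    qed
    then show "\<exists>M. \<forall>m\<ge>M. norm (H2_inner (f (s m)) h - H2_inner g h) < e" by blast
  qed
  then show ?thesis by (rule that[OF s gH])
qed

section \<open>Weakly closed subspaces\<close>

text \<open>Closedness is stated for weak sequential limits because that is the form in which
  \<open>H2_weak_compact\<close> produces limits, and because a space defined by orthogonality, such
  as a model space, has it at once.\<close>

definition closed_subspace :: "(complex \<Rightarrow> complex) set \<Rightarrow> bool" where
  "closed_subspace H \<longleftrightarrow> H \<subseteq> H2 \<and> (\<lambda>z. 0) \<in> H \<and> (\<forall>f\<in>H. \<forall>g\<in>H. \<forall>c. (\<lambda>z. f z + c * g z) \<in> H) \<and>
     (\<forall>f g. (\<forall>m. f m \<in> H) \<and> g \<in> H2 \<and> (\<forall>h\<in>H2. (\<lambda>m. H2_inner (f m) h) \<longlonglongrightarrow> H2_inner g h) \<longrightarrow> g \<in> H)"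

lemma closed_subspace_H2: "closed_subspace H \<Longrightarrow> f \<in> H \<Longrightarrow> f \<in> H2"
  by (auto simp: closed_subspace_def)

lemma closed_subspace_0: "closed_subspace H \<Longrightarrow> (\<lambda>z. 0) \<in> H"
  by (simp add: closed_subspace_def)

lemma closed_subspace_add_cmult:
  "closed_subspace H \<Longrightarrow> f \<in> H \<Longrightarrow> g \<in> H \<Longrightarrow> (\<lambda>z. f z + c * g z) \<in> H"
  by (simp add: closed_subspace_def)

lemma closed_subspace_cmult: "closed_subspace H \<Longrightarrow> g \<in> H \<Longrightarrow> (\<lambda>z. c * g z) \<in> H"
  using closed_subspace_add_cmult[OF _ closed_subspace_0, of H g c] by simp

lemma closed_subspace_sum:
  assumes "closed_subspace H" "\<And>i. i \<in> F \<Longrightarrow> x i \<in> H"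
  shows "(\<lambda>z. \<Sum>i\<in>F. b i * x i z) \<in> H"
  using assms(2)
proof (induction F rule: infinite_finite_induct)
  case (insert i F)
  then have "(\<lambda>z. (\<Sum>i\<in>F. b i * x i z) + b i * x i z) \<in> H"
    by (intro closed_subspace_add_cmult assms(1)) auto
  then show ?case using insert by (simp add: add.commute)
qed (use closed_subspace_0[OF assms(1)] in auto)

lemma closed_subspace_weak_limit:
  "closed_subspace H \<Longrightarrow> (\<And>m. f m \<in> H) \<Longrightarrow> g \<in> H2 \<Longrightarrow>
    (\<And>h. h \<in> H2 \<Longrightarrow> (\<lambda>m. H2_inner (f m) h) \<longlonglongrightarrow> H2_inner g h) \<Longrightarrow> g \<in> H"
  unfolding closed_subspace_def by blast

text \<open>A weakly convergent subsequence supplies the limit, and weak lower semicontinuity of the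
  norm upgrades the convergence of the whole Cauchy sequence to norm convergence.\<close>

lemma closed_subspace_complete:
  assumes H: "closed_subspace H" and f: "\<And>m. f m \<in> H"
    and Cauchy: "\<And>e. e > 0 \<Longrightarrow> \<exists>N. \<forall>m\<ge>N. \<forall>n\<ge>N. H2_norm (\<lambda>z. f m z - f n z) < e"
  shows "\<exists>g\<in>H. (\<lambda>m. H2_norm (\<lambda>z. g z - f m z)) \<longlonglongrightarrow> 0"
proof -
  note fH = closed_subspace_H2[OF H f]
  obtain N0 where N0: "\<And>m. m \<ge> N0 \<Longrightarrow> H2_norm (\<lambda>z. f m z - f N0 z) < 1"
    using Cauchy[of 1] by auto
  have "H2_norm (f (m + N0)) \<le> H2_norm (f N0) + 1" for m
    using H2_norm_triangle_diff[OF fH fH, of "m + N0" N0] N0[of "m + N0"] by simp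
  then obtain s g where s: "strict_mono (s :: nat \<Rightarrow> nat)" and g: "g \<in> H2"
    and lim: "\<And>h. h \<in> H2 \<Longrightarrow> (\<lambda>m. H2_inner (f (s m + N0)) h) \<longlonglongrightarrow> H2_inner g h"
    using H2_weak_compact[of "\<lambda>m. f (m + N0)"] fH by metis
  have gH: "g \<in> H" by (rule closed_subspace_weak_limit[OF H f g lim])
  have "(\<lambda>m. H2_norm (\<lambda>z. g z - f m z)) \<longlonglongrightarrow> 0"
  proof (rule LIMSEQ_I)
    fix e :: real assume "0 < e"
    then obtain N where N: "\<And>m n. m \<ge> N \<Longrightarrow> n \<ge> N \<Longrightarrow> H2_norm (\<lambda>z. f m z - f n z) < e / 2"
      using Cauchy[of "e / 2"] by auto
    have "H2_norm (\<lambda>z. g z - f m z) \<le> e / 2" if m: "m \<ge> N" for m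
    proof (rule H2_weak_limit_norm)
      show "(\<lambda>k. H2_inner (\<lambda>z. f (s k + N0) z - f m z) (\<lambda>z. g z - f m z)) \<longlonglongrightarrow>
          H2_inner (\<lambda>z. g z - f m z) (\<lambda>z. g z - f m z)"
        using g fH by (simp add: H2_inner_diff_left H2_diff) (intro tendsto_intros lim H2_diff)
      have "\<forall>\<^sub>F k in sequentially. k \<ge> N" by (rule eventually_ge_at_top)
      then show "\<forall>\<^sub>F k in sequentially. H2_norm (\<lambda>z. f (s k + N0) z - f m z) \<le> e / 2"
      proof eventually_elim
        case (elim k)
        then have "N \<le> s k + N0" using seq_suble[OF s, of k] by simp
        then show ?case using N[OF _ m] by (intro less_imp_le)
      qed
    qed (use g fH H2_diff in auto)
    then show "\<exists>N. \<forall>m\<ge>N. norm (H2_norm (\<lambda>z. g z - f m z) - 0) < e"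
      using \<open>0 < e\<close> g fH by (intro exI[of _ N]) (force simp: H2_diff)
  qed
  then show ?thesis using gH by blast
qed

section \<open>Riesz bounds\<close>

abbreviation lincomb ::
    "'i set \<Rightarrow> ('i \<Rightarrow> complex) \<Rightarrow> ('i \<Rightarrow> complex \<Rightarrow> complex) \<Rightarrow> complex \<Rightarrow> complex" where
  "lincomb F b x \<equiv> \<lambda>z. \<Sum>n\<in>F. b n * x n z"

abbreviation sqsum :: "'i set \<Rightarrow> ('i \<Rightarrow> complex) \<Rightarrow> real" where
  "sqsum F b \<equiv> \<Sum>n\<in>F. (norm (b n))\<^sup>2"

text \<open>In matrix terms: the Gram matrix of the vectors from \<open>N\<close> on is at least
  \<open>c\<close>. Only finite combinations occur, so no convergence of series is presupposed; for
  c <= 0 the condition is void.\<close>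

definition lower_bd :: "(nat \<Rightarrow> complex \<Rightarrow> complex) \<Rightarrow> nat \<Rightarrow> real \<Rightarrow> bool" where
  "lower_bd x N c \<longleftrightarrow> (\<forall>F b. finite F \<longrightarrow> F \<subseteq> {N..} \<longrightarrow>
     c * sqsum F b \<le> (H2_norm (lincomb F b x))\<^sup>2)"

definition upper_bd :: "(nat \<Rightarrow> complex \<Rightarrow> complex) \<Rightarrow> nat \<Rightarrow> real \<Rightarrow> bool" where
  "upper_bd x N c \<longleftrightarrow> (\<forall>F b. finite F \<longrightarrow> F \<subseteq> {N..} \<longrightarrow>
     (H2_norm (lincomb F b x))\<^sup>2 \<le> c * sqsum F b)"

lemma lower_bd_mono: "lower_bd x N c \<Longrightarrow> N \<le> N' \<Longrightarrow> c' \<le> c \<Longrightarrow> lower_bd x N' c'"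
  unfolding lower_bd_def
proof (intro allI impI)
  fix F :: "nat set" and b :: "nat \<Rightarrow> complex"
  assume *: "\<forall>F b. finite F \<longrightarrow> F \<subseteq> {N..} \<longrightarrow> c * sqsum F b \<le> (H2_norm (lincomb F b x))\<^sup>2"
    and "N \<le> N'" "c' \<le> c" "finite F" "F \<subseteq> {N'..}"
  then have "c * sqsum F b \<le> (H2_norm (lincomb F b x))\<^sup>2"
    by (meson atLeast_subset_iff subset_trans)
  moreover have "c' * sqsum F b \<le> c * sqsum F b"
    using \<open>c' \<le> c\<close> by (intro mult_right_mono sum_nonneg) auto
  ultimately show "c' * sqsum F b \<le> (H2_norm (lincomb F b x))\<^sup>2" by linarith
qed

lemma upper_bd_mono: "upper_bd x N c \<Longrightarrow> N \<le> N' \<Longrightarrow> c \<le> c' \<Longrightarrow> upper_bd x N' c'"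
  unfolding upper_bd_def
proof (intro allI impI)
  fix F :: "nat set" and b :: "nat \<Rightarrow> complex"
  assume *: "\<forall>F b. finite F \<longrightarrow> F \<subseteq> {N..} \<longrightarrow> (H2_norm (lincomb F b x))\<^sup>2 \<le> c * sqsum F b"
    and "N \<le> N'" "c \<le> c'" "finite F" "F \<subseteq> {N'..}"
  then have "(H2_norm (lincomb F b x))\<^sup>2 \<le> c * sqsum F b"
    by (meson atLeast_subset_iff subset_trans)
  moreover have "c * sqsum F b \<le> c' * sqsum F b"
    using \<open>c \<le> c'\<close> by (intro mult_right_mono sum_nonneg) auto
  ultimately show "(H2_norm (lincomb F b x))\<^sup>2 \<le> c' * sqsum F b" by linarith
qed

text \<open>Duality with the vector y whose coefficients are the inner products of f with the x n:
  the sum S of their squares is the inner product of f and y, while the squared norm of y is at most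
  C S.\<close>

lemma bessel:
  assumes up: "upper_bd x N C" and C: "0 \<le> C" and F: "finite F" "F \<subseteq> {N..}"
    and x: "\<And>n. n \<in> F \<Longrightarrow> x n \<in> H2" and f: "f \<in> H2"
  shows "(\<Sum>n\<in>F. (norm (H2_inner f (x n)))\<^sup>2) \<le> C * (H2_norm f)\<^sup>2"
proof -
  define b where "b = (\<lambda>n. H2_inner f (x n))"
  define S where "S = sqsum F b"
  let ?y = "lincomb F b x"
  have y: "?y \<in> H2" using x by (rule H2_sum)
  have S0: "0 \<le> S" unfolding S_def by (rule sum_nonneg) auto
  have "H2_inner f ?y = of_real S"
    unfolding S_def using H2_inner_sum_right[where F = F and x = x and h = f
        and c = b, OF x f] complex_norm_square
    by (simp add: b_def mult.commute)
  then have "S \<le> H2_norm f * H2_norm ?y"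
    using H2_Cauchy_Schwarz[OF f y] S0 by simp
  then have "S\<^sup>2 \<le> (H2_norm f * H2_norm ?y)\<^sup>2" using S0 by (rule power_mono)
  also have "\<dots> = (H2_norm f)\<^sup>2 * (H2_norm ?y)\<^sup>2" by (rule power_mult_distrib)
  also have "\<dots> \<le> (H2_norm f)\<^sup>2 * (C * S)"
    using up F unfolding upper_bd_def S_def by (intro mult_left_mono) auto
  finally have "S * S \<le> (C * (H2_norm f)\<^sup>2) * S" by (simp add: power2_eq_square mult_ac)
  then have "S \<le> C * (H2_norm f)\<^sup>2"
    using S0 C by (cases "S = 0") auto
  then show ?thesis by (simp add: S_def b_def)
qed

text \<open>The lower bound is tested on x j minus t times the sum of its inner products with the x
  n against these vectors. The upper bound keeps the quadratic term in t under control, so the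
  squared norm is at most 1 - S / C, whereas the coefficient 1 of x j makes it at least 1 -
  e.\<close>

lemma row_sum_le:
  assumes low: "lower_bd x N (1 - e)" and up: "upper_bd x N C" and C: "0 < C" and e: "e \<le> 1"
    and F: "finite F" "F \<subseteq> {N..}" and j: "j \<ge> N" "j \<notin> F"
    and x: "\<And>n. n \<ge> N \<Longrightarrow> x n \<in> H2" and xj: "H2_norm (x j) = 1"
  shows "(\<Sum>n\<in>F. (norm (H2_inner (x j) (x n)))\<^sup>2) \<le> C * e"
proof -
  define b where "b = (\<lambda>n. H2_inner (x j) (x n))"
  define S where "S = sqsum F b"
  let ?y = "lincomb F b x"
  have xF: "x n \<in> H2" if "n \<in> F" for n using x that F by auto
  have y: "?y \<in> H2" using xF by (rule H2_sum)
  have S0: "0 \<le> S" unfolding S_def by (rule sum_nonneg) auto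
  have ip: "H2_inner (x j) ?y = of_real S"
    unfolding S_def using H2_inner_sum_right[where F = F and x = x and h = "x j"
        and c = b, OF xF x[OF j(1)]] complex_norm_square
    by (simp add: b_def mult.commute)
  \<comment> \<open>This value minimizes 1 + t^2 C S - 2 t S.\<close>
  define t where "t = 1 / C"
  define c where "c = (\<lambda>n. if n = j then 1 else - of_real t * b n)"
  have "(\<lambda>z. \<Sum>n\<in>insert j F. c n * x n z) = (\<lambda>z. x j z - of_real t * ?y z)"
  proof
    fix z
    have "(\<Sum>n\<in>F. c n * x n z) = (\<Sum>n\<in>F. - (of_real t * (b n * x n z)))"
      using j by (intro sum.cong) (auto simp: c_def)
    then show "(\<Sum>n\<in>insert j F. c n * x n z) = x j z - of_real t * ?y z"
      using F j by (simp add: c_def sum_distrib_left sum_negf)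
  qed
  then have "(1 - e) * (\<Sum>n\<in>insert j F. (norm (c n))\<^sup>2) \<le> (H2_norm (\<lambda>z. x j z - of_real t * ?y z))\<^sup>2"
    using low[unfolded lower_bd_def, rule_format, of "insert j F" c] F j by simp
  moreover have "1 \<le> (\<Sum>n\<in>insert j F. (norm (c n))\<^sup>2)"
    using F j by (simp add: c_def sum_nonneg)
  then have "1 - e \<le> (1 - e) * (\<Sum>n\<in>insert j F. (norm (c n))\<^sup>2)" using e
      by (simp add: mult_le_cancel_left1)
  moreover have "(H2_norm (\<lambda>z. x j z - of_real t * ?y z))\<^sup>2 = 1 + t\<^sup>2 * (H2_norm ?y)\<^sup>2 - 2 * t * S"
    unfolding H2_norm_diff_sq[OF x[OF j(1)] H2_cmult[OF y]] H2_norm_cmult[OF y]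
        H2_inner_cmult_right[OF y x[OF j(1)]] ip xj
    by (simp add: power_mult_distrib)
  moreover have "t\<^sup>2 * (H2_norm ?y)\<^sup>2 \<le> t\<^sup>2 * (C * S)"
    using up F unfolding upper_bd_def S_def by (intro mult_left_mono) auto
  moreover have "t\<^sup>2 * (C * S) = t * S" using C by (simp add: t_def power2_eq_square)
  ultimately have "t * S \<le> e" by linarith
  then have "S \<le> C * e" using C by (simp add: t_def divide_le_eq mult.commute)
  then show ?thesis by (simp add: S_def b_def)
qed

section \<open>Finite interpolation problems\<close>

text \<open>A Gram-Schmidt step: \<open>u\<close> is the component of x p orthogonal to the vectors
  already treated. Its coefficient at x p is 1, so the lower bound shows that it is not zero, and a
  multiple of \<open>u\<close> adjusts the value at p without disturbing the others.\<close>

lemma gram_solve: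
  assumes low: "lower_bd x N c" and c: "0 < c" and x: "\<And>n. n \<ge> N \<Longrightarrow> x n \<in> H2"
    and F: "finite F" "F \<subseteq> {N..}"
  shows "\<exists>b. \<forall>m\<in>F. H2_inner (lincomb F b x) (x m) = a m"
  using F
proof (induction F arbitrary: a)
  case (insert p F)
  have xF: "x n \<in> H2" if "n \<in> F" for n using x insert.prems that by auto
  have xp: "x p \<in> H2" using x insert.prems by auto
  have sF: "(\<lambda>z. \<Sum>n\<in>F. b n * x n z) \<in> H2" for b using xF by (rule H2_sum)
  obtain b0 where b0: "\<forall>m\<in>F. H2_inner (lincomb F b0 x) (x m) = H2_inner (x p) (x m)"
    using insert.IH[of "\<lambda>m. H2_inner (x p) (x m)"] insert.prems by auto
  obtain b1 where b1: "\<forall>m\<in>F. H2_inner (lincomb F b1 x) (x m) = a m"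
    using insert.IH[of a] insert.prems by auto
  define u where "u = (\<lambda>z. x p z - (\<Sum>n\<in>F. b0 n * x n z))"
  have u: "u \<in> H2" unfolding u_def using xp sF by (rule H2_diff)
  have uF: "H2_inner u (x m) = 0" if "m \<in> F" for m
    using that b0 xF xp sF by (simp add: u_def H2_inner_diff_left)
  define d where "d = (\<lambda>n. if n = p then 1 else - b0 n)"
  have ud: "u = (\<lambda>z. \<Sum>n\<in>insert p F. d n * x n z)"
  proof
    fix z
    have "(\<Sum>n\<in>F. d n * x n z) = (\<Sum>n\<in>F. - (b0 n * x n z))"
      using insert.hyps by (intro sum.cong) (auto simp: d_def)
    then show "u z = (\<Sum>n\<in>insert p F. d n * x n z)"
      using insert.hyps by (simp add: d_def u_def sum_negf)
  qed
  have "1 \<le> (\<Sum>n\<in>insert p F. (norm (d n))\<^sup>2)"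
    using insert.hyps by (simp add: d_def sum_nonneg)
  then have "0 < c * (\<Sum>n\<in>insert p F. (norm (d n))\<^sup>2)" using c by simp
  also have "\<dots> \<le> (H2_norm u)\<^sup>2"
    unfolding ud using low[unfolded lower_bd_def, rule_format, of "insert p F" d] insert by simp
  finally have nz: "(H2_norm u)\<^sup>2 \<noteq> 0" by simp
  have "H2_inner u u = H2_inner u (x p) - (\<Sum>n\<in>F. cnj (b0 n) * H2_inner u (x n))"
    using H2_inner_diff_right[OF xp sF u, of b0] H2_inner_sum_right[where F = F and x = x
        and h = u and c = b0, OF xF u] by (simp add: u_def)
  then have up: "H2_inner u (x p) = of_real ((H2_norm u)\<^sup>2)" using uF H2_inner_self[OF u] by simp
  define t where "t = (a p - H2_inner (lincomb F b1 x) (x p)) / of_real ((H2_norm u)\<^sup>2)"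
  define b where "b = (\<lambda>n. if n = p then t else b1 n - t * b0 n)"
  have eq: "(\<lambda>z. \<Sum>n\<in>insert p F. b n * x n z) = (\<lambda>z. (\<Sum>n\<in>F. b1 n * x n z) + t * u z)"
  proof
    fix z
    have "(\<Sum>n\<in>F. b n * x n z) = (\<Sum>n\<in>F. b1 n * x n z - t * (b0 n * x n z))"
      using insert.hyps by (intro sum.cong) (auto simp: b_def algebra_simps)
    then show "(\<Sum>n\<in>insert p F. b n * x n z) = (\<Sum>n\<in>F. b1 n * x n z) + t * u z"
      using insert.hyps by (simp add: b_def u_def sum_subtractf sum_distrib_left algebra_simps)
  qed
  have "H2_inner (\<lambda>z. \<Sum>n\<in>insert p F. b n * x n z) (x m) = a m" if m: "m \<in> insert p F" for m
  proof -
    have "x m \<in> H2" using m xF xp by auto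
    then have "H2_inner (\<lambda>z. \<Sum>n\<in>insert p F. b n * x n z) (x m) =
        H2_inner (lincomb F b1 x) (x m) + t * H2_inner u (x m)"
      unfolding eq using sF u by (simp add: H2_inner_add_left H2_cmult H2_inner_cmult_left)
    then show ?thesis using m b1 uF up nz by (auto simp: t_def)
  qed
  then show ?case by blast
qed simp

text \<open>The squared norm R of the solution equals the sum of cnj (b n) * a n. Cauchy-Schwarz
  bounds R^2 by the product of the square sums of b and a, and the lower bound controls the square
  sum of b by R / c; cancelling one factor R leaves the estimate.\<close>

lemma gram_interpolation:
  assumes low: "lower_bd x N c" and c: "0 < c" and x: "\<And>n. n \<ge> N \<Longrightarrow> x n \<in> H2"
    and F: "finite F" "F \<subseteq> {N..}"
  obtains b where "\<And>m. m \<in> F \<Longrightarrow> H2_inner (lincomb F b x) (x m) = a m"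
    "c * (H2_norm (lincomb F b x))\<^sup>2 \<le> (\<Sum>m\<in>F. (norm (a m))\<^sup>2)"
proof -
  obtain b where b: "\<forall>m\<in>F. H2_inner (lincomb F b x) (x m) = a m"
    using gram_solve[OF low c x F] by blast
  let ?f = "lincomb F b x"
  define R where "R = (H2_norm ?f)\<^sup>2"
  define A where "A = (\<Sum>m\<in>F. (norm (a m))\<^sup>2)"
  have xF: "x n \<in> H2" if "n \<in> F" for n using x F that by auto
  have f: "?f \<in> H2" using xF by (rule H2_sum)
  have A0: "0 \<le> A" unfolding A_def by (rule sum_nonneg) auto
  have "of_real R = H2_inner ?f ?f" unfolding R_def by (rule H2_inner_self[OF f, symmetric])
  also have "\<dots> = (\<Sum>n\<in>F. cnj (b n) * a n)" using H2_inner_sum_right[where F = F and x = x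
      and h = ?f and c = b, OF xF f] b by simp
  finally have "norm (of_real R :: complex) = norm (\<Sum>n\<in>F. cnj (b n) * a n)" by (rule arg_cong)
  also have "\<dots> \<le> (\<Sum>n\<in>F. norm (b n) * norm (a n))"
      by (rule order_trans[OF norm_sum]) (simp add: norm_mult)
  finally have "R \<le> (\<Sum>n\<in>F. norm (b n) * norm (a n))" by (simp only: norm_of_real)
  then have "R\<^sup>2 \<le> (\<Sum>n\<in>F. norm (b n) * norm (a n))\<^sup>2" by (rule power_mono) (simp add: R_def)
  also have "\<dots> \<le> sqsum F b * A" unfolding A_def by (rule Cauchy_Schwarz_ineq_sum)
  finally have "c * R\<^sup>2 \<le> c * (sqsum F b * A)" using c by simp
  also have "\<dots> = (c * sqsum F b) * A" by simp
  also have "\<dots> \<le> R * A"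
    unfolding R_def using low F A0 by (intro mult_right_mono) (auto simp: lower_bd_def)
  finally have "R * (c * R) \<le> R * A" by (simp add: power2_eq_square mult_ac)
  moreover have "0 \<le> R" by (simp add: R_def)
  ultimately have "c * R \<le> A" using A0 by (cases "R = 0") auto
  then show ?thesis using that b unfolding R_def A_def by blast
qed

section \<open>Interpolation and asymptotic orthonormality\<close>

lemma ell2_summable_tail:
  assumes "a \<in> ell2" "N \<ge> 1"
  shows "(\<lambda>n. (norm (a n))\<^sup>2) summable_on {N..}"
  using assms unfolding ell2_def by (auto intro: summable_on_subset_banach[of _ "{1..}"])

lemma tail_norm_sq:
  "(tail_norm N a)\<^sup>2 = (\<Sum>\<^sub>\<infinity>j\<in>{N..}. (norm (a j))\<^sup>2)"
  by (simp add: tail_norm_def infsum_nonneg)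

lemma tail_norm_nonneg [simp]: "0 \<le> tail_norm N a"
  by (simp add: tail_norm_def infsum_nonneg)

lemma tail_norm_ge_sum:
  assumes "(\<lambda>n. (norm (a n))\<^sup>2) summable_on {N..}" "finite F" "F \<subseteq> {N..}"
  shows "sqsum F a \<le> (tail_norm N a)\<^sup>2"
  unfolding tail_norm_sq by (rule finite_sum_le_infsum[OF assms]) auto

lemma finite_support_infsum:
  fixes b :: "nat \<Rightarrow> complex"
  assumes "finite F" "F \<subseteq> {N..}"
  defines "a \<equiv> \<lambda>n. if n \<in> F then b n else 0"
  shows "(\<Sum>\<^sub>\<infinity>n\<in>{N..}. (norm (a n))\<^sup>2) = sqsum F b"
proof -
  have "(\<Sum>\<^sub>\<infinity>n\<in>{N..}. (norm (a n))\<^sup>2) = (\<Sum>\<^sub>\<infinity>n\<in>F. (norm (b n))\<^sup>2)"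
    using assms(2) by (intro infsum_cong_neutral) (auto simp: a_def)
  then show ?thesis using assms(1) by simp
qed

lemma finite_support_ell2:
  assumes "finite F"
  shows "(\<lambda>n. if n \<in> F then b n else 0) \<in> ell2"
proof -
  have "(\<lambda>n. (norm (if n \<in> F then b n else 0))\<^sup>2) summable_on {1..} \<longleftrightarrow>
      (\<lambda>n. (norm (if n \<in> F then b n else 0))\<^sup>2) summable_on (F \<inter> {1..})"
    by (intro summable_on_cong_neutral) auto
  then show ?thesis using assms by (simp add: ell2_def)
qed

text \<open>The first M conditions are solved with a norm bound independent of M; a weak limit then
  satisfies all conditions with the same bound.\<close>

lemma infinite_interpolation:
  assumes H: "closed_subspace H" and x: "\<And>n. n \<ge> N \<Longrightarrow> x n \<in> H"
    and low: "lower_bd x N c" and c: "0 < c"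
    and a: "(\<lambda>n. (norm (a n))\<^sup>2) summable_on {N..}"
  obtains f where "f \<in> H" "\<And>n. n \<ge> N \<Longrightarrow> H2_inner f (x n) = a n" "c * (H2_norm f)\<^sup>2
      \<le> (tail_norm N a)\<^sup>2"
proof -
  have xH: "x n \<in> H2" if "n \<ge> N" for n using closed_subspace_H2[OF H x[OF that]] .
  have "\<exists>f\<in>H. (\<forall>m\<in>{N..<N+M}. H2_inner f (x m) = a m) \<and> c * (H2_norm f)\<^sup>2 \<le> (tail_norm N a)\<^sup>2" for M
  proof -
    obtain b where b: "\<And>m. m \<in> {N..<N+M} \<Longrightarrow> H2_inner (\<lambda>z. \<Sum>n\<in>{N..<N+M}. b n * x n z) (x m) = a m"
      "c * (H2_norm (\<lambda>z. \<Sum>n\<in>{N..<N+M}. b n * x n z))\<^sup>2 \<le> (\<Sum>m\<in>{N..<N+M}. (norm (a m))\<^sup>2)"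
      by (rule gram_interpolation[where F = "{N..<N+M}" and a = a, OF low c xH]) auto
    have le: "(\<Sum>m\<in>{N..<N+M}. (norm (a m))\<^sup>2) \<le> (tail_norm N a)\<^sup>2"
        by (rule tail_norm_ge_sum[OF a]) auto
    show ?thesis
      by (rule bexI[where x = "\<lambda>z. \<Sum>n\<in>{N..<N+M}. b n * x n z"])
        (use b le order_trans[OF b(2) le] closed_subspace_sum[OF H x, of "{N..<N+M}" "\<lambda>n.
            n" b] in auto)
  qed
  then obtain f where fH: "\<And>M. f M \<in> H" and fa: "\<And>M m. m \<in> {N..<N+M} \<Longrightarrow> H2_inner (f M) (x m) = a m"
    and fn: "\<And>M. c * (H2_norm (f M))\<^sup>2 \<le> (tail_norm N a)\<^sup>2" by metis
  define B where "B = tail_norm N a / sqrt c"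
  have B0: "0 \<le> B" using c by (simp add: B_def)
  have fB: "H2_norm (f M) \<le> B" for M
  proof (rule power2_le_imp_le[OF _ B0])
    show "(H2_norm (f M))\<^sup>2 \<le> B\<^sup>2"
      using fn[of M] c by (simp add: B_def power_divide pos_le_divide_eq mult.commute)
  qed
  obtain s g where s: "strict_mono (s :: nat \<Rightarrow> nat)" and g: "g \<in> H2"
    and lim: "\<And>h. h \<in> H2 \<Longrightarrow> (\<lambda>m. H2_inner (f (s m)) h) \<longlonglongrightarrow> H2_inner g h"
    using H2_weak_compact[of f B, OF closed_subspace_H2[OF H fH] fB] by blast
  have "g \<in> H" by (rule closed_subspace_weak_limit[OF H _ g lim]) (rule fH)
  moreover have "H2_inner g (x n) = a n" if n: "n \<ge> N" for n
  proof (rule LIMSEQ_unique[OF lim[OF xH[OF n]]])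
    have "H2_inner (f (s m)) (x n) = a n" if "m \<ge> Suc n" for m
      using seq_suble[OF s, of m] n that by (intro fa) auto
    then have "\<forall>\<^sub>F m in sequentially. H2_inner (f (s m)) (x n) = a n"
      by (rule eventually_sequentiallyI)
    then show "(\<lambda>m. H2_inner (f (s m)) (x n)) \<longlonglongrightarrow> a n" by (rule tendsto_eventually)
  qed
  moreover have "H2_norm g \<le> B"
    by (rule H2_weak_limit_norm[OF g _ lim[OF g]]) (use closed_subspace_H2[OF H fH] fB in auto)
  then have "(H2_norm g)\<^sup>2 \<le> B\<^sup>2" using g by (intro power_mono) auto
  then have "c * (H2_norm g)\<^sup>2 \<le> (tail_norm N a)\<^sup>2"
    using c by (simp add: B_def power_divide pos_le_divide_eq mult.commute)
  ultimately show ?thesis by (rule that)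
qed

section \<open>EIS and AIS as lower Riesz bounds\<close>

lemma lower_bd_imp_EIS:
  assumes H: "closed_subspace H" and x: "\<And>n. n \<ge> 1 \<Longrightarrow> x n \<in> H"
    and val: "\<And>f n. \<lbrakk>f \<in> H; n \<ge> 1\<rbrakk> \<Longrightarrow> normalized_value K f (lam n) = H2_inner f (x n)"
    and low: "\<And>e. e > 0 \<Longrightarrow> \<exists>N\<ge>1. lower_bd x N (1 - e)"
  shows "EIS H H2_norm K lam"
  unfolding EIS_def
proof (intro allI impI)
  fix e :: real assume e: "0 < e"
  \<comment> \<open>A lower bound \<open>c\<close> costs the factor 1 / sqrt c in the norm of the
    interpolating function, which here is 1 + e.\<close>
  define c where "c = 1 / (1 + e)\<^sup>2"
  have c: "0 < c" "c < 1" using e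
      by (auto simp: c_def divide_less_eq power2_eq_square algebra_simps add_pos_pos)
  then obtain N where N: "N \<ge> 1" "lower_bd x N c" using low[of "1 - c"] by auto
  show "\<exists>N\<ge>1. \<forall>a\<in>ell2. \<exists>f\<in>H. (\<forall>n\<ge>N. normalized_value K f (lam n) = a n) \<and> H2_norm f \<le> (1
      + e) * tail_norm N a"
  proof (intro exI[of _ N] conjI N(1) ballI)
    fix a assume a: "a \<in> ell2"
    have xN: "\<And>n. n \<ge> N \<Longrightarrow> x n \<in> H" using x N(1) by auto
    obtain f where f: "f \<in> H" "\<And>n. n \<ge> N \<Longrightarrow> H2_inner f (x n) = a n" "c * (H2_norm f)\<^sup>2
        \<le> (tail_norm N a)\<^sup>2"
      using infinite_interpolation[OF H xN N(2) c(1) ell2_summable_tail[OF a N(1)]] by metis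
    have "(H2_norm f)\<^sup>2 \<le> ((1 + e) * tail_norm N a)\<^sup>2"
      using f(3) e by (simp add: c_def power_mult_distrib divide_le_eq mult.commute)
    then have "H2_norm f \<le> (1 + e) * tail_norm N a" by (rule power2_le_imp_le) (use e in simp)
    then show "\<exists>f\<in>H. (\<forall>n\<ge>N. normalized_value K f (lam n) = a n) \<and> H2_norm f \<le> (1
        + e) * tail_norm N a"
      using f val N(1) by (intro bexI[of _ f]) auto
  qed
qed

lemma EIS_imp_AIS:
  assumes H: "closed_subspace H" and EIS: "EIS H H2_norm K lam"
  shows "AIS H H2_norm K lam"
  unfolding AIS_def
proof (intro allI impI)
  fix e :: real assume e: "0 < e"
  obtain N where N: "N \<ge> 1" and int: "\<And>a. a \<in> ell2 \<Longrightarrow> \<exists>f\<in>H. (\<forall>n\<ge>N. normalized_value K f (lam n)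
      = a n) \<and>
      H2_norm f \<le> (1 + e) * tail_norm N a"
    using EIS e unfolding EIS_def by metis
  \<comment> \<open>Shrinking the interpolating function by \<open>t\<close> makes its norm
    admissible and leaves the relative error 1 - t = e / (1 + e), which is less than e.\<close>
  define t where "t = 1 / (1 + e)"
  have t: "0 < t" "1 - t < e" "t < 1" using e by (auto simp: t_def field_simps)
  show "\<exists>N\<ge>1. \<forall>a\<in>ell2. tail_norm N a \<noteq> 0 \<longrightarrow> (\<exists>G\<in>H. H2_norm G \<le> tail_norm N a \<and>
      (\<lambda>n. (norm (normalized_value K G (lam n) - a n))\<^sup>2) summable_on {N..} \<and>
      tail_norm N (\<lambda>n. normalized_value K G (lam n) - a n) < e * tail_norm N a)"
  proof (intro exI[of _ N] conjI N ballI impI)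
    fix a assume a: "a \<in> ell2" and nz: "tail_norm N a \<noteq> 0"
    obtain f where f: "f \<in> H" "\<And>n. n \<ge> N \<Longrightarrow> normalized_value K f (lam n) = a n"
      "H2_norm f \<le> (1 + e) * tail_norm N a" using int[OF a] by blast
    define G where "G = (\<lambda>z. of_real t * f z)"
    have val: "normalized_value K G (lam n) - a n = - of_real (1 - t) * a n" if "n \<ge> N" for n
    proof -
      have "normalized_value K G (lam n) = of_real t * normalized_value K f (lam n)"
        by (simp add: normalized_value_def G_def)
      then show ?thesis using f(2)[OF that] by (simp add: algebra_simps)
    qed
    have sq: "(norm (normalized_value K G (lam n) - a n))\<^sup>2 = (1 - t)\<^sup>2 * (norm (a n))\<^sup>2"
        if "n \<in> {N..}" for n
      using val[of n] that t by (simp add: norm_mult power_mult_distrib del: of_real_diff)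
    have "H2_norm G = t * H2_norm f"
      unfolding G_def using t H2_norm_cmult[OF closed_subspace_H2[OF H f(1)], of "of_real t"]
          by simp
    also have "\<dots> \<le> t * ((1 + e) * tail_norm N a)" using f(3) t by (intro mult_left_mono) auto
    also have "\<dots> = tail_norm N a" using e by (simp add: t_def)
    finally have nG: "H2_norm G \<le> tail_norm N a" .
    have summ: "(\<lambda>n. (norm (normalized_value K G (lam n) - a n))\<^sup>2) summable_on {N..}"
      using summable_on_cmult_right[OF ell2_summable_tail[OF a N], of "(1 - t)\<^sup>2"] sq
      by (subst summable_on_cong[OF sq]) auto
    have "(tail_norm N (\<lambda>n. normalized_value K G (lam n) - a n))\<^sup>2 = (\<Sum>\<^sub>\<infinity>n\<in>{N..}. (1
        - t)\<^sup>2 * (norm (a n))\<^sup>2)"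
      unfolding tail_norm_sq by (rule infsum_cong[OF sq])
    also have "\<dots> = ((1 - t) * tail_norm N a)\<^sup>2"
      unfolding power_mult_distrib tail_norm_sq
          by (rule infsum_cmult_right) (use ell2_summable_tail[OF a N] in simp)
    finally have "tail_norm N (\<lambda>n. normalized_value K G (lam n) - a n) = (1 - t) * tail_norm N a"
      using t by (simp add: power2_eq_iff_nonneg)
    also have "\<dots> < e * tail_norm N a"
      using t nz tail_norm_nonneg[of N a]
          by (intro mult_strict_right_mono) (auto simp del: tail_norm_nonneg)
    finally have err: "tail_norm N (\<lambda>n. normalized_value K G (lam n) - a n) < e * tail_norm N a" .
    show "\<exists>G\<in>H. H2_norm G \<le> tail_norm N a \<and>
      (\<lambda>n. (norm (normalized_value K G (lam n) - a n))\<^sup>2) summable_on {N..} \<and>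
      tail_norm N (\<lambda>n. normalized_value K G (lam n) - a n) < e * tail_norm N a"
      using nG summ err closed_subspace_cmult[OF H f(1), of "of_real t"] unfolding G_def by blast
  qed
qed

text \<open>The coefficients of a finite combination y serve as the data a. The approximant G has
  norm at most T, the norm of the data, while its inner product with y differs from T^2 by at most d
  T^2; Cauchy-Schwarz therefore gives (1 - d) T as a lower bound for the norm of y.\<close>

lemma AIS_imp_lower_bd:
  assumes H: "closed_subspace H" and x: "\<And>n. n \<ge> 1 \<Longrightarrow> x n \<in> H"
    and val: "\<And>f n. \<lbrakk>f \<in> H; n \<ge> 1\<rbrakk> \<Longrightarrow> normalized_value K f (lam n) = H2_inner f (x n)"
    and AIS: "AIS H H2_norm K lam" and e: "e > 0"
  shows "\<exists>N\<ge>1. lower_bd x N (1 - e)"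
proof -
  \<comment> \<open>The bound e / 2 yields (1 - d)^2 >= 1 - e, and 1 / 2 keeps 1 - d positive for
    the squaring.\<close>
  define d where "d = min (e / 2) (1 / 2)"
  have d: "0 < d" "d \<le> e / 2" "d \<le> 1 / 2" using e by (auto simp: d_def)
  obtain N where N: "N \<ge> 1" and ap: "\<forall>a\<in>ell2. tail_norm N a \<noteq> 0 \<longrightarrow>
      (\<exists>G\<in>H. H2_norm G \<le> tail_norm N a \<and>
      (\<lambda>n. (norm (normalized_value K G (lam n) - a n))\<^sup>2) summable_on {N..} \<and>
      tail_norm N (\<lambda>n. normalized_value K G (lam n) - a n) < d * tail_norm N a)"
    using AIS[unfolded AIS_def, THEN spec, THEN mp, OF d(1)] by (elim exE conjE)
  have "lower_bd x N (1 - e)"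
    unfolding lower_bd_def
  proof (intro allI impI)
    fix F and b :: "nat \<Rightarrow> complex" assume F: "finite F" "F \<subseteq> {N..}"
    have xF: "x n \<in> H2" if "n \<in> F" for n using closed_subspace_H2[OF H x] F N that by fastforce
    let ?y = "lincomb F b x"
    have y: "?y \<in> H2" using xF by (rule H2_sum)
    define a where "a = (\<lambda>n. if n \<in> F then b n else 0)"
    define T where "T = tail_norm N a"
    have T2: "T\<^sup>2 = sqsum F b"
      unfolding T_def tail_norm_sq a_def by (rule finite_support_infsum[OF F])
    show "(1 - e) * sqsum F b \<le> (H2_norm ?y)\<^sup>2"
    proof (cases "T = 0")
      case True
      then show ?thesis using T2 by simp
    next
      case False
      then have T0: "0 < T" using tail_norm_nonneg[of N a]
          by (simp add: T_def del: tail_norm_nonneg)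
      have aell: "a \<in> ell2" unfolding a_def by (rule finite_support_ell2[OF F(1)])
      obtain G where G: "G \<in> H" "H2_norm G \<le> T"
        and summ: "(\<lambda>n. (norm (normalized_value K G (lam n) - a n))\<^sup>2) summable_on {N..}"
        and err: "tail_norm N (\<lambda>n. normalized_value K G (lam n) - a n) < d * T"
        using ap[THEN bspec, OF aell] False unfolding T_def by (elim impE bexE conjE)
      note G2 = closed_subspace_H2[OF H G(1)]
      define E where "E = (\<lambda>n. H2_inner G (x n) - b n)"
      have EF: "normalized_value K G (lam n) - a n = E n" if "n \<in> F" for n
        using val[OF G(1), of n] that F N by (auto simp: E_def a_def)
      have "sqsum F E = (\<Sum>n\<in>F. (norm (normalized_value K G (lam n) - a n))\<^sup>2)"
        using EF by simp
      also have "\<dots> \<le> (tail_norm N (\<lambda>n. normalized_value K G (lam n) - a n))\<^sup>2"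
        by (rule tail_norm_ge_sum[OF summ F])
      also have "\<dots> \<le> (d * T)\<^sup>2" using err by (intro power_mono) auto
      finally have E2: "sqsum F E \<le> (d * T)\<^sup>2" .
      have "norm (\<Sum>n\<in>F. cnj (b n) * E n) \<le> (\<Sum>n\<in>F. norm (b n) * norm (E n))"
        by (rule order_trans[OF norm_sum]) (simp add: norm_mult)
      moreover have "(\<Sum>n\<in>F. norm (b n) * norm (E n)) \<le> d * T * T"
      proof (rule power2_le_imp_le)
        have "(\<Sum>n\<in>F. norm (b n) * norm (E n))\<^sup>2 \<le> T\<^sup>2 * sqsum F E"
          unfolding T2 by (rule Cauchy_Schwarz_ineq_sum)
        also have "\<dots> \<le> T\<^sup>2 * (d * T)\<^sup>2" using E2 by (intro mult_left_mono) auto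
        finally show "(\<Sum>n\<in>F. norm (b n) * norm (E n))\<^sup>2 \<le> (d * T * T)\<^sup>2"
            by (simp add: power_mult_distrib mult_ac)
      qed (use d T0 in simp)
      moreover have "H2_inner G ?y = of_real (T\<^sup>2) + (\<Sum>n\<in>F. cnj (b n) * E n)"
      proof -
        have "H2_inner G ?y = (\<Sum>n\<in>F. cnj (b n) * H2_inner G (x n))"
            by (rule H2_inner_sum_right[OF xF G2])
        also have "\<dots> = (\<Sum>n\<in>F. b n * cnj (b n) + cnj (b n) * E n)" by (simp add: E_def algebra_simps)
        also have "\<dots> = of_real (T\<^sup>2) + (\<Sum>n\<in>F. cnj (b n) * E n)"
          unfolding T2 sum.distrib of_real_sum complex_norm_square ..
        finally show ?thesis .
      qed
      then have "T\<^sup>2 - norm (\<Sum>n\<in>F. cnj (b n) * E n) \<le> norm (H2_inner G ?y)"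
        using norm_triangle_ineq2[of "of_real (T\<^sup>2)" "- (\<Sum>n\<in>F. cnj (b n) * E n)"]
            by (simp del: of_real_power)
      moreover have "norm (H2_inner G ?y) \<le> T * H2_norm ?y"
        by (rule order_trans[OF H2_Cauchy_Schwarz[OF G2 y] mult_right_mono[OF G(2)
            H2_norm_nonneg[OF y]]])
      ultimately have "T\<^sup>2 - d * T * T \<le> T * H2_norm ?y" by linarith
      then have "T * ((1 - d) * T) \<le> T * H2_norm ?y" by (simp add: power2_eq_square algebra_simps)
      then have "(1 - d) * T \<le> H2_norm ?y" using T0 by simp
      then have "((1 - d) * T)\<^sup>2 \<le> (H2_norm ?y)\<^sup>2" using d T0 by (intro power_mono) auto
      moreover have "(1 - e) * T\<^sup>2 \<le> (1 - d)\<^sup>2 * T\<^sup>2"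
      proof (intro mult_right_mono)
        have "(1 - d)\<^sup>2 = 1 - 2 * d + d\<^sup>2" by (simp add: power2_diff)
        then show "1 - e \<le> (1 - d)\<^sup>2" using d(2) zero_le_power2[of d] by linarith
      qed simp
      ultimately show ?thesis using T2 by (simp add: power_mult_distrib)
    qed
  qed
  then show ?thesis using N by blast
qed

lemma EIS_iff_lower_bd:
  assumes "closed_subspace H" "\<And>n. n \<ge> 1 \<Longrightarrow> x n \<in> H"
    "\<And>f n. \<lbrakk>f \<in> H; n \<ge> 1\<rbrakk> \<Longrightarrow> normalized_value K f (lam n) = H2_inner f (x n)"
  shows "EIS H H2_norm K lam \<longleftrightarrow> (\<forall>e>0. \<exists>N\<ge>1. lower_bd x N (1 - e))"
    and "AIS H H2_norm K lam \<longleftrightarrow> (\<forall>e>0. \<exists>N\<ge>1. lower_bd x N (1 - e))"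
proof -
  have 1: "EIS H H2_norm K lam" if "\<forall>e>0. \<exists>N\<ge>1. lower_bd x N (1 - e)"
    by (rule lower_bd_imp_EIS[where x = x]) (use assms that in blast)+
  have 2: "\<forall>e>0. \<exists>N\<ge>1. lower_bd x N (1 - e)" if "AIS H H2_norm K lam"
    using AIS_imp_lower_bd[where x = x, OF assms(1) _ _ that] assms(2,3) by blast
  show "EIS H H2_norm K lam \<longleftrightarrow> (\<forall>e>0. \<exists>N\<ge>1. lower_bd x N (1 - e))"
    "AIS H H2_norm K lam \<longleftrightarrow> (\<forall>e>0. \<exists>N\<ge>1. lower_bd x N (1 - e))"
    using 1 2 EIS_imp_AIS[OF assms(1)] by blast+
qed

section \<open>Riesz bounds and AOB sequences\<close>

text \<open>For finitely supported coefficients the partial sums in \<open>AOB\<close> become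
  constant, so the sum g differs from the finite combination by a function of norm 0 and inherits
  its bound to it.\<close>

lemma AOB_imp_upper_bd:
  assumes H: "closed_subspace H" and AOB: "AOB H H2_norm x" and e: "e > 0"
  shows "\<exists>N\<ge>1. upper_bd x N (1 + e)"
proof -
  obtain C :: "nat \<Rightarrow> real" where x: "\<And>n. n \<ge> 1 \<Longrightarrow> x n \<in> H" and C1: "C \<longlonglongrightarrow> 1"
    and C: "\<And>N a. N \<ge> 1 \<Longrightarrow> a \<in> ell2 \<Longrightarrow> \<exists>g\<in>H.
      (\<lambda>M. H2_norm (\<lambda>z. g z - (\<Sum>n=N..M. a n * x n z))) \<longlonglongrightarrow> 0 \<and>
      (H2_norm g)\<^sup>2 \<le> C N * (\<Sum>\<^sub>\<infinity>n\<in>{N..}. (norm (a n))\<^sup>2)"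
    using AOB unfolding AOB_def by blast
  have "\<forall>\<^sub>F N in sequentially. C N < 1 + e" using order_tendstoD(2)[OF C1, of "1 + e"] e by simp
  then obtain N0 where N0: "\<And>N. N \<ge> N0 \<Longrightarrow> C N < 1 + e" by (auto simp: eventually_sequentially)
  define N where "N = max 1 N0"
  have N: "N \<ge> 1" "C N \<le> 1 + e" using N0[of N] by (auto simp: N_def)
  have "upper_bd x N (C N)"
    unfolding upper_bd_def
  proof (intro allI impI)
    fix F and b :: "nat \<Rightarrow> complex" assume F: "finite F" "F \<subseteq> {N..}"
    define a where "a = (\<lambda>n. if n \<in> F then b n else 0)"
    obtain g where g: "g \<in> H" "(\<lambda>M. H2_norm (\<lambda>z. g z - (\<Sum>n=N..M. a n * x n z))) \<longlonglongrightarrow> 0"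
      "(H2_norm g)\<^sup>2 \<le> C N * (\<Sum>\<^sub>\<infinity>n\<in>{N..}. (norm (a n))\<^sup>2)"
      using C[OF N(1) finite_support_ell2[OF F(1)], of b] unfolding a_def by blast
    let ?y = "lincomb F b x"
    have "x n \<in> H2" if "n \<in> F" for n
      using that F N by (intro closed_subspace_H2[OF H x]) auto
    then have y: "?y \<in> H2" by (rule H2_sum)
    obtain M0 where "\<forall>n\<in>F. n \<le> M0" using F(1) unfolding finite_nat_set_iff_bounded_le by (elim exE)
    then have M0: "n \<le> M0" if "n \<in> F" for n using that by simp
    have "(\<Sum>n=N..M. a n * x n z) = ?y z" if "M \<ge> M0" for M z
    proof (rule sum.mono_neutral_cong_right)
      show "F \<subseteq> {N..M}" using M0 F that by force
    qed (auto simp: a_def)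
    then have "\<forall>\<^sub>F M in sequentially. H2_norm (\<lambda>z. g z - (\<Sum>n=N..M. a n * x n z))
        = H2_norm (\<lambda>z. g z - ?y z)"
      by (intro eventually_sequentiallyI[of M0]) simp
    then have "H2_norm (\<lambda>z. g z - ?y z) = 0"
      by (intro LIMSEQ_unique[OF tendsto_eventually g(2)])
    then have "H2_norm ?y \<le> H2_norm g"
      using H2_norm_triangle_diff[OF y closed_subspace_H2[OF H g(1)]] H2_norm_diff_commute[OF y
          closed_subspace_H2[OF H g(1)]] by simp
    then have "(H2_norm ?y)\<^sup>2 \<le> (H2_norm g)\<^sup>2" using y by (intro power_mono) auto
    also have "\<dots> \<le> C N * sqsum F b"
      using g(3) unfolding a_def finite_support_infsum[OF F] .
    finally show "(H2_norm ?y)\<^sup>2 \<le> C N * sqsum F b" .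
  qed
  then show ?thesis using N upper_bd_mono[OF _ order_refl] by blast
qed

lemma tail_partial_sums:
  assumes "a \<in> ell2" "N \<ge> 1"
  shows "(\<lambda>M. \<Sum>n=N..M. (norm (a n))\<^sup>2) \<longlonglongrightarrow> (\<Sum>\<^sub>\<infinity>n\<in>{N..}. (norm (a n))\<^sup>2)"
proof -
  let ?f = "\<lambda>n. if n \<ge> N then (norm (a n))\<^sup>2 else 0"
  have "((\<lambda>n. (norm (a n))\<^sup>2) has_sum (\<Sum>\<^sub>\<infinity>n\<in>{N..}. (norm (a n))\<^sup>2)) {N..}"
    using ell2_summable_tail[OF assms] by (rule has_sum_infsum)
  moreover have "((\<lambda>n. (norm (a n))\<^sup>2) has_sum s) {N..} \<longleftrightarrow> (?f has_sum s) UNIV" for s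
    by (rule has_sum_cong_neutral) auto
  ultimately have "(?f has_sum (\<Sum>\<^sub>\<infinity>n\<in>{N..}. (norm (a n))\<^sup>2)) UNIV" by simp
  then have "?f sums (\<Sum>\<^sub>\<infinity>n\<in>{N..}. (norm (a n))\<^sup>2)" by (rule has_sum_imp_sums)
  then have "(\<lambda>M. \<Sum>n<Suc M. ?f n) \<longlonglongrightarrow> (\<Sum>\<^sub>\<infinity>n\<in>{N..}. (norm (a n))\<^sup>2)"
    unfolding sums_def by (rule LIMSEQ_Suc)
  moreover have "(\<Sum>n<Suc M. ?f n) = (\<Sum>n=N..M. (norm (a n))\<^sup>2)" for M
    by (intro sum.mono_neutral_cong_right) auto
  ultimately show ?thesis by simp
qed

lemma bounds_imp_AOB:
  assumes H: "closed_subspace H" and x: "\<And>n. n \<ge> 1 \<Longrightarrow> x n \<in> H"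
    and low0: "0 < c0" "lower_bd x 1 c0" and up0: "upper_bd x 1 C0"
    and asym: "\<And>e. e > 0 \<Longrightarrow> \<exists>N\<ge>1. lower_bd x N (1 - e) \<and> upper_bd x N (1 + e)"
  shows "AOB H H2_norm x"
proof -
  \<comment> \<open>The constants required by \<open>AOB\<close> are the best ones: the supremum of
    the admissible lower constants capped at 1 and the infimum of the admissible upper constants
    that are at least 1. The caps trap them between 1 - e and 1, respectively 1 and 1 + e, and
    \<open>c0\<close> keeps every \<open>c N\<close> positive.\<close>
  define Lo where "Lo = (\<lambda>N. {c. c \<le> 1 \<and> lower_bd x N c})"
  define Up where "Up = (\<lambda>N. {C. 1 \<le> C \<and> upper_bd x N C})"
  define c where "c = (\<lambda>N. Sup (Lo N))"
  define C where "C = (\<lambda>N. Inf (Up N))"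
  have bdd: "bdd_above (Lo N)" "bdd_below (Up N)" for N
    by (auto simp: Lo_def Up_def bdd_above_def bdd_below_def)
  have Lo0: "min 1 c0 \<in> Lo N" and Up0: "max 1 C0 \<in> Up N" if "N \<ge> 1" for N
    using lower_bd_mono[OF low0(2) that, of "min 1 c0"] upper_bd_mono[OF up0 that, of "max 1 C0"]
    by (auto simp: Lo_def Up_def)
  then have ne: "Lo N \<noteq> {}" "Up N \<noteq> {}" if "N \<ge> 1" for N using that by blast+
  have c0: "min 1 c0 \<le> c N" if "N \<ge> 1" for N
    unfolding c_def by (rule cSup_upper[OF Lo0[OF that] bdd(1)])
  have c1: "c N \<le> 1" if "N \<ge> 1" for N
    unfolding c_def by (rule cSup_least[OF ne(1)[OF that]]) (simp add: Lo_def)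
  have C1: "1 \<le> C N" if "N \<ge> 1" for N
    unfolding C_def by (rule cInf_greatest[OF ne(2)[OF that]]) (simp add: Up_def)
  have lowc: "lower_bd x N (c N)" if N: "N \<ge> 1" for N
    unfolding lower_bd_def
  proof (intro allI impI)
    fix F and b :: "nat \<Rightarrow> complex" assume F: "finite F" "F \<subseteq> {N..}"
    let ?S = "\<Sum>n\<in>F. (norm (b n))\<^sup>2" and ?R = "(H2_norm (lincomb F b x))\<^sup>2"
    have le: "d * ?S \<le> ?R" if "d \<in> Lo N" for d using that F by (auto simp: Lo_def lower_bd_def)
    have S0: "0 \<le> ?S" by (rule sum_nonneg) auto
    show "c N * ?S \<le> ?R"
    proof (cases "?S = 0")
      case False
      then have S: "0 < ?S" using S0 by linarith
      have "c N \<le> ?R / ?S"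
        unfolding c_def by (rule cSup_least[OF ne(1)[OF N]]) (use le S in \<open>simp add:
            pos_le_divide_eq\<close>)
      then show ?thesis using S by (simp add: pos_le_divide_eq)
    qed simp
  qed
  have upC: "upper_bd x N (C N)" if N: "N \<ge> 1" for N
    unfolding upper_bd_def
  proof (intro allI impI)
    fix F and b :: "nat \<Rightarrow> complex" assume F: "finite F" "F \<subseteq> {N..}"
    let ?S = "\<Sum>n\<in>F. (norm (b n))\<^sup>2" and ?R = "(H2_norm (lincomb F b x))\<^sup>2"
    have le: "?R \<le> d * ?S" if "d \<in> Up N" for d using that F by (auto simp: Up_def upper_bd_def)
    have S0: "0 \<le> ?S" by (rule sum_nonneg) auto
    show "?R \<le> C N * ?S"
    proof (cases "?S = 0")
      case True
      then show ?thesis using le[OF Up0[OF N]] by simp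
    next
      case False
      then have S: "0 < ?S" using S0 by linarith
      have "?R / ?S \<le> C N"
        unfolding C_def by (rule cInf_greatest[OF ne(2)[OF N]]) (use le S in \<open>simp add:
            pos_divide_le_eq\<close>)
      then show ?thesis using S by (simp add: pos_divide_le_eq)
    qed
  qed
  have near: "\<forall>\<^sub>F N in sequentially. 1 - e \<le> c N \<and> c N \<le> 1 \<and> 1 \<le> C N \<and> C N \<le> 1 + e" if e: "e > 0"
      for e
  proof -
    obtain N0 where N0: "N0 \<ge> 1" "lower_bd x N0 (1 - e)" "upper_bd x N0 (1 + e)" using asym[OF e]
        by blast
    show ?thesis
    proof (rule eventually_sequentiallyI)
      fix N assume N: "N \<ge> N0"
      have "1 - e \<in> Lo N" "1 + e \<in> Up N"
        using lower_bd_mono[OF N0(2) N order_refl] upper_bd_mono[OF N0(3) N order_refl] e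
            by (auto simp: Lo_def Up_def)
      then show "1 - e \<le> c N \<and> c N \<le> 1 \<and> 1 \<le> C N \<and> C N \<le> 1 + e"
        using cSup_upper[OF _ bdd(1)] cInf_lower[OF _ bdd(2)] c1 C1 N N0(1)
            by (auto simp: c_def C_def)
    qed
  qed
  have lim: "c \<longlonglongrightarrow> 1" "C \<longlonglongrightarrow> 1"
  proof -
    have "\<forall>\<^sub>F N in sequentially. dist (c N) 1 < e \<and> dist (C N) 1 < e" if "e > 0" for e
      using near[of "e / 2"] that by (auto elim!: eventually_mono simp: dist_real_def)
    from this[THEN eventually_mono] show "c \<longlonglongrightarrow> 1" "C \<longlonglongrightarrow> 1" by (auto intro!: tendstoI)
  qed
  have main: "\<exists>g\<in>H. (\<lambda>M. H2_norm (\<lambda>z. g z - (\<Sum>n=N..M. a n * x n z))) \<longlonglongrightarrow> 0 \<and>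
      c N * (\<Sum>\<^sub>\<infinity>n\<in>{N..}. (norm (a n))\<^sup>2) \<le> (H2_norm g)\<^sup>2 \<and>
      (H2_norm g)\<^sup>2 \<le> C N * (\<Sum>\<^sub>\<infinity>n\<in>{N..}. (norm (a n))\<^sup>2)" if N: "N \<ge> 1" and a: "a \<in> ell2" for N a
  proof -
    define S where "S = (\<lambda>M z. \<Sum>n=N..M. a n * x n z)"
    define A where "A = (\<lambda>M. \<Sum>n=N..M. (norm (a n))\<^sup>2)"
    have Alim: "A \<longlonglongrightarrow> (\<Sum>\<^sub>\<infinity>n\<in>{N..}. (norm (a n))\<^sup>2)" unfolding A_def
        by (rule tail_partial_sums[OF a N])
    have SH: "S M \<in> H" for M unfolding S_def using x N by (intro closed_subspace_sum[OF H]) auto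
    note S2 = closed_subspace_H2[OF H SH]
    \<comment> \<open>A block of the series is a finite combination, so the upper bound turns the
      Cauchy property of the partial sums \<open>A\<close> into that of \<open>S\<close> in
      norm.\<close>
    have diff: "(H2_norm (\<lambda>z. S m z - S n z))\<^sup>2 \<le> C N * (A m - A n)" if "n \<le> m" for m n
    proof -
      let ?I = "{N..m} \<inter> {n<..}"
      have U: "{N..n} \<union> ?I = {N..m}" using that by auto
      have "(\<Sum>k\<in>{N..n} \<union> ?I. a k * x k z) = (\<Sum>k\<in>{N..n}. a k * x k z) + (\<Sum>k\<in>?I. a k * x k z)" for z
        by (rule sum.union_disjoint) auto
      then have "(\<lambda>z. S m z - S n z) = (\<lambda>z. \<Sum>k\<in>?I. a k * x k z)" by (simp add: U S_def)
      moreover have "(\<Sum>k\<in>{N..n} \<union> ?I. (norm (a k))\<^sup>2) = (\<Sum>k\<in>{N..n}. (norm (a k))\<^sup>2)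
          + (\<Sum>k\<in>?I. (norm (a k))\<^sup>2)"
        by (rule sum.union_disjoint) auto
      then have "A m - A n = (\<Sum>k\<in>?I. (norm (a k))\<^sup>2)" by (simp add: U A_def)
      moreover have "finite ?I" "?I \<subseteq> {N..}" by auto
      ultimately show ?thesis using upC[OF N, unfolded upper_bd_def, rule_format, of ?I a]
          by (simp only:)
    qed
    have "\<exists>K. \<forall>m\<ge>K. \<forall>n\<ge>K. H2_norm (\<lambda>z. S m z - S n z) < e" if e: "e > 0" for e
    proof -
      have C0: "0 < C N" using C1[OF N] by simp
      have "Cauchy A" using Alim by (rule LIMSEQ_imp_Cauchy)
      moreover have "0 < e\<^sup>2 / C N" using e C0 by simp
      ultimately obtain K where "\<forall>m\<ge>K. \<forall>n\<ge>K. dist (A m) (A n) < e\<^sup>2 / C N"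
        by (rule metric_CauchyD[THEN exE])
      then have K: "\<bar>A m - A n\<bar> < e\<^sup>2 / C N" if "m \<ge> K" "n \<ge> K" for m n
        using that by (simp add: dist_real_def)
      have *: "H2_norm (\<lambda>z. S m z - S n z) < e" if "K \<le> n" "n \<le> m" for m n
      proof -
        have "(H2_norm (\<lambda>z. S m z - S n z))\<^sup>2 \<le> C N * (A m - A n)" by (rule diff[OF that(2)])
        moreover have "C N * (A m - A n) < C N * (e\<^sup>2 / C N)"
          using K[of m n] that C0 by (intro mult_strict_left_mono) auto
        moreover have "C N * (e\<^sup>2 / C N) = e\<^sup>2" using C0 by simp
        ultimately have "(H2_norm (\<lambda>z. S m z - S n z))\<^sup>2 < e\<^sup>2" by linarith
        then show ?thesis by (rule power2_less_imp_less) (use e in simp)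
      qed
      have "H2_norm (\<lambda>z. S m z - S n z) < e" if "m \<ge> K" "n \<ge> K" for m n
        using *[of n m] *[of m n] that H2_norm_diff_commute[OF S2 S2, of m n] by (cases "n
            \<le> m") auto
      then show ?thesis by blast
    qed
    from closed_subspace_complete[OF H SH this] obtain g where g: "g \<in> H"
      and gl: "(\<lambda>M. H2_norm (\<lambda>z. g z - S M z)) \<longlonglongrightarrow> 0" by blast
    have nl: "(\<lambda>M. (H2_norm (S M))\<^sup>2) \<longlonglongrightarrow> (H2_norm g)\<^sup>2"
      by (intro tendsto_power H2_norm_tendsto closed_subspace_H2[OF H g] S2 gl)
    have bd: "c N * A M \<le> (H2_norm (S M))\<^sup>2" "(H2_norm (S M))\<^sup>2 \<le> C N * A M" for M
      using lowc[OF N, unfolded lower_bd_def, rule_format, of "{N..M}" a]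
        upC[OF N, unfolded upper_bd_def, rule_format, of "{N..M}" a] by (simp_all add: A_def S_def)
    have "c N * (\<Sum>\<^sub>\<infinity>n\<in>{N..}. (norm (a n))\<^sup>2) \<le> (H2_norm g)\<^sup>2"
      by (rule LIMSEQ_le[OF tendsto_mult_left[OF Alim] nl]) (use bd in blast)
    moreover have "(H2_norm g)\<^sup>2 \<le> C N * (\<Sum>\<^sub>\<infinity>n\<in>{N..}. (norm (a n))\<^sup>2)"
      by (rule LIMSEQ_le[OF nl tendsto_mult_left[OF Alim]]) (use bd in blast)
    ultimately show ?thesis using g gl unfolding S_def by blast
  qed
  have pos: "0 < c N" "0 < C N" if "N \<ge> 1" for N
    using c0[OF that] C1[OF that] low0(1) by auto
  show ?thesis unfolding AOB_def using x lim main pos by blast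
qed

section \<open>Blaschke products and thin sequences\<close>

lemma norm_blaschke_factor_lt_1:
  assumes "norm a < 1" "norm z < 1"
  shows "norm (blaschke_factor a z) < 1"
proof -
  have "1 - (norm (blaschke_factor a z))\<^sup>2 > 0"
    unfolding one_minus_blaschke_factor[OF assms(1) less_imp_le[OF assms(2)]]
    using assms one_minus_cnj_mult_nonzero'[OF assms(1) less_imp_le[OF assms(2)]]
    by (intro divide_pos_pos mult_pos_pos) (auto simp: abs_square_less_1)
  then show ?thesis by (simp add: abs_square_less_1)
qed

lemma inner_function_blaschke_factor:
  assumes a: "norm a < 1"
  shows "inner_function (blaschke_factor a)"
  unfolding inner_function_def
proof
  show "blaschke_factor a \<in> H_inf"
    using holomorphic_blaschke_factor[OF a] norm_blaschke_factor_le_1[OF a]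
    by (auto simp: H_inf_def bounded_iff intro!: exI[of _ 1])
  show "AE t in lborel. t \<in> {0..2 * pi} \<longrightarrow>
      (\<exists>u. norm u = 1 \<and> ((\<lambda>r. blaschke_factor a (of_real r * cis t)) \<longlongrightarrow> u) (at_left 1))"
  proof (intro AE_I2 impI)
    fix t :: real
    have nz: "1 - cnj a * cis t \<noteq> 0" by (rule one_minus_cnj_mult_nonzero'[OF a]) simp
    have "((\<lambda>r. blaschke_factor a (of_real r * cis t)) \<longlongrightarrow> blaschke_factor a (of_real 1 * cis t))
        (at_left 1)"
      unfolding blaschke_factor_def using nz by (intro tendsto_intros) auto
    moreover have "(norm (blaschke_factor a (cis t)))\<^sup>2 = 1"
      using one_minus_blaschke_factor[OF a, of "cis t"] by simp
    then have "norm (blaschke_factor a (cis t)) = 1"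
      using norm_ge_zero[of "blaschke_factor a (cis t)"] by (simp only: power2_eq_1_iff) linarith
    ultimately show "\<exists>u. norm u = 1 \<and> ((\<lambda>r. blaschke_factor a (of_real r * cis t)) \<longlongrightarrow> u) (at_left 1)"
      by auto
  qed
qed

lemma inner_function_id: "inner_function (\<lambda>z. z)"
  using inner_function_blaschke_factor[of 0] by (simp add: blaschke_factor_def[abs_def])

section \<open>Division by zeros\<close>

lemma H2_divide_linear:
  assumes f: "f \<in> H2" and a: "norm a < 1" and fa: "f a = 0"
  obtains h where "h \<in> H2" "\<And>z. norm z < 1 \<Longrightarrow> f z = (z - a) * h z"
proof -
  define h where "h = (\<lambda>z. if z = a then deriv f a else (f z - f a) / (z - a))"
  have hol: "h holomorphic_on unit_disc"
    unfolding h_def by (rule pole_lemma_open[OF H2_holomorphic[OF f]]) simp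
  \<comment> \<open>On the annulus |z| >= (1 + |a|) / 2 the distance to \<open>a\<close> is at least
    (1 - |a|) / 2; the removable singularity lies outside it.\<close>
  have "norm (h z) \<le> 2 / (1 - norm a) * norm (f z)" if z: "(1 + norm a) / 2 \<le> norm z" for z
  proof -
    have d: "(1 - norm a) / 2 \<le> norm (z - a)" using norm_triangle_ineq2[of z a] z
        by (simp add: field_simps)
    then have nz: "z \<noteq> a" "0 < norm (z - a)" using a by auto
    have "norm (h z) = norm (f z) / norm (z - a)" using nz fa by (simp add: h_def norm_divide)
    also have "\<dots> \<le> norm (f z) / ((1 - norm a) / 2)"
      using d a nz by (intro divide_left_mono mult_pos_pos) auto
    finally show ?thesis by (simp add: field_simps)
  qed
  then have "h \<in> H2" using a by (intro H2_comparison(1)[OF hol f, of "2 / (1 - norm a)" "(1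
      + norm a) / 2"]) auto
  then show ?thesis by (rule that) (use fa in \<open>auto simp: h_def\<close>)
qed

text \<open>The quotient by z - a is multiplied by 1 - cnj a * z. The norm is preserved because a
  Blaschke factor is inner.\<close>

lemma H2_divide_blaschke:
  assumes f: "f \<in> H2" and a: "norm a < 1" and fa: "f a = 0"
  obtains g where "g \<in> H2" "\<And>z. norm z < 1 \<Longrightarrow> f z = blaschke_factor a z * g z" "H2_norm g
      = H2_norm f"
proof -
  obtain h where h: "h \<in> H2" "\<And>z. norm z < 1 \<Longrightarrow> f z = (z - a) * h z"
    using H2_divide_linear[OF assms] by blast
  define g where "g = (\<lambda>z. (1 - cnj a * z) * h z)"
  have "norm (1 - cnj a * z) \<le> 2" if "norm z < 1" for z
  proof -
    have "norm (cnj a * z) \<le> 1 * 1" unfolding norm_mult using a that by (intro mult_mono) auto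
    then show ?thesis using norm_triangle_ineq4[of 1 "cnj a * z"] by simp
  qed
  then have g: "g \<in> H2" unfolding g_def by (intro H2_mult(1)[OF _ _ h(1)] holomorphic_intros) auto
  have fg: "f z = blaschke_factor a z * g z" if "norm z < 1" for z
    using h(2)[OF that] one_minus_cnj_mult_nonzero'[OF a, of z] that
        by (simp add: g_def blaschke_factor_def)
  have "H2_norm f = H2_norm (\<lambda>z. blaschke_factor a z * g z)"
    by (rule H2_norm_cong[OF H2_inner_function_mult[OF inner_function_blaschke_factor[OF a] g]])
        (rule fg)
  then have "H2_norm g = H2_norm f"
    using inner_function_norm[OF inner_function_blaschke_factor[OF a] g] by simp
  then show ?thesis using that g fg by blast
qed

lemma H2_kernel_norm_sq:
  assumes "norm w < 1"
  shows "(H2_norm (H2_kernel w))\<^sup>2 = 1 / (1 - (norm w)\<^sup>2)"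
proof -
  have "complex_of_real ((H2_norm (H2_kernel w))\<^sup>2) = H2_kernel w w"
    using H2_inner_self[OF H2_kernel_in_H2[OF assms]] H2_reproducing[OF H2_kernel_in_H2 assms]
        assms by simp
  also have "\<dots> = of_real (1 / (1 - (norm w)\<^sup>2))"
    using complex_norm_square[of w] by (simp add: H2_kernel_def mult.commute)
  finally show ?thesis by (simp only: of_real_eq_iff)
qed

lemma norm_sq_less_1: "norm (w :: 'a::real_normed_vector) < 1 \<Longrightarrow> (norm w)\<^sup>2 < 1"
  by (simp add: abs_square_less_1)

text \<open>Each zero is divided out without changing the norm and contributes its Blaschke factor
  at \<open>w\<close>; what remains is estimated by point evaluation. As \<open>A\<close> is a set,
  the other zeros survive each division.\<close>

lemma H2_zeros_bound:
  assumes "finite A" "A \<subseteq> unit_disc" "f \<in> H2" "\<And>a. a \<in> A \<Longrightarrow> f a = 0" and w: "norm w < 1"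
  shows "(norm (f w))\<^sup>2 * (1 - (norm w)\<^sup>2) \<le> (H2_norm f)\<^sup>2 * (\<Prod>a\<in>A. (norm (blaschke_factor a w))\<^sup>2)"
  using assms(1-4)
proof (induction A arbitrary: f)
  case empty
  have "norm (f w) \<le> H2_norm f * H2_norm (H2_kernel w)"
    using H2_Cauchy_Schwarz[OF empty(2) H2_kernel_in_H2[OF w]] H2_reproducing[OF empty(2) w] by simp
  then have "(norm (f w))\<^sup>2 \<le> (H2_norm f * H2_norm (H2_kernel w))\<^sup>2" by (rule power_mono) simp
  also have "\<dots> = (H2_norm f)\<^sup>2 / (1 - (norm w)\<^sup>2)"
    by (simp add: power_mult_distrib H2_kernel_norm_sq[OF w])
  finally show ?case using norm_sq_less_1[OF w] by (simp add: pos_le_divide_eq)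
next
  case (insert a A)
  have a: "norm a < 1" using insert.prems by auto
  obtain g where g: "g \<in> H2" "\<And>z. norm z < 1 \<Longrightarrow> f z = blaschke_factor a z * g z" "H2_norm g
      = H2_norm f"
    using H2_divide_blaschke[OF insert.prems(2) a] insert.prems(3) by blast
  have g0: "g a' = 0" if a': "a' \<in> A" for a'
  proof -
    have "norm a' < 1" "a' \<noteq> a" using a' insert by auto
    moreover from this have "blaschke_factor a a' \<noteq> 0"
      using one_minus_cnj_mult_nonzero'[OF a, of a'] by (simp add: blaschke_factor_def)
    ultimately show ?thesis using g(2)[of a'] insert.prems(3)[of a'] a' by simp
  qed
  have "(norm (f w))\<^sup>2 * (1 - (norm w)\<^sup>2) = (norm (blaschke_factor a w))\<^sup>2 * ((norm (g w))\<^sup>2 * (1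
      - (norm w)\<^sup>2))"
    by (simp add: g(2)[OF w] norm_mult power_mult_distrib)
  also have "\<dots> \<le> (norm (blaschke_factor a w))\<^sup>2 * ((H2_norm g)\<^sup>2 * (\<Prod>a\<in>A. (norm (blaschke_factor a
      w))\<^sup>2))"
    using insert.IH[OF _ g(1) g0] insert.prems by (intro mult_left_mono) auto
  finally show ?case using insert g(3) by (simp add: mult_ac)
qed

lemma prod_subset_antimono:
  fixes f :: "'a \<Rightarrow> real"
  assumes "finite B" "A \<subseteq> B" "\<And>b. b \<in> B \<Longrightarrow> 0 \<le> f b \<and> f b \<le> 1"
  shows "prod f B \<le> prod f A"
proof -
  have "prod f B = prod f (B - A) * prod f A" by (rule prod.subset_diff[OF assms(2,1)])
  also have "\<dots> \<le> 1 * prod f A" using assms by (intro mult_right_mono prod_le_1 prod_nonneg) auto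
  finally show ?thesis by simp
qed

section \<open>Pseudohyperbolic distances and thinness\<close>

definition rho :: "(nat \<Rightarrow> complex) \<Rightarrow> nat \<Rightarrow> nat \<Rightarrow> real" where
  "rho lam j k = norm (blaschke_factor (lam k) (lam j))"

lemma delta_eq: "delta lam j = lim (\<lambda>n. \<Prod>k\<in>{1..n} - {j}. rho lam j k)"
  by (simp add: delta_def rho_def blaschke_factor_def)

lemma rho_commute: "rho lam j k = rho lam k j"
  unfolding rho_def by (rule norm_blaschke_factor_commute)

lemma rho_nonneg [simp]: "0 \<le> rho lam j k"
  by (simp add: rho_def)

lemma rho_le_1:
  assumes "\<And>n. n \<ge> 1 \<Longrightarrow> norm (lam n) < 1" "j \<ge> 1" "k \<ge> 1"
  shows "rho lam j k \<le> 1"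
  unfolding rho_def using assms by (intro norm_blaschke_factor_le_1) (auto intro: less_imp_le)

lemma delta_lim:
  assumes lam: "\<And>n. n \<ge> 1 \<Longrightarrow> norm (lam n) < 1" and j: "j \<ge> 1"
  shows "(\<lambda>n. \<Prod>k\<in>{1..n} - {j}. rho lam j k) \<longlonglongrightarrow> delta lam j"
    and "delta lam j \<le> (\<Prod>k\<in>{1..n} - {j}. rho lam j k)" and "delta lam j \<le> 1" "0 \<le> delta lam j"
proof -
  let ?P = "\<lambda>n. \<Prod>k\<in>{1..n} - {j}. rho lam j k"
  have r1: "rho lam j k \<le> 1" if "k \<ge> 1" for k using rho_le_1[OF lam j that] .
  have "?P (Suc n) \<le> ?P n" for n
    by (rule prod_subset_antimono) (use r1 in auto)
  then have dec: "decseq ?P" by (rule decseq_SucI)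
  have P0: "0 \<le> ?P n" for n by (rule prod_nonneg) auto
  obtain L where L: "?P \<longlonglongrightarrow> L" "\<And>n. L \<le> ?P n"
    using decseq_convergent[OF dec, of 0] P0 by blast
  then have dl: "delta lam j = L" unfolding delta_eq by (simp add: limI)
  show "?P \<longlonglongrightarrow> delta lam j" "delta lam j \<le> ?P n" using L dl by auto
  have "?P 0 = 1" by simp
  then show "delta lam j \<le> 1" using L(2)[of 0] dl by simp
  show "0 \<le> delta lam j" using LIMSEQ_le_const[OF L(1)] P0 dl by auto
qed

lemma prod_rho_ge_delta:
  assumes lam: "\<And>n. n \<ge> 1 \<Longrightarrow> norm (lam n) < 1" and j: "j \<ge> 1" and F: "finite F" "F \<subseteq> {1..}"
  shows "delta lam j \<le> (\<Prod>k\<in>F - {j}. rho lam j k)"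
proof -
  obtain n where n: "\<forall>k\<in>F. k \<le> n" using F(1) unfolding finite_nat_set_iff_bounded_le by (elim exE)
  have "delta lam j \<le> (\<Prod>k\<in>{1..n} - {j}. rho lam j k)" by (rule delta_lim(2)[OF lam j])
  also have "\<dots> \<le> (\<Prod>k\<in>F - {j}. rho lam j k)"
  proof (rule prod_subset_antimono)
    show "F - {j} \<subseteq> {1..n} - {j}" using n F(2) by auto
  qed (use rho_le_1[OF lam j] in auto)
  finally show ?thesis .
qed

lemma interpolating_disc: "interpolating lam \<Longrightarrow> n \<ge> 1 \<Longrightarrow> norm (lam n) < 1"
  by (simp add: interpolating_def)

lemma interpolating_unit_vector:
  assumes "interpolating lam" "j \<ge> 1"
  obtains f where "f \<in> H2" "f (lam j) = 1" "\<And>k. k \<ge> 1 \<Longrightarrow> k \<noteq> j \<Longrightarrow> f (lam k) = 0"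
proof -
  define w where "w = (\<lambda>k. if k = j then 1 else 0 :: complex)"
  have "bounded (w ` {1..})" by (rule bounded_subset[of "{0, 1}"]) (auto simp: w_def)
  then obtain f where f: "f \<in> H_inf" "\<forall>k\<ge>1. f (lam k) = w k"
    using assms unfolding interpolating_def by blast
  obtain M where M: "\<forall>z\<in>unit_disc. norm (f z) \<le> M"
    using f(1) unfolding H_inf_def bounded_iff by auto
  \<comment> \<open>\<open>H2_kernel 0\<close> is the constant 1, so the multiplier estimate places
    f itself in \<open>H2\<close>.\<close>
  have "(\<lambda>z. f z * H2_kernel 0 z) \<in> H2"
    using f(1) M by (intro H2_mult(1) H2_kernel_in_H2) (auto simp: H_inf_def)
  then have "f \<in> H2" by (simp add: H2_kernel_def)
  then show ?thesis using that[of f] f(2) assms(2) by (auto simp: w_def)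
qed

lemma interpolating_inj:
  assumes "interpolating lam" shows "inj_on lam {1..}"
proof (rule inj_onI)
  fix j k assume jk: "j \<in> {1..}" "k \<in> {1..}" "lam j = lam k"
  obtain f where "f \<in> H2" "f (lam j) = 1" "\<And>k. k \<ge> 1 \<Longrightarrow> k \<noteq> j \<Longrightarrow> f (lam k) = 0"
    using interpolating_unit_vector[OF assms jk(1)[unfolded atLeast_iff]] by blast
  then show "j = k" using jk by force
qed

lemma H2_zeros_bound_seq:
  assumes int: "interpolating lam" and F: "finite F" "F \<subseteq> {1..}" and j: "j \<ge> 1"
    and f: "f \<in> H2" "\<And>k. k \<in> F - {j} \<Longrightarrow> f (lam k) = 0"
  shows "(norm (f (lam j)))\<^sup>2 * (1 - (norm (lam j))\<^sup>2) \<le> (H2_norm f)\<^sup>2 * (\<Prod>k\<in>F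
      - {j}. (rho lam j k)\<^sup>2)"
proof -
  have inj: "inj_on lam (F - {j})"
      by (rule inj_on_subset[OF interpolating_inj[OF int]]) (use F in auto)
  have "(norm (f (lam j)))\<^sup>2 * (1 - (norm (lam j))\<^sup>2) \<le>
      (H2_norm f)\<^sup>2 * (\<Prod>a\<in>lam ` (F - {j}). (norm (blaschke_factor a (lam j)))\<^sup>2)"
    using F f interpolating_disc[OF int] j by (intro H2_zeros_bound) auto
  then show ?thesis by (simp add: prod.reindex[OF inj] rho_def)
qed

text \<open>A function with value 1 at lam j that vanishes at all other points bounds every partial
  product away from 0 through \<open>H2_zeros_bound_seq\<close>, uniformly in the number of
  factors.\<close>

lemma delta_pos:
  assumes int: "interpolating lam" and j: "j \<ge> 1"
  shows "0 < delta lam j"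
proof -
  obtain f where f: "f \<in> H2" "f (lam j) = 1" "\<And>k. k \<ge> 1 \<Longrightarrow> k \<noteq> j \<Longrightarrow> f (lam k) = 0"
    using interpolating_unit_vector[OF int j] by blast
  define e where "e = 1 - (norm (lam j))\<^sup>2"
  have e: "0 < e" using norm_sq_less_1[OF interpolating_disc[OF int j]] by (simp add: e_def)
  have le: "e \<le> (H2_norm f)\<^sup>2 * (\<Prod>k\<in>{1..n} - {j}. rho lam j k)\<^sup>2" for n
    using H2_zeros_bound_seq[OF int _ _ j f(1), of "{1..n}"] f
        by (simp add: e_def prod_power_distrib)
  have "(\<lambda>n. (H2_norm f)\<^sup>2 * (\<Prod>k\<in>{1..n} - {j}. rho lam j k)\<^sup>2) \<longlonglongrightarrow> (H2_norm f)\<^sup>2 * (delta lam j)\<^sup>2"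
    by (intro tendsto_intros delta_lim(1) j interpolating_disc[OF int])
  from LIMSEQ_le_const[OF this, of e] le have "e \<le> (H2_norm f)\<^sup>2 * (delta lam j)\<^sup>2" by auto
  then have "delta lam j \<noteq> 0" using e by auto
  then show ?thesis using delta_lim(4)[of lam, OF interpolating_disc[OF int] j] by simp
qed

text \<open>The distances are the ratios of consecutive partial products of delta, and these
  products converge to a positive limit. Symmetry of \<open>rho\<close> then lets \<open>j\<close>
  be the moving index.\<close>

lemma rho_tendsto_1:
  assumes int: "interpolating lam" and k: "k \<ge> 1"
  shows "(\<lambda>j. rho lam j k) \<longlonglongrightarrow> 1"
proof -
  let ?P = "\<lambda>n. \<Prod>i\<in>{1..n} - {k}. rho lam k i"
  note lim = delta_lim(1)[of lam, OF interpolating_disc[OF int] k] and dp = delta_pos[OF int k]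
  have "(\<lambda>n. ?P (Suc n) / ?P n) \<longlonglongrightarrow> delta lam k / delta lam k"
    using lim dp by (intro tendsto_divide LIMSEQ_Suc) auto
  then have *: "(\<lambda>n. ?P (Suc n) / ?P n) \<longlonglongrightarrow> 1" using dp by simp
  have Ppos: "?P n > 0" for n
    using delta_lim(2)[of lam, OF interpolating_disc[OF int] k, of n] dp by linarith
  have "?P (Suc n) / ?P n = rho lam (Suc n) k" if n: "n \<ge> k" for n
  proof -
    have "{1..Suc n} - {k} = insert (Suc n) ({1..n} - {k})" using n by auto
    then have "?P (Suc n) = rho lam (Suc n) k * ?P n" by (simp add: rho_commute[of lam k "Suc n"])
    then show ?thesis using Ppos[of n]
        by (simp only: nonzero_mult_div_cancel_right less_imp_neq[symmetric] not_False_eq_True)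
  qed
  then have "(\<lambda>n. rho lam (Suc n) k) \<longlonglongrightarrow> 1"
    by (intro Lim_transform_eventually[OF *] eventually_sequentiallyI[of k])
  then show ?thesis by (rule LIMSEQ_imp_Suc)
qed

lemma prod_ge_one_minus_sum:
  fixes p :: "'a \<Rightarrow> real"
  assumes "finite F" "\<And>k. k \<in> F \<Longrightarrow> 0 \<le> p k \<and> p k \<le> 1"
  shows "1 - (\<Sum>k\<in>F. 1 - p k) \<le> (\<Prod>k\<in>F. p k)"
  using assms
proof (induction F)
  case (insert a F)
  define S where "S = (\<Sum>k\<in>F. 1 - p k)"
  have IH: "1 - S \<le> prod p F" using insert by (simp add: S_def)
  have S: "0 \<le> S" unfolding S_def using insert by (intro sum_nonneg) auto
  have "1 - (1 - p a + S) \<le> p a * (1 - S)"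
  proof -
    have "p a * (1 - S) - (1 - (1 - p a + S)) = (1 - p a) * S" by (simp add: algebra_simps)
    also have "\<dots> \<ge> 0" using insert S by (intro mult_nonneg_nonneg) auto
    finally show ?thesis by simp
  qed
  also have "\<dots> \<le> p a * prod p F" using IH insert by (intro mult_left_mono) auto
  finally show ?case using insert by (simp add: S_def)
qed simp

text \<open>For fixed N the factors with k < N tend to 1 as j grows, by
  \<open>rho_tendsto_1\<close>; the remaining ones are controlled uniformly by the row sum.\<close>

lemma thin_of_row_sums:
  assumes int: "interpolating lam"
    and rows: "\<And>e. e > 0 \<Longrightarrow> \<exists>N\<ge>1. \<forall>j\<ge>N. \<forall>F. finite F \<longrightarrow> F \<subseteq> {N..} - {j} \<longrightarrow> (\<Sum>k\<in>F. 1
        - (rho lam j k)\<^sup>2) \<le> e"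
  shows "thin lam"
  unfolding thin_def
proof (rule tendstoI)
  fix e :: real assume e: "0 < e"
  note disc = interpolating_disc[OF int]
  \<comment> \<open>Head and tail of the product are each at least 1 - d, and (1 - d)^2 >= 1 - 2 d >
    1 - e.\<close>
  define d where "d = min (e / 3) (1 / 2)"
  have d: "0 < d" "d < 1" "2 * d < e" using e by (auto simp: d_def min_def)
  obtain N where N: "N \<ge> 1" and sums: "\<forall>j\<ge>N. \<forall>F. finite F \<longrightarrow> F \<subseteq> {N..} - {j} \<longrightarrow>
      (\<Sum>k\<in>F. 1 - (rho lam j k)\<^sup>2) \<le> d" using rows[OF d(1)] by (elim exE conjE)
  define Q where "Q = (\<lambda>j. \<Prod>k\<in>{1..<N}. rho lam j k)"
  have "Q \<longlonglongrightarrow> (\<Prod>k\<in>{1..<N}. 1)" unfolding Q_def by (intro tendsto_prod rho_tendsto_1[OF int]) auto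
  then have "Q \<longlonglongrightarrow> 1" by simp
  then have "\<forall>\<^sub>F j in sequentially. 1 - d < Q j" using order_tendstoD(1)[of Q 1 sequentially "1
      - d"] d by simp
  moreover have "\<forall>\<^sub>F j in sequentially. j \<ge> N" by (rule eventually_ge_at_top)
  ultimately show "\<forall>\<^sub>F j in sequentially. dist (delta lam j) 1 < e"
  proof eventually_elim
    case (elim j)
    have j: "j \<ge> 1" using elim(2) N by simp
    have r1: "rho lam j k \<le> 1" if "k \<ge> 1" for k using rho_le_1[OF disc j that] .
    have "(1 - d) * (1 - d) \<le> (\<Prod>k\<in>{1..n} - {j}. rho lam j k)" if n: "n \<ge> N" for n
    proof -
      have U: "{1..<N} \<union> ({N..n} - {j}) = {1..n} - {j}" using N n elim(2) by auto
      have "(\<Prod>k\<in>{1..<N} \<union> ({N..n} - {j}). rho lam j k) = Q j * (\<Prod>k\<in>{N..n} - {j}. rho lam j k)"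
        unfolding Q_def by (rule prod.union_disjoint) auto
      then have "(\<Prod>k\<in>{1..n} - {j}. rho lam j k) = Q j * (\<Prod>k\<in>{N..n} - {j}. rho lam j k)"
        unfolding U .
      moreover have "1 - d \<le> (\<Prod>k\<in>{N..n} - {j}. rho lam j k)"
      proof -
        have "1 - d \<le> 1 - (\<Sum>k\<in>{N..n} - {j}. 1 - (rho lam j k)\<^sup>2)"
          using sums[rule_format, OF elim(2), of "{N..n}
              - {j}"] Diff_mono[of "{N..n}" "{N..}" "{j}"]
          by (simp add: subset_iff)
        also have "\<dots> \<le> (\<Prod>k\<in>{N..n} - {j}. (rho lam j k)\<^sup>2)"
          by (rule prod_ge_one_minus_sum) (use r1 N in \<open>auto simp: power_le_one\<close>)
        also have "\<dots> \<le> (\<Prod>k\<in>{N..n} - {j}. rho lam j k)"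
          by (rule prod_mono) (use r1 N in \<open>auto simp: power2_eq_square mult_left_le\<close>)
        finally show ?thesis .
      qed
      ultimately show ?thesis using elim(1) d by (auto intro!: mult_mono)
    qed
    then have "(1 - d) * (1 - d) \<le> delta lam j"
      by (intro LIMSEQ_le_const[OF delta_lim(1)[OF disc j]]) auto
    moreover have "1 - 2 * d \<le> (1 - d) * (1 - d)" by (simp add: algebra_simps)
    moreover have "delta lam j \<le> 1" by (rule delta_lim(3)[OF disc j])
    ultimately show ?case using d by (simp add: dist_real_def)
  qed
qed

lemma thin_imp_products:
  assumes int: "interpolating lam" and thin: "thin lam" and d: "d < 1"
  shows "\<exists>N\<ge>1. \<forall>F. finite F \<longrightarrow> F \<subseteq> {N..} \<longrightarrow> (\<forall>j\<in>F. d \<le> (\<Prod>k\<in>F - {j}. rho lam j k))"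
proof -
  have "\<forall>\<^sub>F j in sequentially. d < delta lam j"
    using thin d unfolding thin_def by (rule order_tendstoD)
  then obtain N0 where N0: "\<And>j. j \<ge> N0 \<Longrightarrow> d < delta lam j" by (auto simp: eventually_sequentially)
  show ?thesis
  proof (intro exI[of _ "max 1 N0"] conjI allI impI ballI)
    fix F j assume F: "finite F" "F \<subseteq> {max 1 N0..}" and j: "j \<in> F"
    have "d < delta lam j" using N0 j F by auto
    also have "\<dots> \<le> (\<Prod>k\<in>F - {j}. rho lam j k)"
      by (rule prod_rho_ge_delta[OF interpolating_disc[OF int]]) (use F j in auto)
    finally show "d \<le> (\<Prod>k\<in>F - {j}. rho lam j k)" by simp
  qed simp
qed

section \<open>Riesz bounds for kernels at thin sequences\<close>

text \<open>The average of the squared norm over all signs is the sum of the squared norms, so both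
  choices exist. They are found greedily: each new sign makes the cross term with the vectors
  already treated nonnegative or nonpositive. The parameter s = 1 or -1 handles both cases in one
  induction.\<close>

lemma signs_exist:
  assumes "finite F" "\<And>i. i \<in> F \<Longrightarrow> v i \<in> H2"
  shows "\<exists>w. (\<forall>i. w i \<in> {-1, 1}) \<and> (\<Sum>i\<in>F. (H2_norm (v i))\<^sup>2) \<le> (H2_norm (\<lambda>z. \<Sum>i\<in>F. of_real (w i) *
      v i z))\<^sup>2"
    and "\<exists>w. (\<forall>i. w i \<in> {-1, 1}) \<and> (H2_norm (\<lambda>z. \<Sum>i\<in>F. of_real (w i) * v i z))\<^sup>2
        \<le> (\<Sum>i\<in>F. (H2_norm (v i))\<^sup>2)"
proof -
  have "\<exists>w. (\<forall>i. w i \<in> {-1, 1}) \<and>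
      (\<Sum>i\<in>F. (H2_norm (v i))\<^sup>2) * s \<le> (H2_norm (\<lambda>z. \<Sum>i\<in>F. of_real (w i) * v i z))\<^sup>2 * s"
    if s: "s = 1 \<or> s = - 1" for s :: real
    using assms
  proof (induction F)
    case empty
    show ?case by (rule exI[of _ "\<lambda>_. 1"]) simp
  next
    case (insert a F)
    obtain w where w: "\<forall>i. w i \<in> {-1, 1}"
      and le: "(\<Sum>i\<in>F. (H2_norm (v i))\<^sup>2) * s \<le> (H2_norm (\<lambda>z. \<Sum>i\<in>F. of_real (w i) * v i z))\<^sup>2 * s"
      using insert by auto
    let ?S = "\<lambda>z. \<Sum>i\<in>F. of_real (w i) * v i z"
    have S: "?S \<in> H2" using insert.prems by (intro H2_sum) auto
    have va: "v a \<in> H2" using insert.prems by simp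
    define t :: real where "t = (if Re (H2_inner (v a) ?S) * s \<ge> 0 then 1 else - 1)"
    define w' where "w' = w(a := t)"
    have t2: "t\<^sup>2 = 1" by (simp add: t_def)
    have eq: "(\<lambda>z. \<Sum>i\<in>insert a F. of_real (w' i) * v i z) = (\<lambda>z. of_real t * v a z + ?S z)"
    proof
      fix z
      have "(\<Sum>i\<in>F. of_real (w' i) * v i z) = ?S z"
        using insert.hyps by (intro sum.cong) (auto simp: w'_def)
      then show "(\<Sum>i\<in>insert a F. of_real (w' i) * v i z) = of_real t * v a z + ?S z"
        using insert.hyps by (simp add: w'_def)
    qed
    have nt: "(H2_norm (\<lambda>z. of_real t * v a z))\<^sup>2 = (H2_norm (v a))\<^sup>2"
      using H2_norm_cmult[OF va, of "of_real t"] t2 by (simp add: power_mult_distrib)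
    have "(H2_norm (\<lambda>z. of_real t * v a z + ?S z))\<^sup>2 =
        (H2_norm (v a))\<^sup>2 + (H2_norm ?S)\<^sup>2 + 2 * (t * Re (H2_inner (v a) ?S))"
      unfolding H2_norm_add_sq[OF H2_cmult[OF va] S] nt H2_inner_cmult_left[OF va S] by simp
    then have "(H2_norm (\<lambda>z. of_real t * v a z + ?S z))\<^sup>2 * s =
        (H2_norm (v a))\<^sup>2 * s + (H2_norm ?S)\<^sup>2 * s + 2 * (t * (Re (H2_inner (v a) ?S) * s))"
      by (simp add: algebra_simps)
    moreover have "0 \<le> t * (Re (H2_inner (v a) ?S) * s)" by (auto simp: t_def)
    ultimately have "(\<Sum>i\<in>insert a F. (H2_norm (v i))\<^sup>2) * s \<le>
        (H2_norm (\<lambda>z. \<Sum>i\<in>insert a F. of_real (w' i) * v i z))\<^sup>2 * s"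
      unfolding eq using le insert.hyps by (simp add: distrib_right)
    moreover have "\<forall>i. w' i \<in> {-1, 1}" using w by (simp add: w'_def t_def)
    ultimately show ?case by blast
  qed
  from this[of 1] this[of "-1"] show
    "\<exists>w. (\<forall>i. w i \<in> {-1, 1}) \<and> (\<Sum>i\<in>F. (H2_norm (v i))\<^sup>2) \<le> (H2_norm (\<lambda>z. \<Sum>i\<in>F. of_real (w i) * v i
        z))\<^sup>2"
    "\<exists>w. (\<forall>i. w i \<in> {-1, 1}) \<and> (H2_norm (\<lambda>z. \<Sum>i\<in>F. of_real (w i) * v i z))\<^sup>2
        \<le> (\<Sum>i\<in>F. (H2_norm (v i))\<^sup>2)"
    by simp_all
qed

lemma H2_normalized_kernel_eq:
  "H2_normalized_kernel w = (\<lambda>z. of_real (sqrt (1 - (norm w)\<^sup>2)) * H2_kernel w z)"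
  by (simp add: H2_normalized_kernel_def[abs_def] H2_kernel_def)

lemma H2_normalized_kernel_in_H2: "norm w < 1 \<Longrightarrow> H2_normalized_kernel w \<in> H2"
  unfolding H2_normalized_kernel_eq by (intro H2_cmult H2_kernel_in_H2)

lemma H2_inner_normalized_kernel:
  "f \<in> H2 \<Longrightarrow> norm w < 1 \<Longrightarrow> H2_inner f (H2_normalized_kernel w) = of_real (sqrt (1
      - (norm w)\<^sup>2)) * f w"
  unfolding H2_normalized_kernel_eq
      by (simp add: H2_inner_cmult_right H2_kernel_in_H2 H2_reproducing)

lemma H2_norm_normalized_kernel: "norm w < 1 \<Longrightarrow> H2_norm (H2_normalized_kernel w) = 1"
proof -
  assume w: "norm w < 1"
  have "(H2_norm (H2_normalized_kernel w))\<^sup>2 = 1\<^sup>2"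
    using norm_sq_less_1[OF w]
        unfolding H2_normalized_kernel_eq H2_norm_cmult[OF H2_kernel_in_H2[OF w]]
    by (simp add: power_mult_distrib H2_kernel_norm_sq[OF w])
  then show ?thesis using H2_norm_nonneg[OF H2_normalized_kernel_in_H2[OF w]]
    by (subst (asm) power2_eq_iff_nonneg) auto
qed

text \<open>The adjoint of multiplication by \<open>\<phi>\<close> maps the kernel at \<open>w\<close> to \<open>cnj (\<phi> w)\<close> times that
  kernel.\<close>

lemma adjoint_multiplier_contraction:
  assumes \<phi>: "\<phi> holomorphic_on unit_disc" "\<And>z. norm z < 1 \<Longrightarrow> norm (\<phi> z) \<le> 1"
    and lam: "\<And>n. n \<in> F \<Longrightarrow> norm (lam n) < 1"
  shows "H2_norm (\<lambda>z. \<Sum>n\<in>F. cnj (\<phi> (lam n)) * b n * H2_normalized_kernel (lam n) z)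
    \<le> H2_norm (\<lambda>z. \<Sum>n\<in>F. b n * H2_normalized_kernel (lam n) z)"
proof -
  let ?h = "\<lambda>n. H2_normalized_kernel (lam n)"
  let ?x = "lincomb F b ?h" and ?y = "\<lambda>z. \<Sum>n\<in>F. cnj (\<phi> (lam n)) * b n * ?h n z"
  have h: "?h n \<in> H2" if "n \<in> F" for n using H2_normalized_kernel_in_H2[OF lam[OF that]] .
  have x: "?x \<in> H2" and y: "?y \<in> H2" using h by (intro H2_sum; simp)+
  have \<phi>y: "(\<lambda>z. \<phi> z * ?y z) \<in> H2" "H2_norm (\<lambda>z. \<phi> z * ?y z) \<le> 1 * H2_norm ?y"
    by (rule H2_mult[OF \<phi> y]; simp)+
  have "H2_inner ?y ?y = (\<Sum>n\<in>F. cnj (cnj (\<phi> (lam n)) * b n) * H2_inner ?y (?h n))"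
    by (rule H2_inner_sum_right[OF h y])
  also have "\<dots> = (\<Sum>n\<in>F. cnj (b n) * H2_inner (\<lambda>z. \<phi> z * ?y z) (?h n))"
    using lam by (intro sum.cong refl) (simp add: H2_inner_normalized_kernel y \<phi>y(1))
  also have "\<dots> = H2_inner (\<lambda>z. \<phi> z * ?y z) ?x" by (rule H2_inner_sum_right[OF h \<phi>y(1), symmetric])
  finally have "norm (H2_inner ?y ?y) = norm (H2_inner (\<lambda>z. \<phi> z * ?y z) ?x)" by (rule arg_cong)
  then have "(H2_norm ?y)\<^sup>2 \<le> H2_norm (\<lambda>z. \<phi> z * ?y z) * H2_norm ?x"
    unfolding H2_inner_self[OF y] norm_of_real using H2_Cauchy_Schwarz[OF \<phi>y(1) x] by simp
  also have "\<dots> \<le> H2_norm ?y * H2_norm ?x" using \<phi>y(2) x by (intro mult_right_mono) auto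
  finally show ?thesis using H2_norm_nonneg[OF y] H2_norm_nonneg[OF x]
    by (cases "H2_norm ?y = 0") (simp_all add: power2_eq_square)
qed

text \<open>If every choice of signs can be interpolated by a multiplier of norm at most \<open>1 / r\<close>, the
  kernels behave like an orthonormal sequence up to the factor \<open>r\<close>: compare a linear combination
  with the one whose signs are chosen favourably.\<close>

lemma products_imp_bounds:
  assumes lam: "\<And>n. n \<ge> N \<Longrightarrow> norm (lam n) < 1" and l: "0 < l" "l < d" "d \<le> 1"
    and prods: "\<And>F j. finite F \<Longrightarrow> F \<subseteq> {N..} \<Longrightarrow> j \<in> F \<Longrightarrow> d \<le> (\<Prod>k\<in>F - {j}. rho lam j k)"
  defines "r \<equiv> l * hyp_diff l d"
  shows "lower_bd (\<lambda>n. H2_normalized_kernel (lam n)) N (r\<^sup>2)"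
    and "upper_bd (\<lambda>n. H2_normalized_kernel (lam n)) N (1 / r\<^sup>2)"
proof -
  let ?h = "\<lambda>n. H2_normalized_kernel (lam n)"
  have r: "0 < r" using l hyp_diff_pos[OF l] by (simp add: r_def)
  \<comment> \<open>Earl's theorem interpolates r times the signs by a multiplier bounded by 1; its
    contractive adjoint multiplies the n-th kernel by r w n.\<close>
  have contr: "r\<^sup>2 * (H2_norm (\<lambda>z. \<Sum>n\<in>F. of_real (w n) * (b n * ?h n z)))\<^sup>2
      \<le> (H2_norm (lincomb F b ?h))\<^sup>2"
    if F: "finite F" "F \<subseteq> {N..}" and w: "\<forall>i. w i \<in> {-1, 1::real}" for F w and b :: "nat \<Rightarrow> complex"
  proof -
    have lF: "norm (lam n) < 1" if "n \<in> F" for n using lam that F by auto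
    have "norm (complex_of_real (w n)) \<le> 1" for n using w[rule_format, of n] by auto
    then obtain \<phi> where \<phi>: "\<phi> holomorphic_on unit_disc" "\<forall>x\<in>unit_disc. norm (\<phi> x) \<le> 1"
      "\<forall>j\<in>F. \<phi> (lam j) = of_real r * of_real (w j)"
      using earl_interpolation[OF l F(1), of lam "\<lambda>n. of_real (w n)"] lF prods[OF F]
      unfolding rho_def r_def by blast
    have S: "(\<lambda>z. \<Sum>n\<in>F. of_real (w n) * (b n * ?h n z)) \<in> H2"
      by (rule H2_sum[of F "\<lambda>n z. b n * ?h n z"]) (intro H2_cmult H2_normalized_kernel_in_H2 lF)
    have "H2_norm (\<lambda>z. \<Sum>n\<in>F. cnj (\<phi> (lam n)) * b n * ?h n z) \<le> H2_norm (lincomb F b ?h)"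
      by (rule adjoint_multiplier_contraction) (use \<phi> lF in auto)
    also have "(\<lambda>z. \<Sum>n\<in>F. cnj (\<phi> (lam n)) * b n * ?h n z) = (\<lambda>z. of_real r * (\<Sum>n\<in>F. of_real (w n)
        * (b n * ?h n z)))"
      using \<phi>(3) by (auto simp: sum_distrib_left mult.assoc intro!: ext sum.cong)
    finally have "r * H2_norm (\<lambda>z. \<Sum>n\<in>F. of_real (w n) * (b n * ?h n z)) \<le> H2_norm (lincomb F b ?h)"
      using r by (simp add: H2_norm_cmult[OF S])
    then have "(r * H2_norm (\<lambda>z. \<Sum>n\<in>F. of_real (w n) * (b n * ?h n z)))\<^sup>2
        \<le> (H2_norm (lincomb F b ?h))\<^sup>2"
      using r H2_norm_nonneg[OF S] by (intro power_mono) auto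
    then show ?thesis by (simp add: power_mult_distrib)
  qed
  have nv2: "(\<lambda>z. b n * ?h n z) \<in> H2" if "F \<subseteq> {N..}" "n \<in> F" for F n and b :: "nat \<Rightarrow> complex"
    using that by (intro H2_cmult H2_normalized_kernel_in_H2 lam) auto
  have nv1: "(\<Sum>n\<in>F. (H2_norm (\<lambda>z. b n * ?h n z))\<^sup>2) = sqsum F b"
    if "F \<subseteq> {N..}" for F and b :: "nat \<Rightarrow> complex"
  proof (rule sum.cong[OF refl])
    fix n assume "n \<in> F"
    then have "norm (lam n) < 1" using that by (intro lam) auto
    then show "(H2_norm (\<lambda>z. b n * ?h n z))\<^sup>2 = (norm (b n))\<^sup>2"
      by (simp add: H2_norm_cmult H2_normalized_kernel_in_H2 H2_norm_normalized_kernel)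
  qed
  show "lower_bd ?h N (r\<^sup>2)"
    unfolding lower_bd_def
  proof (intro allI impI)
    fix F and b :: "nat \<Rightarrow> complex" assume F: "finite F" "F \<subseteq> {N..}"
    have nvF: "(\<lambda>z. b n * ?h n z) \<in> H2" if "n \<in> F" for n by (rule nv2[OF F(2) that])
    from F(1) nvF have "\<exists>w. (\<forall>i. w i \<in> {-1, 1}) \<and> (\<Sum>n\<in>F. (H2_norm (\<lambda>z. b n * ?h n z))\<^sup>2)
        \<le> (H2_norm (\<lambda>z. \<Sum>n\<in>F. of_real (w n) * (b n * ?h n z)))\<^sup>2"
      by (rule signs_exist(1))
    then obtain w where w: "\<forall>i. w i \<in> {-1, 1}"
      and le: "sqsum F b \<le> (H2_norm (\<lambda>z. \<Sum>n\<in>F. of_real (w n) * (b n * ?h n z)))\<^sup>2"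
      unfolding nv1[OF F(2)] by (elim exE conjE)
    have "r\<^sup>2 * sqsum F b \<le> r\<^sup>2 * (H2_norm (\<lambda>z. \<Sum>n\<in>F. of_real (w n) * (b n * ?h n z)))\<^sup>2"
      using le by (intro mult_left_mono) auto
    with contr[OF F w, of b] show "r\<^sup>2 * sqsum F b \<le> (H2_norm (lincomb F b ?h))\<^sup>2"
      by linarith
  qed
  show "upper_bd ?h N (1 / r\<^sup>2)"
    unfolding upper_bd_def
  proof (intro allI impI)
    fix F and b :: "nat \<Rightarrow> complex" assume F: "finite F" "F \<subseteq> {N..}"
    have nvF: "(\<lambda>z. b n * ?h n z) \<in> H2" if "n \<in> F" for n by (rule nv2[OF F(2) that])
    from F(1) nvF have "\<exists>w. (\<forall>i. w i \<in> {-1, 1}) \<and> (H2_norm (\<lambda>z. \<Sum>n\<in>F. of_real (w n) * (b n * ?h n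
        z)))\<^sup>2 \<le> (\<Sum>n\<in>F. (H2_norm (\<lambda>z. b n * ?h n z))\<^sup>2)"
      by (rule signs_exist(2))
    then obtain w where w: "\<forall>i. w i \<in> {-1, 1}"
      and le: "(H2_norm (\<lambda>z. \<Sum>n\<in>F. of_real (w n) * (b n * ?h n z)))\<^sup>2 \<le> sqsum F b"
      unfolding nv1[OF F(2)] by (elim exE conjE)
    \<comment> \<open>For the upper bound the contraction is applied to the coefficients w n * b n,
      so that the second change of signs restores \<open>b\<close>.\<close>
    have ww: "complex_of_real (w n) * of_real (w n) = 1" for n using w[rule_format, of n] by auto
    have "(\<lambda>z. \<Sum>n\<in>F. of_real (w n) * (of_real (w n) * b n * ?h n z)) = lincomb F b ?h"
      by (simp add: mult.assoc[symmetric] ww)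
    moreover have "r\<^sup>2 * (H2_norm (\<lambda>z. \<Sum>n\<in>F. of_real (w n) * (of_real (w n) * b n * ?h n z)))\<^sup>2 \<le>
        (H2_norm (\<lambda>z. \<Sum>n\<in>F. of_real (w n) * b n * ?h n z))\<^sup>2"
      by (rule contr[OF F w])
    ultimately have "r\<^sup>2 * (H2_norm (lincomb F b ?h))\<^sup>2 \<le> sqsum F b"
      using le by (simp add: mult.assoc)
    then show "(H2_norm (lincomb F b ?h))\<^sup>2 \<le> 1 / r\<^sup>2 * sqsum F b"
      using r by (simp add: pos_le_divide_eq mult.commute)
  qed
qed

lemma hyp_diff_near_1:
  assumes "0 < e"
  obtains l d where "0 < l" "l < d" "d < (1::real)" "(l * hyp_diff l d)\<^sup>2 \<ge> 1
      - e" "1 / (l * hyp_diff l d)\<^sup>2 \<le> 1 + e"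
proof -
  \<comment> \<open>A square of size at least \<open>q\<close> meets both requirements: q >= 1 - e
    and 1 / q <= 1 + e.\<close>
  define q where "q = max (1 / 2) (max (1 - e) (1 / (1 + e)))"
  have q: "1 / 2 \<le> q" "1 - e \<le> q" "1 / (1 + e) \<le> q" "q < 1" using assms by (auto simp: q_def)
  \<comment> \<open>\<open>l\<close> must be fixed before \<open>d\<close>, because
    \<open>hyp_diff l d\<close> tends to 1 only as d tends to 1 with l held. Both factors exceed the
    fourth root of q, so the square of their product exceeds q.\<close>
  obtain l where l: "sqrt (sqrt q) < l" "l < 1"
    using dense[of "sqrt (sqrt q)" 1] q by auto
  have s0: "0 < sqrt (sqrt q)" "0 < sqrt q" using q by auto
  have "((\<lambda>d. hyp_diff l d) \<longlongrightarrow> hyp_diff l 1) (at_left 1)"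
    unfolding hyp_diff_def using l by (intro tendsto_intros) auto
  moreover have "hyp_diff l 1 = 1" using l by (simp add: hyp_diff_def)
  ultimately have "\<forall>\<^sub>F d in at_left 1. sqrt (sqrt q) < hyp_diff l d"
    using order_tendstoD(1)[of "hyp_diff l" 1 "at_left 1" "sqrt (sqrt q)"] q by simp
  moreover have "\<forall>\<^sub>F d in at_left 1. d \<in> {l<..<1}"
    using l by (intro eventually_at_leftI[of l]) auto
  ultimately have "\<forall>\<^sub>F d in at_left (1::real). sqrt (sqrt q) < hyp_diff l d \<and> l < d \<and> d < 1"
    by eventually_elim auto
  from eventually_happens'[OF _ this] obtain d where d: "sqrt (sqrt q) < hyp_diff l d" "l < d" "d
      < 1" by auto
  have "sqrt (sqrt q) * sqrt (sqrt q) \<le> l * hyp_diff l d"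
    using l d s0 by (intro mult_mono) linarith+
  then have "(sqrt q)\<^sup>2 \<le> (l * hyp_diff l d)\<^sup>2" using s0 q by (intro power_mono) auto
  then have qr: "q \<le> (l * hyp_diff l d)\<^sup>2" using q by simp
  have "1 / (l * hyp_diff l d)\<^sup>2 \<le> 1 / (1 / (1 + e))"
    using qr q assms by (intro divide_left_mono mult_pos_pos) (auto intro: order.strict_trans2[of
        0 q])
  then show ?thesis using that[of l d] qr q l d s0 by simp
qed

lemma thin_imp_bounds:
  assumes int: "interpolating lam" and thin: "thin lam" and e: "e > 0"
  shows "\<exists>N\<ge>1. lower_bd (\<lambda>n. H2_normalized_kernel (lam n)) N (1 - e) \<and>
                upper_bd (\<lambda>n. H2_normalized_kernel (lam n)) N (1 + e)"
proof -
  obtain l d where ld: "0 < l" "l < d" "d < (1::real)"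
    and r: "(l * hyp_diff l d)\<^sup>2 \<ge> 1 - e" "1 / (l * hyp_diff l d)\<^sup>2 \<le> 1 + e"
    using hyp_diff_near_1[OF e] by blast
  obtain N where N: "N \<ge> 1"
    and prods: "\<forall>F. finite F \<longrightarrow> F \<subseteq> {N..} \<longrightarrow> (\<forall>j\<in>F. d \<le> (\<Prod>k\<in>F - {j}. rho lam j k))"
    using thin_imp_products[OF int thin ld(3)] by (elim exE conjE)
  have lN: "norm (lam n) < 1" if "n \<ge> N" for n using interpolating_disc[OF int] that N by auto
  note b = products_imp_bounds[OF lN ld(1,2) less_imp_le[OF ld(3)] prods[rule_format]]
  show ?thesis
    using N lower_bd_mono[OF b(1) order_refl r(1)] upper_bd_mono[OF b(2) order_refl r(2)] by blast
qed

section \<open>Extending Riesz bounds by one vector\<close>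

lemma upper_bd_shift: "upper_bd (\<lambda>n. x (n + q)) N C \<longleftrightarrow> upper_bd x (N + q) C"
  and lower_bd_shift: "lower_bd (\<lambda>n. x (n + q)) N C \<longleftrightarrow> lower_bd x (N + q) C"
proof -
  have inj: "inj_on (\<lambda>n. n + q) F" for F :: "nat set" by (simp add: inj_on_def)
  \<comment> \<open>The reindexing is proved for an arbitrary relation \<open>P\<close> between
    square sum and norm, to serve both kinds of bounds.\<close>
  have *: "(\<forall>F b. finite F \<longrightarrow> F \<subseteq> {N..} \<longrightarrow> P (sqsum F b) (H2_norm (\<lambda>z. \<Sum>n\<in>F. b n * x (n + q) z))) \<longleftrightarrow>
        (\<forall>F b. finite F \<longrightarrow> F \<subseteq> {N + q..} \<longrightarrow> P (sqsum F b) (H2_norm (lincomb F b x)))"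
    (is "?L \<longleftrightarrow> ?R") for P
  proof
    assume L: ?L
    show ?R
    proof (intro allI impI)
      fix F and b :: "nat \<Rightarrow> complex" assume F: "finite F" "F \<subseteq> {N + q..}"
      define F' where "F' = (\<lambda>n. n - q) ` F"
      have im: "(\<lambda>n. n + q) ` F' = F"
        unfolding F'_def image_image using F(2) by (force simp: subset_iff image_iff)
      have "finite F'" "F' \<subseteq> {N..}" using F by (auto simp: F'_def)
      from L[rule_format, OF this, of "\<lambda>n. b (n + q)"]
      show "P (sqsum F b) (H2_norm (lincomb F b x))"
        by (simp add: im[symmetric] sum.reindex[OF inj])
    qed
  next
    assume R: ?R
    show ?L
    proof (intro allI impI)
      fix F and b :: "nat \<Rightarrow> complex" assume F: "finite F" "F \<subseteq> {N..}"
      have "finite ((\<lambda>n. n + q) ` F)" "(\<lambda>n. n + q) ` F \<subseteq> {N + q..}" using F by auto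
      from R[rule_format, OF this, of "\<lambda>n. b (n - q)"]
      show "P (sqsum F b) (H2_norm (\<lambda>z. \<Sum>n\<in>F. b n * x (n + q) z))"
        by (simp add: sum.reindex[OF inj])
    qed
  qed
  show "upper_bd (\<lambda>n. x (n + q)) N C \<longleftrightarrow> upper_bd x (N + q) C"
    unfolding upper_bd_def by (rule *[of "\<lambda>s h. h\<^sup>2 \<le> C * s"])
  show "lower_bd (\<lambda>n. x (n + q)) N C \<longleftrightarrow> lower_bd x (N + q) C"
    unfolding lower_bd_def by (rule *[of "\<lambda>s h. C * s \<le> h\<^sup>2"])
qed

text \<open>Finitely many additional vectors merely enlarge an upper constant, by (a + b)^2 <= 2 a^2
  + 2 b^2 at each step. A lower bound can be lost in this way, which is the source of the
  alternative with p >= 2.\<close>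

lemma upper_bd_extend:
  assumes "upper_bd x N C" "1 \<le> N" and x: "\<And>n. n \<ge> 1 \<Longrightarrow> x n \<in> H2"
  shows "\<exists>C'. upper_bd x 1 C'"
  using assms(2,1)
proof (induction N arbitrary: C rule: dec_induct)
  case base
  then show ?case by blast
next
  case (step N)
  define C' where "C' = 2 * max C ((H2_norm (x N))\<^sup>2)"
  have "upper_bd x N C'"
    unfolding upper_bd_def
  proof (intro allI impI)
    fix F and b :: "nat \<Rightarrow> complex" assume F: "finite F" "F \<subseteq> {N..}"
    define F' where "F' = F - {N}"
    define \<beta> where "\<beta> = (if N \<in> F then b N else 0)"
    have F': "finite F'" "F' \<subseteq> {Suc N..}" using F
        by (auto simp: F'_def Suc_le_eq le_neq_implies_less)
    let ?y = "lincomb F' b x"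
    have xN: "x N \<in> H2" using x step by simp
    have "x n \<in> H2" if "n \<in> F'" for n using x F'(2) that by force
    then have y: "?y \<in> H2" by (rule H2_sum)
    have eq: "(lincomb F b x) = (\<lambda>z. \<beta> * x N z + ?y z)"
      using F(1) by (auto simp: F'_def \<beta>_def sum.remove)
    have S: "sqsum F b = (norm \<beta>)\<^sup>2 + sqsum F' b"
      using F(1) by (auto simp: F'_def \<beta>_def sum.remove)
    have "H2_norm (\<lambda>z. \<beta> * x N z + ?y z) \<le> norm \<beta> * H2_norm (x N) + H2_norm ?y"
      using H2_norm_triangle[OF H2_cmult[OF xN] y] by (simp add: H2_norm_cmult[OF xN])
    then have "(H2_norm (\<lambda>z. \<beta> * x N z + ?y z))\<^sup>2 \<le> (norm \<beta> * H2_norm (x N) + H2_norm ?y)\<^sup>2"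
      by (rule power_mono) (simp add: H2_add H2_cmult xN y)
    also have "\<dots> \<le> 2 * (norm \<beta> * H2_norm (x N))\<^sup>2 + 2 * (H2_norm ?y)\<^sup>2"
      using sum_squares_bound[of "norm \<beta> * H2_norm (x N)" "H2_norm ?y"] by (simp add: power2_sum)
    also have "\<dots> \<le> 2 * ((norm \<beta>)\<^sup>2 * (H2_norm (x N))\<^sup>2) + 2 * (C * sqsum F' b)"
      using step.prems[unfolded upper_bd_def, rule_format, OF F', of b]
          by (simp add: power_mult_distrib)
    also have "\<dots> \<le> 2 * ((norm \<beta>)\<^sup>2 * max C ((H2_norm (x N))\<^sup>2))
        + 2 * (max C ((H2_norm (x N))\<^sup>2) * sqsum F' b)"
      by (intro add_mono mult_left_mono mult_right_mono sum_nonneg) auto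
    also have "\<dots> = C' * sqsum F b" unfolding S C'_def by (simp add: algebra_simps)
    finally show "(H2_norm (lincomb F b x))\<^sup>2 \<le> C' * sqsum F b" unfolding eq .
  qed
  then show ?case by (rule step.IH)
qed

text \<open>A functional that kills the later vectors but not \<open>x q\<close> recovers the coefficient of \<open>x q\<close>.\<close>

lemma lower_bd_extend:
  assumes low: "lower_bd x (Suc q) c" and c: "0 < c" and x: "\<And>n. n \<ge> q \<Longrightarrow> x n \<in> H2"
    and f: "f \<in> H2" "\<And>n. n \<ge> Suc q \<Longrightarrow> H2_inner f (x n) = 0" "H2_inner f (x q) \<noteq> 0"
  shows "\<exists>c'>0. lower_bd x q c'"
proof -
  \<comment> \<open>With Y the norm of the combination, \<open>A\<close> bounds the coefficient at q
    by A Y, and \<open>B\<close> bounds the remaining part by B Y; the lower bound for the later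
    vectors turns the latter into B^2 / c * Y^2. \<open>D\<close> is the sum of both
    contributions.\<close>
  define A where "A = H2_norm f / norm (H2_inner f (x q))"
  define B where "B = 1 + A * H2_norm (x q)"
  define D where "D = A\<^sup>2 + B\<^sup>2 / c"
  have xq: "x q \<in> H2" using x by simp
  have A: "0 \<le> A" using f(1) by (simp add: A_def)
  have B: "1 \<le> B" using A xq by (simp add: B_def)
  have D: "0 < D" using B c unfolding D_def by (intro add_nonneg_pos divide_pos_pos) auto
  have "lower_bd x q (1 / D)"
    unfolding lower_bd_def
  proof (intro allI impI)
    fix F and b :: "nat \<Rightarrow> complex" assume F: "finite F" "F \<subseteq> {q..}"
    define F' where "F' = F - {q}"
    define \<beta> where "\<beta> = (if q \<in> F then b q else 0)"
    have F': "finite F'" "F' \<subseteq> {Suc q..}" using F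
        by (auto simp: F'_def Suc_le_eq le_neq_implies_less)
    let ?y = "lincomb F b x" and ?y' = "lincomb F' b x"
    have xF: "x n \<in> H2" if "n \<in> F" for n using x F(2) that by auto
    have y: "?y \<in> H2" using xF by (rule H2_sum)
    have y': "?y' \<in> H2" by (rule H2_sum) (use xF in \<open>auto simp: F'_def\<close>)
    have eq: "?y = (\<lambda>z. \<beta> * x q z + ?y' z)"
      using F(1) by (auto simp: F'_def \<beta>_def sum.remove)
    have S: "sqsum F b = (norm \<beta>)\<^sup>2 + sqsum F' b"
      using F(1) by (auto simp: F'_def \<beta>_def sum.remove)
    define Y where "Y = H2_norm ?y"
    have Y: "0 \<le> Y" using y by (simp add: Y_def)
    have "H2_inner f ?y' = (\<Sum>n\<in>F'. cnj (b n) * H2_inner f (x n))"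
      by (rule H2_inner_sum_right) (use xF f in \<open>auto simp: F'_def\<close>)
    also have "\<dots> = 0" using f(2) F'(2) by (intro sum.neutral) auto
    finally have "H2_inner f ?y = cnj \<beta> * H2_inner f (x q)"
      unfolding eq using H2_inner_add_right[OF H2_cmult[OF xq] y' f(1)] H2_inner_cmult_right[OF xq
          f(1)] by simp
    then have "norm \<beta> * norm (H2_inner f (x q)) \<le> H2_norm f * Y"
      using H2_Cauchy_Schwarz[OF f(1) y] by (simp add: norm_mult Y_def)
    then have \<beta>: "norm \<beta> \<le> A * Y" using f(3) by (simp add: A_def pos_le_divide_eq)
    have "H2_norm ?y' \<le> Y + norm \<beta> * H2_norm (x q)"
    proof -
      have "?y' = (\<lambda>z. ?y z + (- \<beta>) * x q z)" by (rule ext) (use fun_cong[OF eq] in simp)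
      then show ?thesis using H2_norm_triangle[OF y H2_cmult[OF xq], of "- \<beta>"] H2_norm_cmult[OF
          xq, of "- \<beta>"] by (simp add: Y_def)
    qed
    also have "\<dots> \<le> Y + A * Y * H2_norm (x q)" using \<beta> xq
        by (intro add_left_mono mult_right_mono) auto
    also have "\<dots> = B * Y" by (simp add: B_def algebra_simps)
    finally have "(H2_norm ?y')\<^sup>2 \<le> (B * Y)\<^sup>2" using y' by (intro power_mono) auto
    then have "c * sqsum F' b \<le> B\<^sup>2 * Y\<^sup>2"
      using low[unfolded lower_bd_def, rule_format, OF F', of b] by (simp add: power_mult_distrib)
    then have "sqsum F' b \<le> B\<^sup>2 / c * Y\<^sup>2" using c by (simp add: pos_le_divide_eq mult.commute)
    moreover have "(norm \<beta>)\<^sup>2 \<le> A\<^sup>2 * Y\<^sup>2" using power_mono[OF \<beta>, of 2]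
        by (simp add: power_mult_distrib)
    ultimately have "sqsum F b \<le> D * Y\<^sup>2" unfolding S D_def by (simp add: distrib_right)
    then show "1 / D * sqsum F b \<le> (H2_norm ?y)\<^sup>2"
      using D by (simp add: pos_divide_le_eq Y_def mult.commute)
  qed
  then show ?thesis using D by (intro exI[of _ "1 / D"]) simp
qed

text \<open>The y M are the orthogonal projections of f to the spans of the first M vectors. A weak
  limit g has the same inner products with all x n as f, so totality gives norm 0 for f - g. Since
  the squared norm of f - y M is that of f minus the real part of the inner product of y M with f,
  weak convergence here entails norm convergence.\<close>

lemma total_imp_approximable:
  assumes H: "closed_subspace H" and x: "\<And>n. n \<ge> N \<Longrightarrow> x n \<in> H"
    and low: "lower_bd x N c" and c: "0 < c"
    and total: "\<And>f. f \<in> H \<Longrightarrow> (\<And>n. n \<ge> N \<Longrightarrow> H2_inner f (x n) = 0) \<Longrightarrow> H2_norm f = 0"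
    and f: "f \<in> H" and e: "0 < e"
  shows "\<exists>M b. H2_norm (\<lambda>z. f z - (\<Sum>n\<in>{N..<N+M}. b n * x n z)) < e"
proof -
  note f2 = closed_subspace_H2[OF H f]
  have xH: "x n \<in> H2" if "n \<ge> N" for n using closed_subspace_H2[OF H x[OF that]] .
  have "\<exists>b. \<forall>m\<in>{N..<N+M}. H2_inner (\<lambda>z. \<Sum>n\<in>{N..<N+M}. b n * x n z) (x m) = H2_inner f (x m)" for M
    by (rule gram_solve[OF low c xH]) auto
  then obtain b where b: "\<And>M m. m \<in> {N..<N+M} \<Longrightarrow>
      H2_inner (\<lambda>z. \<Sum>n\<in>{N..<N+M}. b M n * x n z) (x m) = H2_inner f (x m)" by metis
  define y where "y = (\<lambda>M z. \<Sum>n\<in>{N..<N+M}. b M n * x n z)"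
  have yH: "y M \<in> H" for M unfolding y_def using x by (intro closed_subspace_sum[OF H]) auto
  note y2 = closed_subspace_H2[OF H yH]
  have ym: "H2_inner (y M) (x m) = H2_inner f (x m)" if "m \<in> {N..<N+M}" for M m
    using b[OF that] by (simp add: y_def)
  have fy: "H2_inner f (y M) = of_real ((H2_norm (y M))\<^sup>2)" for M
  proof -
    have xM: "x n \<in> H2" if "n \<in> {N..<N+M}" for n using xH that by auto
    have "H2_inner h (y M) = (\<Sum>n\<in>{N..<N+M}. cnj (b M n) * H2_inner h (x n))" if "h \<in> H2" for h
      unfolding y_def by (rule H2_inner_sum_right[OF xM that])
    from this[OF f2] this[OF y2[of M]] ym[of _ M] have "H2_inner f (y M) = H2_inner (y M) (y M)"
        by simp
    then show ?thesis using H2_inner_self[OF y2] by simp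
  qed
  have ny: "H2_norm (y M) \<le> H2_norm f" for M
  proof -
    have "H2_norm (y M) * H2_norm (y M) \<le> H2_norm f * H2_norm (y M)"
      using H2_Cauchy_Schwarz[OF f2 y2[of M]] unfolding fy norm_of_real
          by (simp add: power2_eq_square)
    then show ?thesis using H2_norm_nonneg[OF y2[of M]] H2_norm_nonneg[OF f2]
        by (cases "H2_norm (y M) = 0") auto
  qed
  obtain s g where s: "strict_mono (s :: nat \<Rightarrow> nat)" and g: "g \<in> H2"
    and lim: "\<And>h. h \<in> H2 \<Longrightarrow> (\<lambda>m. H2_inner (y (s m)) h) \<longlonglongrightarrow> H2_inner g h"
    using H2_weak_compact[of y "H2_norm f", OF y2 ny] by blast
  have gH: "g \<in> H" by (rule closed_subspace_weak_limit[OF H _ g lim]) (rule yH)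
  have gx: "H2_inner g (x n) = H2_inner f (x n)" if n: "n \<ge> N" for n
  proof (rule LIMSEQ_unique[OF lim[OF xH[OF n]]])
    have "H2_inner (y (s m)) (x n) = H2_inner f (x n)" if "m \<ge> Suc n" for m
      using seq_suble[OF s, of m] n that by (intro ym) auto
    then have "\<forall>\<^sub>F m in sequentially. H2_inner (y (s m)) (x n) = H2_inner f (x n)"
      by (rule eventually_sequentiallyI)
    then show "(\<lambda>m. H2_inner (y (s m)) (x n)) \<longlonglongrightarrow> H2_inner f (x n)" by (rule tendsto_eventually)
  qed
  have "(\<lambda>z. f z + (- 1) * g z) \<in> H" by (rule closed_subspace_add_cmult[OF H f gH])
  then have dH: "(\<lambda>z. f z - g z) \<in> H" by simp
  have d0: "H2_norm (\<lambda>z. f z - g z) = 0"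
    by (rule total[OF dH]) (use gx f2 g xH in \<open>simp add: H2_inner_diff_left\<close>)
  have "norm (H2_inner (\<lambda>z. f z - g z) f) \<le> 0"
    using H2_Cauchy_Schwarz[OF closed_subspace_H2[OF H dH] f2] d0 by simp
  then have gf: "H2_inner g f = of_real ((H2_norm f)\<^sup>2)"
    using H2_inner_diff_left[OF f2 g f2] H2_inner_self[OF f2] by simp
  have "(\<lambda>m. (H2_norm f)\<^sup>2 - Re (H2_inner (y (s m)) f)) \<longlonglongrightarrow> (H2_norm f)\<^sup>2 - Re (H2_inner g f)"
    by (intro tendsto_intros lim f2)
  then have "(\<lambda>m. (H2_norm f)\<^sup>2 - Re (H2_inner (y (s m)) f)) \<longlonglongrightarrow> 0" by (simp add: gf)
  moreover have "(H2_norm (\<lambda>z. f z - y (s m) z))\<^sup>2 = (H2_norm f)\<^sup>2 - Re (H2_inner (y (s m)) f)"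
      for m
  proof -
    have "Re (H2_inner (y (s m)) f) = Re (H2_inner f (y (s m)))"
      using H2_inner_commute[OF f2 y2[of "s m"]] by simp
    then show ?thesis using H2_norm_diff_sq[OF f2 y2[of "s m"]] fy[of "s m"] by simp
  qed
  ultimately have "(\<lambda>m. (H2_norm (\<lambda>z. f z - y (s m) z))\<^sup>2) \<longlonglongrightarrow> 0" by simp
  then have "\<forall>\<^sub>F m in sequentially. (H2_norm (\<lambda>z. f z - y (s m) z))\<^sup>2 < e\<^sup>2"
    by (rule order_tendstoD) (use e in simp)
  then obtain m where "(H2_norm (\<lambda>z. f z - y (s m) z))\<^sup>2 < e\<^sup>2"
    using eventually_happens'[OF sequentially_bot] by blast
  then have "H2_norm (\<lambda>z. f z - y (s m) z) < e" by (rule power2_less_imp_less) (use e in simp)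
  then show ?thesis unfolding y_def by blast
qed

section \<open>Model spaces\<close>

text \<open>Isolates what is used of an inner function, so that the symbol 0, whose model space is
  the whole of \<open>H2\<close>, is covered as well. The orthogonality of the kernels is where the
  isometry is encoded.\<close>

locale model_symbol =
  fixes \<Theta> :: "complex \<Rightarrow> complex"
  assumes hol: "\<Theta> holomorphic_on unit_disc"
    and le_1: "\<And>z. norm z < 1 \<Longrightarrow> norm (\<Theta> z) \<le> 1"
    and kernel_orth: "\<And>w g. norm w < 1 \<Longrightarrow> g \<in> H2 \<Longrightarrow> H2_inner (model_kernel \<Theta> w) (\<lambda>z. \<Theta> z * g z) = 0"

lemma model_kernel_eq:
  "model_kernel \<Theta> w = (\<lambda>z. H2_kernel w z - cnj (\<Theta> w) * (\<Theta> z * H2_kernel w z))"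
  by (simp add: model_kernel_def[abs_def] H2_kernel_def diff_divide_distrib mult.assoc)

lemma model_symbol_0: "model_symbol (\<lambda>_. 0)"
  by unfold_locales auto

lemma model_space_0: "model_space (\<lambda>_. 0) = H2"
  by (simp add: model_space_def)

lemma model_kernel_0: "model_kernel (\<lambda>_. 0) = H2_kernel"
  by (intro ext) (simp add: model_kernel_def H2_kernel_def)

lemma model_normalized_kernel_0: "model_normalized_kernel (\<lambda>_. 0) = H2_normalized_kernel"
  by (intro ext) (simp add: model_normalized_kernel_def model_kernel_def H2_normalized_kernel_def)

text \<open>Orthogonality: the kernel is k - cnj (\<Theta> w) \<Theta> k with k the Hardy space
  kernel. Against \<Theta> g the first part gives the conjugate of \<Theta> w * g w by reproduction,
  and the second gives the same by the isometry.\<close>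

lemma model_symbol_inner_function:
  assumes \<Theta>: "inner_function \<Theta>"
  shows "model_symbol \<Theta>"
proof
  show "\<Theta> holomorphic_on unit_disc" by (rule inner_function_holomorphic[OF \<Theta>])
  show "norm (\<Theta> z) \<le> 1" if "norm z < 1" for z by (rule inner_function_le_1[OF \<Theta> that])
  fix w :: complex and g assume w: "norm w < 1" and g: "g \<in> H2"
  let ?k = "H2_kernel w"
  have k: "?k \<in> H2" by (rule H2_kernel_in_H2[OF w])
  have Tk: "(\<lambda>z. \<Theta> z * ?k z) \<in> H2" and Tg: "(\<lambda>z. \<Theta> z * g z) \<in> H2"
    using H2_inner_function_mult[OF \<Theta>] k g by auto
  have "H2_inner (model_kernel \<Theta> w) (\<lambda>z. \<Theta> z * g z) =
      H2_inner ?k (\<lambda>z. \<Theta> z * g z) - cnj (\<Theta> w) * H2_inner (\<lambda>z. \<Theta> z * ?k z) (\<lambda>z. \<Theta> z * g z)"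
    unfolding model_kernel_eq H2_inner_diff_left[OF k H2_cmult[OF Tk] Tg] H2_inner_cmult_left[OF
        Tk Tg] ..
  also have "\<dots> = cnj (\<Theta> w * g w) - cnj (\<Theta> w) * cnj (g w)"
    unfolding inner_function_inner[OF \<Theta> k g] H2_inner_commute[OF Tg k] H2_inner_commute[OF g k]
      H2_reproducing[OF Tg w] H2_reproducing[OF g w] ..
  finally show "H2_inner (model_kernel \<Theta> w) (\<lambda>z. \<Theta> z * g z) = 0" by simp
qed

context model_symbol
begin

lemma mult_H2: "g \<in> H2 \<Longrightarrow> (\<lambda>z. \<Theta> z * g z) \<in> H2"
  by (rule H2_mult(1)[OF hol le_1])

lemma model_kernel_H2: "norm w < 1 \<Longrightarrow> model_kernel \<Theta> w \<in> H2"
  unfolding model_kernel_eq by (intro H2_diff H2_cmult mult_H2 H2_kernel_in_H2)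

lemma model_kernel_in_model_space: "norm w < 1 \<Longrightarrow> model_kernel \<Theta> w \<in> model_space \<Theta>"
  by (simp add: model_space_def model_kernel_H2 kernel_orth)

lemma model_space_reproducing:
  assumes f: "f \<in> model_space \<Theta>" and w: "norm w < 1"
  shows "H2_inner f (model_kernel \<Theta> w) = f w"
proof -
  have f2: "f \<in> H2" and k: "H2_kernel w \<in> H2" using f H2_kernel_in_H2[OF w]
      by (auto simp: model_space_def)
  have "H2_inner f (\<lambda>z. \<Theta> z * H2_kernel w z) = 0" using f k by (simp add: model_space_def)
  then show ?thesis
    unfolding model_kernel_eq H2_inner_diff_right[OF k H2_cmult[OF mult_H2[OF k]] f2]
      H2_inner_cmult_right[OF mult_H2[OF k] f2] by (simp add: H2_reproducing[OF f2 w])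
qed

lemma closed_subspace_model_space: "closed_subspace (model_space \<Theta>)"
  unfolding closed_subspace_def
proof (intro conjI ballI allI impI)
  show "model_space \<Theta> \<subseteq> H2" "(\<lambda>z. 0) \<in> model_space \<Theta>" by (auto simp: model_space_def)
  show "(\<lambda>z. f z + c * g z) \<in> model_space \<Theta>" if "f \<in> model_space \<Theta>" "g \<in> model_space \<Theta>" for f g c
    using that mult_H2 by (auto simp: model_space_def H2_add H2_cmult H2_inner_add_left
        H2_inner_cmult_left)
next
  fix f g assume *: "(\<forall>m. f m \<in> model_space \<Theta>) \<and> g \<in> H2 \<and> (\<forall>h\<in>H2. (\<lambda>m. H2_inner (f m) h) \<longlonglongrightarrow>
      H2_inner g h)"
  have "H2_inner g (\<lambda>z. \<Theta> z * h z) = 0" if h: "h \<in> H2" for h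
  proof (rule LIMSEQ_unique)
    show "(\<lambda>m. H2_inner (f m) (\<lambda>z. \<Theta> z * h z)) \<longlonglongrightarrow> H2_inner g (\<lambda>z. \<Theta> z * h z)"
      using * mult_H2[OF h] by blast
    have "H2_inner (f m) (\<lambda>z. \<Theta> z * h z) = 0" for m using * h by (simp add: model_space_def)
    then show "(\<lambda>m. H2_inner (f m) (\<lambda>z. \<Theta> z * h z)) \<longlonglongrightarrow> 0" by simp
  qed
  then show "g \<in> model_space \<Theta>" using * by (simp add: model_space_def)
qed

text \<open>With \<open>v = \<Theta> g / (1 - cnj a z)\<close> one has \<open>\<langle>(z - a) h, z v\<rangle> = \<langle>h, (1 - cnj a z) v\<rangle>\<close>, and the
  left-hand side vanishes because \<open>z v\<close> is a multiple of \<open>\<Theta>\<close>.\<close>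

lemma model_space_divide_blaschke:
  assumes f: "f \<in> model_space \<Theta>" and a: "norm a < 1" and fa: "f a = 0"
  obtains g where "g \<in> model_space \<Theta>" "\<And>z. norm z < 1 \<Longrightarrow> f z
      = blaschke_factor a z * g z" "H2_norm g = H2_norm f"
proof -
  have f2: "f \<in> H2" using f by (simp add: model_space_def)
  obtain h where h: "h \<in> H2" and fh: "\<And>z. norm z < 1 \<Longrightarrow> f z = (z - a) * h z"
    using H2_divide_linear[OF f2 a fa] by blast
  have zH: "(\<lambda>z. z * u z) \<in> H2" if "u \<in> H2" for u
      by (rule H2_inner_function_mult[OF inner_function_id that])
  have "H2_inner h (\<lambda>z. \<Theta> z * g z) = 0" if g: "g \<in> H2" for g
  proof -
    have nz: "1 - cnj a * z \<noteq> 0" if "norm z < 1" for z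
        using one_minus_cnj_mult_nonzero'[OF a, of z] that by simp
    define u where "u = (\<lambda>z. H2_kernel a z * g z)"
    have kb: "norm (H2_kernel a z) \<le> 1 / (1 - norm a)" if z: "norm z < 1" for z
    proof -
      have "norm (cnj a * z) \<le> norm a * 1" unfolding norm_mult complex_mod_cnj using z
          by (intro mult_left_mono) auto
      then have "1 - norm a \<le> norm (1 - cnj a * z)" using norm_triangle_ineq2[of 1 "cnj a * z"]
          by simp
      then show ?thesis using a unfolding H2_kernel_def norm_divide by (intro frac_le) auto
    qed
    have u: "u \<in> H2" unfolding u_def
        by (rule H2_mult(1)[OF H2_holomorphic[OF H2_kernel_in_H2[OF a]] kb g])
    define v where "v = (\<lambda>z. \<Theta> z * u z)"
    have v: "v \<in> H2" unfolding v_def by (rule mult_H2[OF u])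
    have "0 = H2_inner f (\<lambda>z. \<Theta> z * (z * u z))"
      using f zH[OF u] by (simp add: model_space_def)
    also have "(\<lambda>z. \<Theta> z * (z * u z)) = (\<lambda>z. z * v z)" by (simp add: v_def mult_ac)
    also have "H2_inner f (\<lambda>z. z * v z) = H2_inner (\<lambda>z. z * h z - a * h z) (\<lambda>z. z * v z)"
      by (rule H2_inner_cong[OF H2_diff[OF zH[OF h] H2_cmult[OF h]] zH[OF v]]) (simp_all add: fh
          algebra_simps)
    also have "\<dots> = H2_inner h v - a * H2_inner h (\<lambda>z. z * v z)"
      unfolding H2_inner_diff_left[OF zH[OF h] H2_cmult[OF h] zH[OF v]] H2_inner_cmult_left[OF h
          zH[OF v]]
        inner_function_inner[OF inner_function_id h v] ..
    also have "\<dots> = H2_inner h (\<lambda>z. v z - cnj a * (z * v z))"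
      unfolding H2_inner_diff_right[OF v H2_cmult[OF zH[OF v]] h] H2_inner_cmult_right[OF zH[OF v]
          h] by simp
    also have "\<dots> = H2_inner h (\<lambda>z. \<Theta> z * g z)"
    proof (rule H2_inner_cong[OF h mult_H2[OF g] refl])
      fix z :: complex assume "norm z < 1"
      moreover have "v z - cnj a * (z * v z) = (1 - cnj a * z) * v z" by (simp add: algebra_simps)
      ultimately show "v z - cnj a * (z * v z) = \<Theta> z * g z"
        using nz[of z] by (simp add: v_def u_def H2_kernel_def)
    qed
    finally show ?thesis by simp
  qed
  then have hm: "h \<in> model_space \<Theta>" using h by (simp add: model_space_def)
  \<comment> \<open>On the disc this is (1 - cnj a * z) * h z, written as a linear combination of h
    and f = (z - a) h so that membership in the model space is evident.\<close>
  define g where "g = (\<lambda>z. (h z + (- cnj a) * f z) + (- (cnj a * a)) * h z)"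
  have gm: "g \<in> model_space \<Theta>"
    unfolding g_def by (intro closed_subspace_add_cmult[OF closed_subspace_model_space] f hm)
  have g2: "g \<in> H2" using gm by (simp add: model_space_def)
  have fg: "f z = blaschke_factor a z * g z" if "norm z < 1" for z
  proof -
    have "g z = (1 - cnj a * z) * h z" by (simp add: g_def fh[OF that] algebra_simps)
    then show ?thesis
      using fh[OF that] one_minus_cnj_mult_nonzero'[OF a, of z] that
          by (simp add: blaschke_factor_def)
  qed
  have "H2_norm f = H2_norm (\<lambda>z. blaschke_factor a z * g z)"
    by (rule H2_norm_cong[OF H2_inner_function_mult[OF inner_function_blaschke_factor[OF a] g2]])
        (rule fg)
  then have "H2_norm g = H2_norm f"
    using inner_function_norm[OF inner_function_blaschke_factor[OF a] g2] by simp
  then show ?thesis using that gm fg by blast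
qed

text \<open>The repeated division is used quantitatively: it preserves the norm and, as
  \<open>a\<close> is not in \<Lambda>, the zeros on \<Lambda>. After m divisions the value at w is
  bounded by the norm of f times the m-th power of a number below 1, up to a constant depending on
  w.\<close>

lemma model_space_eq_0:
  assumes \<Lambda>: "\<Lambda> \<subseteq> unit_disc" and a: "norm a < 1" "a \<notin> \<Lambda>"
    and impl: "\<And>f. f \<in> model_space \<Theta> \<Longrightarrow> (\<And>l. l \<in> \<Lambda> \<Longrightarrow> f l = 0) \<Longrightarrow> f a = 0"
    and f: "f \<in> model_space \<Theta>" "\<And>l. l \<in> \<Lambda> \<Longrightarrow> f l = 0"
  shows "H2_norm f = 0"
proof -
  have bound: "(norm (f w))\<^sup>2 * (1 - (norm w)\<^sup>2) \<le> (H2_norm f)\<^sup>2 * ((norm (blaschke_factor a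
      w))\<^sup>2) ^ m"
    if w: "norm w < 1" for m w
    using f
  proof (induction m arbitrary: f)
    case 0
    then show ?case using H2_zeros_bound[of "{}" f w] w by (simp add: model_space_def)
  next
    case (Suc m)
    obtain g where g: "g \<in> model_space \<Theta>" "\<And>z. norm z < 1 \<Longrightarrow> f z
        = blaschke_factor a z * g z" "H2_norm g = H2_norm f"
      using model_space_divide_blaschke[OF Suc.prems(1) a(1) impl[OF Suc.prems]] by blast
    have "g l = 0" if l: "l \<in> \<Lambda>" for l
    proof -
      have l1: "norm l < 1" "l \<noteq> a" using l \<Lambda> a by auto
      then have "blaschke_factor a l \<noteq> 0"
        using one_minus_cnj_mult_nonzero'[OF a(1), of l] by (simp add: blaschke_factor_def)
      then show ?thesis using g(2)[OF l1(1)] Suc.prems(2)[OF l] by simp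
    qed
    from Suc.IH[OF g(1) this]
    have "(norm (g w))\<^sup>2 * (1 - (norm w)\<^sup>2) \<le> (H2_norm g)\<^sup>2 * ((norm (blaschke_factor a w))\<^sup>2) ^
        m" .
    then have "(norm (blaschke_factor a w))\<^sup>2 * ((norm (g w))\<^sup>2 * (1 - (norm w)\<^sup>2)) \<le>
        (norm (blaschke_factor a w))\<^sup>2 * ((H2_norm g)\<^sup>2 * ((norm (blaschke_factor a w))\<^sup>2) ^ m)"
      by (rule mult_left_mono) simp
    then show ?case by (simp add: g(2)[OF w] g(3) norm_mult power_mult_distrib mult_ac)
  qed
  have "f w = 0" if w: "norm w < 1" for w
  proof -
    have "(norm (blaschke_factor a w))\<^sup>2 < 1"
        by (rule norm_sq_less_1[OF norm_blaschke_factor_lt_1[OF a(1) w]])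
    then have "(\<lambda>m. (H2_norm f)\<^sup>2 * ((norm (blaschke_factor a w))\<^sup>2) ^ m) \<longlonglongrightarrow> (H2_norm f)\<^sup>2 * 0"
      by (intro tendsto_mult tendsto_const LIMSEQ_realpow_zero) auto
    from LIMSEQ_le_const[OF this] bound[OF w] have "(norm (f w))\<^sup>2 * (1 - (norm w)\<^sup>2) \<le> 0" by auto
    then show ?thesis using norm_sq_less_1[OF w] by (simp add: mult_le_0_iff)
  qed
  then have "H2_norm f = H2_norm (\<lambda>z. 0)" by (intro H2_norm_cong[OF H2_0]) auto
  then show ?thesis by simp
qed

end

lemma H2_norm_sum_sq:
  assumes "\<And>n. n \<in> F \<Longrightarrow> x n \<in> H2" "\<And>m n. m \<in> F \<Longrightarrow> n \<in> F \<Longrightarrow> H2_inner (x n) (x m) = k n m"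
  shows "of_real ((H2_norm (lincomb F c x))\<^sup>2) = (\<Sum>m\<in>F. \<Sum>n\<in>F. cnj (c m) * c n * k n m)"
proof -
  let ?y = "lincomb F c x"
  have y: "?y \<in> H2" using assms(1) by (rule H2_sum)
  have "of_real ((H2_norm ?y)\<^sup>2) = H2_inner ?y ?y" by (rule H2_inner_self[OF y, symmetric])
  also have "\<dots> = (\<Sum>m\<in>F. cnj (c m) * H2_inner ?y (x m))" by (rule H2_inner_sum_right[OF assms(1) y])
  also have "\<dots> = (\<Sum>m\<in>F. \<Sum>n\<in>F. cnj (c m) * c n * k n m)"
  proof (rule sum.cong[OF refl])
    fix m assume m: "m \<in> F"
    have "H2_inner ?y (x m) = (\<Sum>n\<in>F. c n * H2_inner (x n) (x m))"
      by (rule H2_inner_sum_left[OF assms(1) assms(1)[OF m]])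
    then show "cnj (c m) * H2_inner ?y (x m) = (\<Sum>n\<in>F. cnj (c m) * c n * k n m)"
      using assms(2) m by (simp add: sum_distrib_left mult.assoc)
  qed
  finally show ?thesis .
qed

section \<open>Normalized kernels and their Gram matrix\<close>

context model_symbol
begin

definition model_factor :: "complex \<Rightarrow> real" where
  "model_factor w = sqrt ((1 - (norm w)\<^sup>2) / (1 - (norm (\<Theta> w))\<^sup>2))"

lemma model_normalized_kernel_eq:
  "model_normalized_kernel \<Theta> w = (\<lambda>z. of_real (model_factor w) * model_kernel \<Theta> w z)"
  by (simp add: model_normalized_kernel_def[abs_def] model_factor_def)

lemma model_kernel_diag: "model_kernel \<Theta> w w = of_real ((1 - (norm (\<Theta> w))\<^sup>2) / (1 - (norm w)\<^sup>2))"
  using complex_norm_square[of w] complex_norm_square[of "\<Theta> w"]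
  by (simp add: model_kernel_def mult.commute)

lemma model_normalized_kernel_in_model_space:
  "norm w < 1 \<Longrightarrow> model_normalized_kernel \<Theta> w \<in> model_space \<Theta>"
  unfolding model_normalized_kernel_eq
  by (intro closed_subspace_cmult[OF closed_subspace_model_space] model_kernel_in_model_space)

lemma model_normalized_kernel_H2: "norm w < 1 \<Longrightarrow> model_normalized_kernel \<Theta> w \<in> H2"
  using model_normalized_kernel_in_model_space by (simp add: model_space_def)

lemma inner_model_normalized_kernel:
  assumes "f \<in> model_space \<Theta>" "norm w < 1"
  shows "H2_inner f (model_normalized_kernel \<Theta> w) = of_real (model_factor w) * f w"
  unfolding model_normalized_kernel_eq
  using assms by (subst H2_inner_cmult_right) (auto simp: model_kernel_H2 model_space_reproducing
      model_space_def)

lemma normalized_value_eq: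
  assumes "f \<in> model_space \<Theta>" "norm w < 1" "norm (\<Theta> w) < 1"
  shows "normalized_value (model_kernel \<Theta>) f w = H2_inner f (model_normalized_kernel \<Theta> w)"
proof -
  have "1 / sqrt (Re (model_kernel \<Theta> w w)) = model_factor w"
    unfolding model_kernel_diag model_factor_def by (simp add: real_sqrt_divide)
  then show ?thesis
    unfolding inner_model_normalized_kernel[OF assms(1,2)] normalized_value_def
    by (metis (no_types, opaque_lifting) of_real_1 of_real_divide mult.commute mult_1
        times_divide_eq_right)
qed

lemma model_factor_sq:
  assumes "norm w < 1" "norm (\<Theta> w) < 1"
  shows "(model_factor w)\<^sup>2 = (1 - (norm w)\<^sup>2) / (1 - (norm (\<Theta> w))\<^sup>2)" "0 < model_factor w"
  using norm_sq_less_1[OF assms(1)] norm_sq_less_1[OF assms(2)] by (auto simp: model_factor_def)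

lemma norm_model_normalized_kernel:
  assumes "norm w < 1" "norm (\<Theta> w) < 1"
  shows "H2_norm (model_normalized_kernel \<Theta> w) = 1"
proof -
  let ?x = "model_normalized_kernel \<Theta> w"
  have "H2_inner ?x ?x = of_real (model_factor w) * ?x w"
    by (rule inner_model_normalized_kernel[OF model_normalized_kernel_in_model_space[OF assms(1)]
        assms(1)])
  also have "\<dots> = of_real ((model_factor w)\<^sup>2 * ((1 - (norm (\<Theta> w))\<^sup>2) / (1 - (norm w)\<^sup>2)))"
    unfolding model_normalized_kernel_eq model_kernel_diag by (simp add: power2_eq_square)
  also have "(model_factor w)\<^sup>2 * ((1 - (norm (\<Theta> w))\<^sup>2) / (1 - (norm w)\<^sup>2)) = 1"
    unfolding model_factor_sq(1)[OF assms]
        using norm_sq_less_1[OF assms(1)] norm_sq_less_1[OF assms(2)] by simp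
  finally have "complex_of_real ((H2_norm ?x)\<^sup>2) = of_real 1"
    using H2_inner_self[OF model_normalized_kernel_H2[OF assms(1)]] by simp
  then have "(H2_norm ?x)\<^sup>2 = 1\<^sup>2" by (simp only: of_real_eq_iff one_power2)
  then show ?thesis using H2_norm_nonneg[OF model_normalized_kernel_H2[OF assms(1)]]
    by (subst (asm) power2_eq_iff_nonneg) auto
qed

text \<open>The squared modulus of the inner product is the quotient of 1 - rho^2 for v, w by the
  same expression for \<Theta> v, \<Theta> w, and the latter is at most 1.\<close>

lemma inner_model_normalized_kernels_ge:
  assumes "norm v < 1" "norm (\<Theta> v) < 1" "norm w < 1" "norm (\<Theta> w) < 1"
  shows "1 - (norm (blaschke_factor v w))\<^sup>2 \<le>
    (norm (H2_inner (model_normalized_kernel \<Theta> v) (model_normalized_kernel \<Theta> w)))\<^sup>2"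
proof -
  define B where "B = norm (1 - cnj v * w)"
  define A where "A = norm (1 - cnj (\<Theta> v) * \<Theta> w)"
  define p where "p = (1 - (norm v)\<^sup>2) * (1 - (norm w)\<^sup>2)"
  define q where "q = (1 - (norm (\<Theta> v))\<^sup>2) * (1 - (norm (\<Theta> w))\<^sup>2)"
  note sq = norm_sq_less_1[OF assms(1)] norm_sq_less_1[OF assms(2)] norm_sq_less_1[OF assms(3)]
      norm_sq_less_1[OF assms(4)]
  have p: "0 < p" and q: "0 < q" using sq by (auto simp: p_def q_def)
  have "1 - (norm (blaschke_factor (\<Theta> v) (\<Theta> w)))\<^sup>2 = q / A\<^sup>2"
    unfolding q_def A_def by (rule one_minus_blaschke_factor) (use assms in auto)
  then have "q / A\<^sup>2 \<le> 1" using zero_le_power2[of "norm (blaschke_factor (\<Theta> v) (\<Theta> w))"] by linarith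
  moreover have "0 < A\<^sup>2" using one_minus_cnj_mult_nonzero'[OF assms(2) less_imp_le[OF assms(4)]]
      by (simp add: A_def)
  ultimately have "q \<le> A\<^sup>2" by (simp add: pos_divide_le_eq)
  then have "1 \<le> A\<^sup>2 / q" using q by (simp add: pos_le_divide_eq)
  then have "p / B\<^sup>2 * 1 \<le> p / B\<^sup>2 * (A\<^sup>2 / q)" using p by (intro mult_left_mono) auto
  also have "\<dots> = (model_factor v)\<^sup>2 * (model_factor w)\<^sup>2 * (A\<^sup>2 / B\<^sup>2)"
    unfolding model_factor_sq(1)[OF assms(1,2)] model_factor_sq(1)[OF assms(3,4)]
        by (simp add: p_def q_def)
  also have "\<dots> = (norm (H2_inner (model_normalized_kernel \<Theta> v) (model_normalized_kernel \<Theta> w)))\<^sup>2"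
  proof -
    have "H2_inner (model_normalized_kernel \<Theta> v) (model_normalized_kernel \<Theta> w) =
        of_real (model_factor w) * (of_real (model_factor v) * model_kernel \<Theta> v w)"
      using inner_model_normalized_kernel[OF model_normalized_kernel_in_model_space[OF assms(1)]
          assms(3)]
      by (simp add: model_normalized_kernel_eq[of v])
    then show ?thesis
      by (simp add: model_kernel_def A_def B_def norm_mult norm_divide power_mult_distrib
          power_divide)
  qed
  finally show ?thesis
    unfolding one_minus_blaschke_factor[OF assms(1) less_imp_le[OF assms(3)]]
        by (simp add: p_def B_def)
qed

text \<open>The matrix identity of the overview as an identity of quadratic forms: the weights are
  absorbed into \<open>c\<close>, and the factor 1 - cnj (\<Theta> (lam n)) * \<Theta> (lam m) of
  the entries splits into the form of the Hardy space kernels at \<open>c\<close> and at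
  \<open>c\<close> multiplied entrywise by cnj (\<Theta> (lam n)).\<close>

lemma model_gram:
  fixes lam b :: "nat \<Rightarrow> complex"
  assumes w: "\<And>n. n \<in> F \<Longrightarrow> norm (lam n) < 1" "\<And>n. n \<in> F \<Longrightarrow> norm (\<Theta> (lam n)) < 1"
  defines "c \<equiv> \<lambda>n. b n / of_real (sqrt (1 - (norm (\<Theta> (lam n)))\<^sup>2))"
  shows "(H2_norm (\<lambda>z. \<Sum>n\<in>F. b n * model_normalized_kernel \<Theta> (lam n) z))\<^sup>2 =
    (H2_norm (\<lambda>z. \<Sum>n\<in>F. c n * H2_normalized_kernel (lam n) z))\<^sup>2 -
    (H2_norm (\<lambda>z. \<Sum>n\<in>F. (c n * cnj (\<Theta> (lam n))) * H2_normalized_kernel (lam n) z))\<^sup>2"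
proof -
  let ?h = "\<lambda>n. H2_normalized_kernel (lam n)" and ?x = "\<lambda>n. model_normalized_kernel \<Theta> (lam n)"
  define s where "s = (\<lambda>n. sqrt (1 - (norm (lam n))\<^sup>2))"
  define t where "t = (\<lambda>n. sqrt (1 - (norm (\<Theta> (lam n)))\<^sup>2))"
  define D where "D = (\<lambda>n m. 1 - cnj (lam n) * lam m)"
  have t: "t n \<noteq> 0" if "n \<in> F" for n using norm_sq_less_1[OF w(2)[OF that]] by (simp add: t_def)
  have mf: "model_factor (lam n) = s n / t n" for n
      by (simp add: model_factor_def s_def t_def real_sqrt_divide)
  define kh where "kh = (\<lambda>n m. of_real (s m * s n) / D n m)"
  define kx where "kx = (\<lambda>n m. of_real (s m * s n / (t m * t n)) * (1
      - cnj (\<Theta> (lam n)) * \<Theta> (lam m)) / D n m)"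
  have ih: "H2_inner (?h n) (?h m) = kh n m" if "m \<in> F" "n \<in> F" for m n
    using w(1) that H2_inner_normalized_kernel[OF H2_normalized_kernel_in_H2, of "lam n" "lam m"]
    by (simp add: kh_def s_def D_def H2_normalized_kernel_def)
  have ix: "H2_inner (?x n) (?x m) = kx n m" if "m \<in> F" "n \<in> F" for m n
    using w(1) that inner_model_normalized_kernel[OF model_normalized_kernel_in_model_space, of
        "lam n" "lam m"]
    by (simp add: kx_def mf D_def model_normalized_kernel_eq model_kernel_def mult.assoc)
  have hH: "?h n \<in> H2" and xH: "?x n \<in> H2" if "n \<in> F" for n
    using w(1)[OF that] by (auto intro: H2_normalized_kernel_in_H2 model_normalized_kernel_H2)
  have P: "complex_of_real ((H2_norm (lincomb F c ?h))\<^sup>2) = (\<Sum>m\<in>F. \<Sum>n\<in>F. cnj (c m) * c n * kh n m)"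
    by (rule H2_norm_sum_sq[OF hH ih])
  have Q: "complex_of_real ((H2_norm (\<lambda>z. \<Sum>n\<in>F. (c n * cnj (\<Theta> (lam n))) * ?h n z))\<^sup>2) =
      (\<Sum>m\<in>F. \<Sum>n\<in>F. cnj (c m * cnj (\<Theta> (lam m))) * (c n * cnj (\<Theta> (lam n))) * kh n m)"
    by (rule H2_norm_sum_sq[OF hH ih])
  have "complex_of_real ((H2_norm (lincomb F b ?x))\<^sup>2) = (\<Sum>m\<in>F. \<Sum>n\<in>F. cnj (b m) * b n * kx n m)"
    by (rule H2_norm_sum_sq[OF xH ix])
  also have "\<dots> = (\<Sum>m\<in>F. \<Sum>n\<in>F. cnj (c m) * c n * kh n m) -
      (\<Sum>m\<in>F. \<Sum>n\<in>F. cnj (c m * cnj (\<Theta> (lam m))) * (c n * cnj (\<Theta> (lam n))) * kh n m)"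
    unfolding sum_subtractf[symmetric]
  proof (intro sum.cong refl)
    fix m n assume mn: "m \<in> F" "n \<in> F"
    have b: "b n = c n * of_real (t n)" "b m = c m * of_real (t m)" using t mn
        by (auto simp: c_def t_def)
    have "cnj (b m) * b n * of_real (s m * s n / (t m * t n))
        = cnj (c m) * c n * of_real (s m * s n)"
      unfolding b using t mn by (simp add: mult_ac)
    then have "cnj (b m) * b n * kx n m = cnj (c m) * c n * of_real (s m * s n) * (1
        - cnj (\<Theta> (lam n)) * \<Theta> (lam m)) / D n m"
      unfolding kx_def by (metis (no_types, lifting) mult.assoc times_divide_eq_right)
    then show "cnj (b m) * b n * kx n m = cnj (c m) * c n * kh n m -
        cnj (c m * cnj (\<Theta> (lam m))) * (c n * cnj (\<Theta> (lam n))) * kh n m"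
      by (simp add: kh_def algebra_simps diff_divide_distrib)
  qed
  also have "\<dots> = of_real ((H2_norm (lincomb F c ?h))\<^sup>2 - (H2_norm (\<lambda>z. \<Sum>n\<in>F. (c n * cnj (\<Theta> (lam
      n))) * ?h n z))\<^sup>2)"
    unfolding of_real_diff P Q ..
  finally show ?thesis by (simp only: of_real_eq_iff)
qed

end

section \<open>Thinness and the Riesz bounds of model kernels\<close>

locale model_sequence = model_symbol +
  fixes lam :: "nat \<Rightarrow> complex" and \<kappa> :: real
  assumes int: "interpolating lam"
    and \<kappa>: "0 \<le> \<kappa>" "\<kappa> < 1" "\<And>n. n \<ge> 1 \<Longrightarrow> norm (\<Theta> (lam n)) \<le> \<kappa>"
begin

abbreviation x :: "nat \<Rightarrow> complex \<Rightarrow> complex" where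
  "x n \<equiv> model_normalized_kernel \<Theta> (lam n)"

abbreviation h :: "nat \<Rightarrow> complex \<Rightarrow> complex" where
  "h n \<equiv> H2_normalized_kernel (lam n)"

lemma disc: "n \<ge> 1 \<Longrightarrow> norm (lam n) < 1"
  by (rule interpolating_disc[OF int])

lemma \<Theta>_less: "n \<ge> 1 \<Longrightarrow> norm (\<Theta> (lam n)) < 1"
  using \<kappa>(2) \<kappa>(3)[of n] by simp

lemma \<kappa>_sq: "0 < 1 - \<kappa>\<^sup>2" "1 - \<kappa>\<^sup>2 \<le> 1"
  using \<kappa> by (auto simp: abs_square_less_1)

lemma \<Theta>_sq: "n \<ge> 1 \<Longrightarrow> (norm (\<Theta> (lam n)))\<^sup>2 \<le> \<kappa>\<^sup>2"
  using \<kappa>(3) by (intro power_mono) auto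

lemma xM: "n \<ge> 1 \<Longrightarrow> x n \<in> model_space \<Theta>"
  by (rule model_normalized_kernel_in_model_space[OF disc])

lemma xH: "n \<ge> 1 \<Longrightarrow> x n \<in> H2"
  by (rule model_normalized_kernel_H2[OF disc])

lemma row_le:
  assumes "j \<ge> 1" "k \<ge> 1"
  shows "1 - (rho lam j k)\<^sup>2 \<le> (norm (H2_inner (x j) (x k)))\<^sup>2"
  using inner_model_normalized_kernels_ge[OF disc[OF assms(1)] \<Theta>_less[OF assms(1)] disc[OF
      assms(2)] \<Theta>_less[OF assms(2)]]
  by (simp add: rho_def norm_blaschke_factor_commute)

text \<open>The square sums C and C' of the two coefficient families in \<open>model_gram\<close>
  satisfy C - C' = sum of |b n|^2 exactly. Only the errors e C and e C' are enlarged, each by at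
  most 1 / (1 - \<kappa>^2), whence the factor 2.\<close>

lemma bounds_transfer:
  assumes low: "lower_bd h N (1 - e)" and up: "upper_bd h N (1 + e)" and N: "N \<ge> 1" and e: "0 \<le> e"
  shows "lower_bd x N (1 - 2 * e / (1 - \<kappa>\<^sup>2))" "upper_bd x N (1 + 2 * e / (1 - \<kappa>\<^sup>2))"
proof -
  have *: "(1 - 2 * e / (1 - \<kappa>\<^sup>2)) * sqsum F b \<le> (H2_norm (lincomb F b x))\<^sup>2 \<and>
      (H2_norm (lincomb F b x))\<^sup>2 \<le> (1 + 2 * e / (1 - \<kappa>\<^sup>2)) * sqsum F b"
    if F: "finite F" "F \<subseteq> {N..}" for F and b :: "nat \<Rightarrow> complex"
  proof -
    have F1: "n \<ge> 1" if "n \<in> F" for n using F(2) N that by auto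
    define u where "u = (\<lambda>n. 1 - (norm (\<Theta> (lam n)))\<^sup>2)"
    define c where "c = (\<lambda>n. b n / of_real (sqrt (u n)))"
    define A where "A = sqsum F b"
    define C where "C = sqsum F c"
    define C' where "C' = (\<Sum>n\<in>F. (norm (c n * cnj (\<Theta> (lam n))))\<^sup>2)"
    define X where "X = (H2_norm (lincomb F b x))\<^sup>2"
    define P where "P = (H2_norm (lincomb F c h))\<^sup>2"
    define Q where "Q = (H2_norm (\<lambda>z. \<Sum>n\<in>F. (c n * cnj (\<Theta> (lam n))) * h n z))\<^sup>2"
    have X: "X = P - Q"
      unfolding X_def P_def Q_def c_def u_def by (rule model_gram) (use F1 disc \<Theta>_less in auto)
    have PQ: "(1 - e) * C \<le> P" "P \<le> (1 + e) * C" "(1 - e) * C' \<le> Q" "Q \<le> (1 + e) * C'"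
      unfolding P_def Q_def C_def C'_def
      using low[unfolded lower_bd_def, rule_format, OF F, of c] up[unfolded upper_bd_def,
          rule_format, OF F, of c]
        low[unfolded lower_bd_def, rule_format, OF F, of "\<lambda>n. c n * cnj (\<Theta> (lam n))"]
        up[unfolded upper_bd_def, rule_format, OF F, of "\<lambda>n. c n * cnj (\<Theta> (lam n))"] by simp_all
    have u: "1 - \<kappa>\<^sup>2 \<le> u n" "0 < u n" if "n \<in> F" for n
      using \<Theta>_sq[OF F1[OF that]] \<kappa>_sq(1) by (auto simp: u_def)
    have cn: "(norm (c n))\<^sup>2 = (norm (b n))\<^sup>2 / u n" if "n \<in> F" for n
      using u(2)[OF that] by (simp add: c_def norm_divide power_divide)
    have "C - C' = A"
      unfolding C_def C'_def A_def sum_subtractf[symmetric]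
    proof (rule sum.cong[OF refl])
      fix n assume n: "n \<in> F"
      have "(norm (c n))\<^sup>2 - (norm (c n * cnj (\<Theta> (lam n))))\<^sup>2 = (norm (c n))\<^sup>2 * u n"
        by (simp add: norm_mult power_mult_distrib u_def algebra_simps)
      then show "(norm (c n))\<^sup>2 - (norm (c n * cnj (\<Theta> (lam n))))\<^sup>2 = (norm (b n))\<^sup>2"
        using cn[OF n] u(2)[OF n] by simp
    qed
    moreover have "C \<le> A / (1 - \<kappa>\<^sup>2)"
      unfolding C_def A_def sum_divide_distrib
    proof (rule sum_mono)
      fix n assume n: "n \<in> F"
      show "(norm (c n))\<^sup>2 \<le> (norm (b n))\<^sup>2 / (1 - \<kappa>\<^sup>2)"
        unfolding cn[OF n] using u[OF n] \<kappa>_sq(1) by (intro divide_left_mono mult_pos_pos) auto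
    qed
    moreover have "0 \<le> C'" unfolding C'_def by (rule sum_nonneg) auto
    moreover have "0 \<le> A" unfolding A_def by (rule sum_nonneg) auto
    ultimately have "e * (C + C') \<le> e * (2 * (A / (1 - \<kappa>\<^sup>2)))"
      using e by (intro mult_left_mono) linarith+
    moreover have "A - e * (C + C') \<le> X" "X \<le> A + e * (C + C')"
      using PQ \<open>C - C' = A\<close> unfolding X by (auto simp: algebra_simps)
    ultimately have "A - e * (2 * (A / (1 - \<kappa>\<^sup>2))) \<le> X \<and> X \<le> A + e * (2 * (A / (1 - \<kappa>\<^sup>2)))"
        by linarith
    then show ?thesis unfolding X_def[symmetric] A_def[symmetric] by (simp add: algebra_simps)
  qed
  then show "lower_bd x N (1 - 2 * e / (1 - \<kappa>\<^sup>2))" "upper_bd x N (1 + 2 * e / (1 - \<kappa>\<^sup>2))"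
    unfolding lower_bd_def upper_bd_def by blast+
qed

text \<open>Dropping the subtracted norm in \<open>model_gram\<close> leaves an estimate that works
  with an arbitrary upper constant and no lower bound for \<open>h\<close>; this is the form
  available before thinness is known.\<close>

lemma upper_transfer:
  assumes up: "upper_bd h N C" and N: "N \<ge> 1" and C: "0 \<le> C"
  shows "upper_bd x N (C / (1 - \<kappa>\<^sup>2))"
  unfolding upper_bd_def
proof (intro allI impI)
  fix F and b :: "nat \<Rightarrow> complex" assume F: "finite F" "F \<subseteq> {N..}"
  have F1: "n \<ge> 1" if "n \<in> F" for n using F(2) N that by auto
  define c where "c = (\<lambda>n. b n / of_real (sqrt (1 - (norm (\<Theta> (lam n)))\<^sup>2)))"
  have "(H2_norm (lincomb F b x))\<^sup>2 =
      (H2_norm (lincomb F c h))\<^sup>2 - (H2_norm (\<lambda>z. \<Sum>n\<in>F. (c n * cnj (\<Theta> (lam n))) * h n z))\<^sup>2"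
    unfolding c_def by (rule model_gram) (use F1 disc \<Theta>_less in auto)
  also have "\<dots> \<le> (H2_norm (lincomb F c h))\<^sup>2" by simp
  also have "\<dots> \<le> C * sqsum F c"
    using up[unfolded upper_bd_def, rule_format, OF F] by blast
  also have "\<dots> \<le> C * (\<Sum>n\<in>F. (norm (b n))\<^sup>2 / (1 - \<kappa>\<^sup>2))"
  proof (intro mult_left_mono sum_mono C)
    fix n assume n: "n \<in> F"
    have u: "1 - \<kappa>\<^sup>2 \<le> 1 - (norm (\<Theta> (lam n)))\<^sup>2" using \<Theta>_sq[OF F1[OF n]] by simp
    have "(norm (c n))\<^sup>2 = (norm (b n))\<^sup>2 / (1 - (norm (\<Theta> (lam n)))\<^sup>2)"
      using u \<kappa>_sq(1) by (simp add: c_def norm_divide power_divide)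
    also have "\<dots> \<le> (norm (b n))\<^sup>2 / (1 - \<kappa>\<^sup>2)"
      using u \<kappa>_sq(1) by (intro divide_left_mono mult_pos_pos) auto
    finally show "(norm (c n))\<^sup>2 \<le> (norm (b n))\<^sup>2 / (1 - \<kappa>\<^sup>2)" .
  qed
  finally show "(H2_norm (lincomb F b x))\<^sup>2 \<le> C / (1 - \<kappa>\<^sup>2) * sqsum F b"
    by (simp add: sum_divide_distrib[symmetric])
qed

lemma thin_imp_model_bounds:
  assumes "thin lam" "e > 0"
  shows "\<exists>N\<ge>1. lower_bd x N (1 - e) \<and> upper_bd x N (1 + e)"
proof -
  \<comment> \<open>Compensates for the loss in \<open>bounds_transfer\<close>.\<close>
  define d where "d = e * (1 - \<kappa>\<^sup>2) / 2"
  have d: "0 < d" "2 * d / (1 - \<kappa>\<^sup>2) = e" using assms(2) \<kappa>_sq(1) by (auto simp: d_def)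
  obtain N where "N \<ge> 1" "lower_bd h N (1 - d)" "upper_bd h N (1 + d)"
    using thin_imp_bounds[OF int assms(1) d(1)] by blast
  then show ?thesis using bounds_transfer[of N d] d by auto
qed

text \<open>Bessel's inequality for x j and the vectors x k including x j itself: the diagonal term
  uses up 1 of the constant 1 + e, so at most e remains for the row.\<close>

lemma upper_imp_thin:
  assumes "\<And>e. e > 0 \<Longrightarrow> \<exists>N\<ge>1. upper_bd x N (1 + e)"
  shows "thin lam"
proof (rule thin_of_row_sums[OF int])
  fix e :: real assume e: "e > 0"
  obtain N where N: "N \<ge> 1" and up: "upper_bd x N (1 + e)" using assms[OF e] by blast
  show "\<exists>N\<ge>1. \<forall>j\<ge>N. \<forall>F. finite F \<longrightarrow> F \<subseteq> {N..} - {j} \<longrightarrow> (\<Sum>k\<in>F. 1 - (rho lam j k)\<^sup>2) \<le> e"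
  proof (intro exI[of _ N] conjI N allI impI)
    fix j F assume j: "j \<ge> N" and F: "finite F" "F \<subseteq> {N..} - {j}"
    have j1: "j \<ge> 1" using j N by simp
    have n1: "H2_norm (x j) = 1" by (rule norm_model_normalized_kernel[OF disc[OF j1] \<Theta>_less[OF
        j1]])
    have "(\<Sum>k\<in>F. 1 - (rho lam j k)\<^sup>2) \<le> (\<Sum>k\<in>F. (norm (H2_inner (x j) (x k)))\<^sup>2)"
    proof (rule sum_mono)
      fix k assume "k \<in> F"
      then have "k \<ge> 1" using F(2) N by auto
      then show "1 - (rho lam j k)\<^sup>2 \<le> (norm (H2_inner (x j) (x k)))\<^sup>2" by (rule row_le[OF j1])
    qed
    moreover have "(\<Sum>k\<in>insert j F. (norm (H2_inner (x j) (x k)))\<^sup>2) \<le> (1 + e) * (H2_norm (x j))\<^sup>2"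
      by (rule bessel[OF up]) (use e F j N in \<open>auto intro!: xH[OF j1] xH\<close>)
    moreover have "(\<Sum>k\<in>insert j F. (norm (H2_inner (x j) (x k)))\<^sup>2) = 1
        + (\<Sum>k\<in>F. (norm (H2_inner (x j) (x k)))\<^sup>2)"
      using F by (subst sum.insert) (auto simp: H2_inner_self[OF xH[OF j1]] n1)
    ultimately show "(\<Sum>k\<in>F. 1 - (rho lam j k)\<^sup>2) \<le> e" using n1 by simp
  qed
qed

text \<open>The dual functions in the model space, divided by Blaschke products, bound the partial
  products from below; the resulting crude upper Riesz bound turns the lower bounds into small row
  sums.\<close>

lemma lower_imp_thin:
  assumes low: "\<And>e. e > 0 \<Longrightarrow> \<exists>N\<ge>1. lower_bd x N (1 - e)"
  shows "thin lam"
proof -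
  obtain N0 where N0: "N0 \<ge> 1" and low0: "lower_bd x N0 (1 / 2)" using low[of "1 / 2"] by auto
  \<comment> \<open>The function f dual to x j has squared norm at most 2, because the lower bound
    is 1 / 2. Dividing by the Blaschke factors gives 1 - |\<Theta> (lam j)|^2 <= 2 * prod rho, so
    the products are at least this \<open>d\<close>.\<close>
  define d where "d = (1 - \<kappa>\<^sup>2) / 2"
  have "d \<le> 1 / 2" unfolding d_def by (rule divide_right_mono[OF \<kappa>_sq(2)]) simp
  then have "d \<le> 1" by linarith
  then have d: "0 < d" "d \<le> 1" using \<kappa>_sq(1) by (simp_all add: d_def)
  have xN0: "\<And>n. n \<ge> N0 \<Longrightarrow> x n \<in> H2" using xH N0 by auto
  have prods: "d \<le> (\<Prod>k\<in>F - {j}. rho lam j k)" if F: "finite F" "F \<subseteq> {N0..}" and j: "j \<in> F" for F j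
  proof -
    have F1: "n \<ge> 1" if "n \<in> F" for n using F(2) N0 that by auto
    define a :: "nat \<Rightarrow> complex" where "a = (\<lambda>m. if m = j then 1 else 0)"
    obtain b where b: "\<And>m. m \<in> F \<Longrightarrow> H2_inner (lincomb F b x) (x m) = a m"
      "1 / 2 * (H2_norm (lincomb F b x))\<^sup>2 \<le> (\<Sum>m\<in>F. (norm (a m))\<^sup>2)"
      by (rule gram_interpolation[where F = F and a = a, OF low0 _ xN0 F]) auto
    define f where "f = lincomb F b x"
    have fM: "f \<in> model_space \<Theta>" unfolding f_def
      by (rule closed_subspace_sum[OF closed_subspace_model_space]) (use F1 xM in auto)
    then have f2: "f \<in> H2" by (simp add: model_space_def)
    have "(\<Sum>m\<in>F. (norm (a m))\<^sup>2) = (\<Sum>m\<in>F. if m = j then 1 else 0)"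
        by (rule sum.cong) (auto simp: a_def)
    also have "\<dots> = 1" using F(1) j by simp
    finally have nf: "(H2_norm f)\<^sup>2 \<le> 2" using b(2) by (simp add: f_def)
    have fv: "of_real (model_factor (lam m)) * f (lam m) = a m" if "m \<in> F" for m
      using b(1)[OF that] inner_model_normalized_kernel[OF fM disc[OF F1[OF that]]]
          by (simp add: f_def)
    have j1: "j \<ge> 1" by (rule F1[OF j])
    note mf = model_factor_sq[OF disc \<Theta>_less]
    have f0: "f (lam k) = 0" if "k \<in> F - {j}" for k
      using fv[of k] mf(2)[OF F1 F1, of k] that by (auto simp: a_def)
    have "norm (of_real (model_factor (lam j)) * f (lam j)) = 1" using fv[OF j] by (simp add: a_def)
    then have "(model_factor (lam j))\<^sup>2 * (norm (f (lam j)))\<^sup>2 = 1"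
      using power_mult_distrib[of "model_factor (lam j)" "norm (f (lam j))" 2] mf(2)[OF j1 j1]
          by (simp add: norm_mult)
    then have "(1 - (norm (lam j))\<^sup>2) * (norm (f (lam j)))\<^sup>2 = 1 - (norm (\<Theta> (lam j)))\<^sup>2"
      unfolding mf(1)[OF j1 j1] using norm_sq_less_1[OF \<Theta>_less[OF j1]] by (simp add: divide_eq_eq)
    then have "1 - (norm (\<Theta> (lam j)))\<^sup>2 \<le> (H2_norm f)\<^sup>2 * (\<Prod>k\<in>F - {j}. (rho lam j k)\<^sup>2)"
      using H2_zeros_bound_seq[OF int F(1) _ j1 f2 f0] F1 by (auto simp: mult.commute)
    also have "\<dots> \<le> 2 * (\<Prod>k\<in>F - {j}. rho lam j k)"
    proof (intro mult_mono nf prod_mono prod_nonneg)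
      fix k assume "k \<in> F - {j}"
      then show "0 \<le> (rho lam j k)\<^sup>2 \<and> (rho lam j k)\<^sup>2 \<le> rho lam j k"
        using rho_le_1[of lam, OF disc j1 F1] by (simp add: power2_eq_square mult_left_le)
    qed auto
    finally show ?thesis using \<Theta>_sq[OF j1] by (simp add: d_def)
  qed
  \<comment> \<open>Any l strictly between 0 and d would do in Earl's theorem; d / 2 is taken, since
    only some finite upper bound is wanted.\<close>
  define r where "r = d / 2 * hyp_diff (d / 2) d"
  have ld: "0 < d / 2" "d / 2 < d" using d by auto
  have r: "0 < r" using hyp_diff_pos[OF ld d(2)] d by (simp add: r_def)
  have "upper_bd h N0 (1 / r\<^sup>2)"
    unfolding r_def by (rule products_imp_bounds(2)[OF _ ld d(2) prods]) (use disc N0 in auto)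
  then have up: "upper_bd x N0 (1 / r\<^sup>2 / (1 - \<kappa>\<^sup>2))" by (rule upper_transfer[OF _ N0]) simp
  define C where "C = 1 / r\<^sup>2 / (1 - \<kappa>\<^sup>2)"
  have C: "0 < C" using r \<kappa>_sq by (simp add: C_def)
  show ?thesis
  proof (rule thin_of_row_sums[OF int])
    fix e :: real assume e: "e > 0"
    \<comment> \<open>The row sums will be bounded by C e'; the cap 1 is required by
      \<open>row_sum_le\<close>.\<close>
    define e' where "e' = min (e / C) 1"
    have e': "0 < e'" "e' \<le> 1" "C * e' \<le> e" using e C by (auto simp: e'_def min_def field_simps)
    obtain N1 where N1: "N1 \<ge> 1" "lower_bd x N1 (1 - e')" using low[OF e'(1)] by blast
    define N where "N = max N0 N1"
    have lowN: "lower_bd x N (1 - e')" by (rule lower_bd_mono[OF N1(2)]) (auto simp: N_def)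
    have upN: "upper_bd x N C" unfolding C_def by (rule upper_bd_mono[OF up]) (auto simp: N_def)
    have N: "N \<ge> 1" using N0 by (simp add: N_def)
    show "\<exists>N\<ge>1. \<forall>j\<ge>N. \<forall>F. finite F \<longrightarrow> F \<subseteq> {N..} - {j} \<longrightarrow> (\<Sum>k\<in>F. 1 - (rho lam j k)\<^sup>2) \<le> e"
    proof (intro exI[of _ N] conjI N allI impI)
      fix j F assume j: "j \<ge> N" and F: "finite F" "F \<subseteq> {N..} - {j}"
      have j1: "j \<ge> 1" using j N by simp
      have "(\<Sum>k\<in>F. 1 - (rho lam j k)\<^sup>2) \<le> (\<Sum>k\<in>F. (norm (H2_inner (x j) (x k)))\<^sup>2)"
      proof (rule sum_mono)
        fix k assume "k \<in> F"
        then have "k \<ge> 1" using F(2) N by auto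
        then show "1 - (rho lam j k)\<^sup>2 \<le> (norm (H2_inner (x j) (x k)))\<^sup>2" by (rule row_le[OF j1])
      qed
      also have "\<dots> \<le> C * e'"
      proof (rule row_sum_le[OF lowN upN C e'(2) F(1) _ j])
        show "x n \<in> H2" if "n \<ge> N" for n using xH that N by simp
        show "H2_norm (x j) = 1" by (rule norm_model_normalized_kernel[OF disc[OF j1] \<Theta>_less[OF
            j1]])
      qed (use F in auto)
      finally show "(\<Sum>k\<in>F. 1 - (rho lam j k)\<^sup>2) \<le> e" using e'(3) by linarith
    qed
  qed
qed

lemma EIS_iff_thin: "EIS (model_space \<Theta>) H2_norm (model_kernel \<Theta>) lam \<longleftrightarrow> thin lam"
  and AIS_iff_thin: "AIS (model_space \<Theta>) H2_norm (model_kernel \<Theta>) lam \<longleftrightarrow> thin lam"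
proof -
  have val: "normalized_value (model_kernel \<Theta>) f (lam n) = H2_inner f (x n)"
    if "f \<in> model_space \<Theta>" "n \<ge> 1" for f n
    by (rule normalized_value_eq[OF that(1) disc[OF that(2)] \<Theta>_less[OF that(2)]])
  have "(\<forall>e>0. \<exists>N\<ge>1. lower_bd x N (1 - e)) \<longleftrightarrow> thin lam"
    using lower_imp_thin thin_imp_model_bounds by blast
  then show "EIS (model_space \<Theta>) H2_norm (model_kernel \<Theta>) lam \<longleftrightarrow> thin lam"
    "AIS (model_space \<Theta>) H2_norm (model_kernel \<Theta>) lam \<longleftrightarrow> thin lam"
    using EIS_iff_lower_bd[where x = x and lam = lam, OF closed_subspace_model_space xM val]
        by simp_all
qed

end

section \<open>The two alternatives for AOB sequences\<close>

context model_sequence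
begin

lemma AOB_imp_thin:
  assumes "AOB (model_space \<Theta>) H2_norm (\<lambda>n. x (n + q))"
  shows "thin lam"
proof (rule upper_imp_thin)
  fix e :: real assume "e > 0"
  then obtain N where "N \<ge> 1" "upper_bd (\<lambda>n. x (n + q)) N (1 + e)"
    using AOB_imp_upper_bd[OF closed_subspace_model_space assms] by blast
  then show "\<exists>N\<ge>1. upper_bd x N (1 + e)"
    unfolding upper_bd_shift[where x = x] by (intro exI[of _ "N + q"]) auto
qed

text \<open>Thinness governs late tails only, while \<open>AOB\<close> asks for positive constants
  from its first vector on. For the shifted sequence this vector is x (Suc q), where positivity is
  assumed; the upper bound extends by itself.\<close>

lemma thin_imp_AOB_shift:
  assumes thin: "thin lam" and c: "0 < c" "lower_bd x (Suc q) c"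
  shows "AOB (model_space \<Theta>) H2_norm (\<lambda>n. x (n + q))"
proof -
  obtain N1 where N1: "N1 \<ge> 1" "upper_bd x N1 (1 + 1)" using thin_imp_model_bounds[OF thin, of 1]
      by auto
  obtain C where "upper_bd x 1 C" using upper_bd_extend[OF N1(2,1) xH] by blast
  then have up: "upper_bd (\<lambda>n. x (n + q)) 1 C"
    unfolding upper_bd_shift[where x = x] by (rule upper_bd_mono) auto
  show ?thesis
  proof (rule bounds_imp_AOB[OF closed_subspace_model_space _ c(1) _ up])
    show "x (n + q) \<in> model_space \<Theta>" if "n \<ge> 1" for n using that by (intro xM) simp
    show "lower_bd (\<lambda>n. x (n + q)) 1 c" unfolding lower_bd_shift[where x = x] using c(2) by simp
    fix e :: real assume "e > 0"
    then obtain N where N: "N \<ge> 1" "lower_bd x N (1 - e)" "upper_bd x N (1 + e)"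
      using thin_imp_model_bounds[OF thin] by blast
    show "\<exists>N\<ge>1. lower_bd (\<lambda>n. x (n + q)) N (1 - e) \<and> upper_bd (\<lambda>n. x (n + q)) N (1 + e)"
      unfolding lower_bd_shift[where x = x] upper_bd_shift[where x = x]
      using N(1) lower_bd_mono[OF N(2), of "N + q" "1 - e"] upper_bd_mono[OF N(3), of "N + q" "1
          + e"] by auto
  qed
qed

lemma thin_imp_AOB:
  assumes thin: "thin lam"
  shows "AOB (model_space \<Theta>) H2_norm x \<or>
    (\<exists>p\<ge>2. AOB (model_space \<Theta>) H2_norm (\<lambda>n. x (n + p - 1)) \<and>
            complete_in (model_space \<Theta>) H2_norm (\<lambda>n. x (n + p - 1)))"
proof -
  \<comment> \<open>Here q = p - 1, so \<open>P q\<close> says that the kernels with index greater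
    than q form a Riesz sequence; q = 0 is alternative (a).\<close>
  define P where "P = (\<lambda>q. \<exists>c>0. lower_bd x (Suc q) c)"
  obtain N where N: "N \<ge> 1" "lower_bd x N (1 - 1 / 2)"
      using thin_imp_model_bounds[OF thin, of "1 / 2"] by auto
  have "P (N - 1)" unfolding P_def using N by (intro exI[of _ "1 / 2"]) auto
  then have PL: "P (LEAST q. P q)" by (rule LeastI)
  define q where "q = (LEAST q. P q)"
  obtain c where c: "0 < c" "lower_bd x (Suc q) c" using PL unfolding P_def q_def by blast
  have AOBq: "AOB (model_space \<Theta>) H2_norm (\<lambda>n. x (n + q))" by (rule thin_imp_AOB_shift[OF thin c])
  show ?thesis
  proof (cases "q = 0")
    case True
    then show ?thesis using AOBq by simp
  next
    case False
    then have q1: "q \<ge> 1" by simp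
    have "\<not> P (q - 1)" using not_less_Least[of "q - 1" P] q1 by (simp add: q_def)
    then have np: "\<not> (\<exists>c>0. lower_bd x q c)" using q1 by (simp add: P_def)
    have xq: "\<And>n. n \<ge> q \<Longrightarrow> x n \<in> H2" using xH q1 by simp
    \<comment> \<open>Otherwise f would separate x q from the later kernels, and
      \<open>lower_bd_extend\<close> would contradict the minimality of q.\<close>
    have dep: "H2_inner f (x q) = 0" if f: "f \<in> model_space \<Theta>" "\<And>n. n \<ge> Suc q \<Longrightarrow> H2_inner f (x n)
        = 0" for f
    proof (rule ccontr)
      assume "H2_inner f (x q) \<noteq> 0"
      then have "\<exists>c'>0. lower_bd x q c'"
        using f by (intro lower_bd_extend[OF c(2,1) xq]) (auto simp: model_space_def)
      then show False using np by simp
    qed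
    have ev0: "H2_inner f (x n) = 0 \<longleftrightarrow> f (lam n) = 0" if "f \<in> model_space \<Theta>" "n \<ge> 1" for f n
      using inner_model_normalized_kernel[OF that(1) disc[OF that(2)]] model_factor_sq(2)[OF
          disc[OF that(2)] \<Theta>_less[OF that(2)]] by simp
    have total: "H2_norm f = 0" if f: "f \<in> model_space \<Theta>" "\<And>n. n \<ge> Suc q \<Longrightarrow> H2_inner f (x n) = 0"
        for f
    proof (rule model_space_eq_0[of "lam ` {Suc q..}" "lam q"])
      show "lam ` {Suc q..} \<subseteq> unit_disc" using disc by auto
      show "norm (lam q) < 1" by (rule disc[OF q1])
      show "lam q \<notin> lam ` {Suc q..}"
      proof
        assume "lam q \<in> lam ` {Suc q..}"
        then obtain n where n: "n \<ge> Suc q" "lam q = lam n" by auto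
        then have "q = n" using inj_onD[OF interpolating_inj[OF int] n(2)] q1 by auto
        then show False using n by simp
      qed
      show "g (lam q) = 0" if g: "g \<in> model_space \<Theta>" "\<And>l. l \<in> lam ` {Suc q..} \<Longrightarrow> g l = 0" for g
      proof -
        have "H2_inner g (x n) = 0" if "n \<ge> Suc q" for n
          using ev0[OF g(1), of n] g(2)[of "lam n"] that by simp
        then have "H2_inner g (x q) = 0" by (rule dep[OF g(1)])
        then show ?thesis using ev0[OF g(1) q1] by simp
      qed
      show "f l = 0" if "l \<in> lam ` {Suc q..}" for l
        using that ev0[OF f(1)] f(2) by auto
    qed (rule f(1))
    have "complete_in (model_space \<Theta>) H2_norm (\<lambda>n. x (n + q))"
      unfolding complete_in_def
    proof (intro conjI allI impI ballI)
      show "x (n + q) \<in> model_space \<Theta>" if "n \<ge> 1" for n using that by (intro xM) simp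
      fix f and e :: real assume f: "f \<in> model_space \<Theta>" and e: "e > 0"
      have xM': "\<And>n. n \<ge> Suc q \<Longrightarrow> x n \<in> model_space \<Theta>" using xM by simp
      obtain M b where b: "H2_norm (\<lambda>z. f z - (\<Sum>n\<in>{Suc q..<Suc q + M}. b n * x n z)) < e"
        using total_imp_approximable[OF closed_subspace_model_space xM' c(2,1) total f e] by blast
      have "(\<Sum>n=1..M. b (n + q) * x (n + q) z) = (\<Sum>n\<in>{Suc q..<Suc q + M}. b n * x n z)" for z
        by (rule sum.reindex_bij_witness[of _ "\<lambda>n. n - q" "\<lambda>n. n + q"]) auto
      then show "\<exists>M c. H2_norm (\<lambda>z. f z - (\<Sum>n=1..M. c n * x (n + q) z)) < e"
        using b by (intro exI[of _ M] exI[of _ "\<lambda>n. b (n + q)"]) simp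
    qed
    then show ?thesis using AOBq q1 by (intro disjI2 exI[of _ "Suc q"]) simp
  qed
qed

lemma AOB_iff_thin:
  "AOB (model_space \<Theta>) H2_norm x \<or>
    (\<exists>p\<ge>2. AOB (model_space \<Theta>) H2_norm (\<lambda>n. x (n + p - 1)) \<and>
            complete_in (model_space \<Theta>) H2_norm (\<lambda>n. x (n + p - 1))) \<longleftrightarrow> thin lam"
proof
  assume "AOB (model_space \<Theta>) H2_norm x \<or>
    (\<exists>p\<ge>2. AOB (model_space \<Theta>) H2_norm (\<lambda>n. x (n + p - 1)) \<and>
            complete_in (model_space \<Theta>) H2_norm (\<lambda>n. x (n + p - 1)))"
  then show "thin lam"
  proof (elim disjE exE conjE)
    assume "AOB (model_space \<Theta>) H2_norm x"
    then show ?thesis using AOB_imp_thin[of 0] by simp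
  next
    fix p :: nat assume p: "2 \<le> p" and A: "AOB (model_space \<Theta>) H2_norm (\<lambda>n. x (n + p - 1))"
    have "n + p - 1 = n + (p - 1)" for n using p by simp
    then show ?thesis using A AOB_imp_thin[of "p - 1"] by simp
  qed
qed (rule thin_imp_AOB)

end

section \<open>Carleson embeddings\<close>

text \<open>The measure is the image of a weighted counting measure under \<open>lam\<close>, so the
  integral becomes a series over indices with values in the extended reals.\<close>

lemma L2_norm_sq_point_masses:
  assumes lam: "\<And>n. n \<ge> N \<Longrightarrow> norm (lam n) < 1" and w: "\<And>n. n \<ge> N \<Longrightarrow> 0 \<le> w n"
    and f: "f holomorphic_on unit_disc"
  shows "L2_norm_sq (point_masses lam w N) f = (\<Sum>n. if n \<ge> N then ennreal (w n * (norm (f (lam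
      n)))\<^sup>2) else 0)"
proof -
  let ?P = "point_measure {N..} (\<lambda>k. ennreal (w k))"
  have m: "lam \<in> ?P \<rightarrow>\<^sub>M restrict_space borel unit_disc"
    by (rule measurable_restrict_space2) (use lam in \<open>auto simp: space_point_measure\<close>)
  have "continuous_on unit_disc (\<lambda>z. (norm (f z))\<^sup>2)"
    by (intro continuous_intros holomorphic_on_imp_continuous_on f)
  then have "(\<lambda>z. (norm (f z))\<^sup>2) \<in> borel_measurable (restrict_space borel unit_disc)"
    by (rule borel_measurable_continuous_on_restrict)
  then have "L2_norm_sq (point_masses lam w N) f = (\<integral>\<^sup>+ n. ennreal ((norm (f (lam n)))\<^sup>2) \<partial>?P)"
    unfolding L2_norm_sq_def point_masses_def by (subst nn_integral_distr[OF m]) auto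
  also have "\<dots> = (\<integral>\<^sup>+ n. ennreal (w n) * ennreal ((norm (f (lam n)))\<^sup>2) \<partial>count_space {N..})"
    unfolding point_measure_def by (subst nn_integral_density) auto
  also have "\<dots> = (\<integral>\<^sup>+ n. (if n \<ge> N then ennreal (w n * (norm (f (lam n)))\<^sup>2) else 0) \<partial>count_space
      UNIV)"
    by (subst nn_integral_count_space_indicator) (auto intro!: nn_integral_cong simp:
        indicator_def ennreal_mult w)
  also have "\<dots> = (\<Sum>n. if n \<ge> N then ennreal (w n * (norm (f (lam n)))\<^sup>2) else 0)"
    by (rule nn_integral_count_space_nat)
  finally show ?thesis .
qed

lemma L2_norm_sq_ge:
  assumes lam: "\<And>n. n \<ge> N \<Longrightarrow> norm (lam n) < 1" and w: "\<And>n. n \<ge> N \<Longrightarrow> 0 \<le> w n"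
    and f: "f holomorphic_on unit_disc" and F: "finite F" "F \<subseteq> {N..}"
  shows "ennreal (\<Sum>n\<in>F. w n * (norm (f (lam n)))\<^sup>2) \<le> L2_norm_sq (point_masses lam w N) f"
proof -
  let ?g = "\<lambda>n. if n \<ge> N then ennreal (w n * (norm (f (lam n)))\<^sup>2) else 0"
  have "ennreal (\<Sum>n\<in>F. w n * (norm (f (lam n)))\<^sup>2) = (\<Sum>n\<in>F. ennreal (w n * (norm (f (lam n)))\<^sup>2))"
    by (rule sum_ennreal[symmetric]) (use F w in auto)
  also have "\<dots> = (\<Sum>n\<in>F. ?g n)" by (rule sum.cong) (use F in auto)
  also have "\<dots> \<le> (\<Sum>n. ?g n)" by (rule sum_le_suminf[OF _ F(1)]) auto
  finally show ?thesis using L2_norm_sq_point_masses[OF lam w f] by simp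
qed

lemma L2_norm_sq_le:
  assumes lam: "\<And>n. n \<ge> N \<Longrightarrow> norm (lam n) < 1" and w: "\<And>n. n \<ge> N \<Longrightarrow> 0 \<le> w n"
    and f: "f holomorphic_on unit_disc"
    and B: "\<And>F. finite F \<Longrightarrow> F \<subseteq> {N..} \<Longrightarrow> (\<Sum>n\<in>F. w n * (norm (f (lam n)))\<^sup>2) \<le> B"
  shows "L2_norm_sq (point_masses lam w N) f \<le> ennreal B"
proof -
  let ?g = "\<lambda>n. if n \<ge> N then ennreal (w n * (norm (f (lam n)))\<^sup>2) else 0"
  have "(\<Sum>n<K. ?g n) \<le> ennreal B" for K
  proof -
    have "(\<Sum>n<K. ?g n) = (\<Sum>n\<in>{N..<K}. ennreal (w n * (norm (f (lam n)))\<^sup>2))"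
      by (rule sum.mono_neutral_cong_right) auto
    also have "\<dots> = ennreal (\<Sum>n\<in>{N..<K}. w n * (norm (f (lam n)))\<^sup>2)"
      by (rule sum_ennreal) (use w in auto)
    also have "\<dots> \<le> ennreal B" by (intro ennreal_leI B) auto
    finally show ?thesis .
  qed
  then have "(\<Sum>n. ?g n) \<le> ennreal B" by (intro suminf_le_const) auto
  then show ?thesis using L2_norm_sq_point_masses[OF lam w f] by simp
qed

lemma ennreal_sqrt_mono: "x \<le> y \<Longrightarrow> ennreal_sqrt x \<le> ennreal_sqrt y"
  by (auto simp: ennreal_sqrt_def top_unique intro!: ennreal_leI enn2real_mono simp: less_top)

lemma ennreal_sqrt_ennreal: "0 \<le> r \<Longrightarrow> ennreal_sqrt (ennreal r) = ennreal (sqrt r)"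
  by (simp add: ennreal_sqrt_def)

lemma ennreal_tendsto_1I:
  assumes "\<forall>\<^sub>F N in sequentially. (1::ennreal) \<le> c N"
    and "\<And>e. e > 0 \<Longrightarrow> \<forall>\<^sub>F N in sequentially. c N \<le> ennreal (1 + e)"
  shows "c \<longlonglongrightarrow> 1"
proof (rule order_tendstoI)
  show "\<forall>\<^sub>F N in sequentially. a < c N" if "a < 1" for a
    using assms(1) that by (auto elim!: eventually_mono intro: order.strict_trans2)
  fix a :: ennreal assume a: "1 < a"
  obtain r where r: "1 < r" "ennreal r < a"
    using dense[OF a] by (metis ennreal_1 ennreal_cases ennreal_less_iff ennreal_less_top not_le
        order.strict_trans order_less_imp_not_less top_greatest zero_less_one_class.zero_le_one)
  then have "\<forall>\<^sub>F N in sequentially. c N \<le> ennreal (1 + (r - 1))" by (intro assms(2)) simp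
  then show "\<forall>\<^sub>F N in sequentially. c N < a"
    using r by (auto elim!: eventually_mono intro: order.strict_trans1)
qed

section \<open>Embedding constants for the weights (1 - |lam k|^2) v k, with v = 1 and v = 1 / delta
  in view\<close>

context
  fixes lam :: "nat \<Rightarrow> complex" and v :: "nat \<Rightarrow> real"
  assumes int: "interpolating lam" and v: "\<And>n. n \<ge> 1 \<Longrightarrow> 0 \<le> v n"
begin

private abbreviation w :: "nat \<Rightarrow> real" where
  "w k \<equiv> (1 - (norm (lam k))\<^sup>2) * v k"

private lemma disc: "n \<ge> 1 \<Longrightarrow> norm (lam n) < 1"
  by (rule interpolating_disc[OF int])

private lemma w_nonneg: "n \<ge> 1 \<Longrightarrow> 0 \<le> w n"
  using norm_sq_less_1[OF disc] v by (intro mult_nonneg_nonneg) (auto intro: less_imp_le)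

private lemma w_value:
  assumes "f \<in> H2" "n \<ge> 1"
  shows "w n * (norm (f (lam n)))\<^sup>2 = v n * (norm (H2_inner f (H2_normalized_kernel (lam n))))\<^sup>2"
  using norm_sq_less_1[OF disc[OF assms(2)]]
  by (simp add: H2_inner_normalized_kernel[OF assms(1) disc[OF assms(2)]] norm_mult
      power_mult_distrib)

text \<open>The factor 1 - |lam n|^2 turns squared values of f into squared inner products with the
  normalized kernels, so that the integral is a Bessel sum weighted by \<open>v\<close>.\<close>

lemma weighted_L2_le:
  assumes N: "N \<ge> 1" and up: "upper_bd (\<lambda>n. H2_normalized_kernel (lam n)) N C" "0 \<le> C"
    and V: "\<And>n. n \<ge> N \<Longrightarrow> v n \<le> V" and f: "f \<in> H2"
  shows "L2_norm_sq (point_masses lam w N) f \<le> ennreal (V * C * (H2_norm f)\<^sup>2)"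
proof (rule L2_norm_sq_le)
  fix F assume F: "finite F" "F \<subseteq> {N..}"
  have F1: "n \<ge> 1" if "n \<in> F" for n using F N that by auto
  have "(\<Sum>n\<in>F. w n * (norm (f (lam n)))\<^sup>2) = (\<Sum>n\<in>F. v n * (norm (H2_inner f (H2_normalized_kernel
      (lam n))))\<^sup>2)"
    using w_value[OF f F1] by (intro sum.cong) auto
  also have "\<dots> \<le> (\<Sum>n\<in>F. V * (norm (H2_inner f (H2_normalized_kernel (lam n))))\<^sup>2)"
    using V F by (intro sum_mono mult_right_mono) auto
  also have "\<dots> = V * (\<Sum>n\<in>F. (norm (H2_inner f (H2_normalized_kernel (lam n))))\<^sup>2)"
    by (rule sum_distrib_left[symmetric])
  also have "\<dots> \<le> V * (C * (H2_norm f)\<^sup>2)"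
  proof (rule mult_left_mono)
    show "(\<Sum>n\<in>F. (norm (H2_inner f (H2_normalized_kernel (lam n))))\<^sup>2) \<le> C * (H2_norm f)\<^sup>2"
      by (rule bessel[OF up F _ f]) (use F1 disc H2_normalized_kernel_in_H2 in auto)
    show "0 \<le> V" using v[OF N] V[OF order_refl] by linarith
  qed
  finally show "(\<Sum>n\<in>F. w n * (norm (f (lam n)))\<^sup>2) \<le> V * C * (H2_norm f)\<^sup>2" by simp
qed (use N disc w_nonneg H2_holomorphic[OF f] in auto)

lemma weighted_carleson_le:
  assumes N: "N \<ge> 1" and up: "upper_bd (\<lambda>n. H2_normalized_kernel (lam n)) N C" "0 \<le> C"
    and V: "\<And>n. n \<ge> N \<Longrightarrow> v n \<le> V"
  shows "carleson_const (point_masses lam w N) \<le> ennreal (V * C)"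
  unfolding carleson_const_def
proof (rule SUP_least)
  fix f assume "f \<in> {f \<in> H2. \<exists>z\<in>unit_disc. f z \<noteq> 0}"
  then obtain z where f: "f \<in> H2" and z: "norm z < 1" "f z \<noteq> 0" by auto
  have "H2_norm f \<noteq> 0" using H2_eq_0[OF f _ z(1)] z(2) by blast
  then have nf: "0 < (H2_norm f)\<^sup>2" by simp
  have V0: "0 \<le> V" using v[OF N] V[OF order_refl] by linarith
  have "L2_norm_sq (point_masses lam w N) f \<le> ennreal (V * C) * ennreal ((H2_norm f)\<^sup>2)"
    using weighted_L2_le[OF N up V f] V0 up(2) by (simp add: ennreal_mult[symmetric])
  then show "L2_norm_sq (point_masses lam w N) f / ennreal ((H2_norm f)\<^sup>2) \<le> ennreal (V * C)"
    using nf by (intro divide_le_posI_ennreal) (auto simp: mult.commute)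
qed

lemma weighted_kernel_const_le:
  assumes N: "N \<ge> 1" and up: "upper_bd (\<lambda>n. H2_normalized_kernel (lam n)) N C" "0 \<le> C"
    and V: "\<And>n. n \<ge> N \<Longrightarrow> v n \<le> V"
  shows "kernel_const (point_masses lam w N) \<le> ennreal (sqrt (V * C))"
  unfolding kernel_const_def
proof (rule SUP_least)
  fix z :: complex assume "z \<in> unit_disc"
  then have z: "norm z < 1" by simp
  have V0: "0 \<le> V" using v[OF N] V[OF order_refl] by linarith
  have "L2_norm_sq (point_masses lam w N) (H2_normalized_kernel z) \<le> ennreal (V * C)"
    using weighted_L2_le[OF N up V H2_normalized_kernel_in_H2[OF z]]
        by (simp add: H2_norm_normalized_kernel[OF z])
  from ennreal_sqrt_mono[OF this] show "ennreal_sqrt (L2_norm_sq (point_masses lam w N)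
      (H2_normalized_kernel z)) \<le> ennreal (sqrt (V * C))"
    using V0 up(2) by (simp add: ennreal_sqrt_ennreal)
qed

text \<open>Testing on the normalized kernel at lam j makes the terms v n * (1 - rho^2), the entries
  of a weighted row sum.\<close>

private lemma kernel_L2_ge:
  assumes N: "N \<ge> 1" and j: "j \<ge> N" and F: "finite F" "F \<subseteq> {N..}"
  shows "ennreal (\<Sum>n\<in>F. v n * (1 - (rho lam j n)\<^sup>2))
      \<le> L2_norm_sq (point_masses lam w N) (H2_normalized_kernel (lam j))"
proof -
  have j1: "j \<ge> 1" using j N by simp
  have F1: "n \<ge> 1" if "n \<in> F" for n using F N that by auto
  have hj: "H2_normalized_kernel (lam j) \<in> H2" by (rule H2_normalized_kernel_in_H2[OF disc[OF j1]])
  have "w n * (norm (H2_normalized_kernel (lam j) (lam n)))\<^sup>2 = v n * (1 - (rho lam j n)\<^sup>2)"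
      if "n \<in> F" for n
  proof -
    have "(norm (H2_normalized_kernel (lam j) (lam n)))\<^sup>2 = (1 - (norm (lam j))\<^sup>2) / (norm (1
        - cnj (lam j) * lam n))\<^sup>2"
      using norm_sq_less_1[OF disc[OF j1]]
          by (simp add: H2_normalized_kernel_def norm_divide power_divide)
    moreover have "1 - (rho lam j n)\<^sup>2 = (1 - (norm (lam j))\<^sup>2) * (1
        - (norm (lam n))\<^sup>2) / (norm (1 - cnj (lam j) * lam n))\<^sup>2"
      using one_minus_blaschke_factor[OF disc[OF j1] less_imp_le[OF disc[OF F1[OF that]]]]
      by (simp add: rho_def norm_blaschke_factor_commute)
    ultimately show ?thesis by simp
  qed
  then have "(\<Sum>n\<in>F. w n * (norm (H2_normalized_kernel (lam j) (lam n)))\<^sup>2) = (\<Sum>n\<in>F. v n * (1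
      - (rho lam j n)\<^sup>2))"
    by (intro sum.cong) auto
  then show ?thesis
    using L2_norm_sq_ge[of N lam w "H2_normalized_kernel (lam j)" F] N disc w_nonneg
        H2_holomorphic[OF hj] F by simp
qed

lemma weighted_carleson_ge:
  assumes N: "N \<ge> 1" and j: "j \<ge> N" and F: "finite F" "F \<subseteq> {N..}"
  shows "ennreal (\<Sum>n\<in>F. v n * (1 - (rho lam j n)\<^sup>2)) \<le> carleson_const (point_masses lam w N)"
proof -
  let ?h = "H2_normalized_kernel (lam j)"
  have dj: "norm (lam j) < 1" using disc j N by simp
  have hj: "?h \<in> H2" by (rule H2_normalized_kernel_in_H2[OF dj])
  have "?h 0 \<noteq> 0" using norm_sq_less_1[OF dj] by (simp add: H2_normalized_kernel_def)
  then have "?h \<in> {f \<in> H2. \<exists>z\<in>unit_disc. f z \<noteq> 0}" using hj by (auto intro!: bexI[of _ 0])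
  then have "L2_norm_sq (point_masses lam w N) ?h / ennreal ((H2_norm ?h)\<^sup>2)
      \<le> carleson_const (point_masses lam w N)"
    unfolding carleson_const_def by (rule SUP_upper)
  then have "L2_norm_sq (point_masses lam w N) ?h \<le> carleson_const (point_masses lam w N)"
    by (simp add: H2_norm_normalized_kernel[OF dj] divide_ennreal_def)
  then show ?thesis using kernel_L2_ge[OF assms] by (rule order_trans[rotated])
qed

text \<open>The single mass at lam j already contributes v j when tested on the normalized kernel at
  that point.\<close>

lemma weighted_kernel_const_ge:
  assumes N: "N \<ge> 1" and j: "j \<ge> N"
  shows "ennreal (sqrt (v j)) \<le> kernel_const (point_masses lam w N)"
proof -
  have dj: "lam j \<in> unit_disc" using disc j N by simp
  have "rho lam j j = 0" by (simp add: rho_def blaschke_factor_def)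
  then have "ennreal (v j) \<le> L2_norm_sq (point_masses lam w N) (H2_normalized_kernel (lam j))"
    using kernel_L2_ge[OF N j, of "{j}"] j by simp
  from ennreal_sqrt_mono[OF this] have "ennreal (sqrt (v j))
      \<le> ennreal_sqrt (L2_norm_sq (point_masses lam w N) (H2_normalized_kernel (lam j)))"
    using v[of j] j N by (simp add: ennreal_sqrt_ennreal)
  also have "\<dots> \<le> kernel_const (point_masses lam w N)"
    unfolding kernel_const_def by (rule SUP_upper[OF dj])
  finally show ?thesis .
qed

end

text \<open>From above, the constant is bounded by an upper Riesz constant. From below, testing on
  the kernel at lam j gives 1 plus the row sum of j, so a limit of 1 makes the row sums small. For
  the early N, where no asymptotic bound applies, finiteness comes from
  \<open>upper_bd_extend\<close>.\<close>

lemma carleson_iff_thin: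
  assumes int: "interpolating lam"
  defines "\<mu> \<equiv> point_masses lam (\<lambda>k. 1 - (norm (lam k))\<^sup>2)"
  shows "((\<forall>N\<ge>1. carleson_measure (\<mu> N)) \<and> (\<lambda>N. carleson_const (\<mu> N)) \<longlonglongrightarrow> 1) \<longleftrightarrow> thin lam"
proof -
  have mu: "\<mu> = point_masses lam (\<lambda>k. (1 - (norm (lam k))\<^sup>2) * 1)" by (simp add: \<mu>_def)
  note le = weighted_carleson_le[where v = "\<lambda>_. 1" and V = 1, OF int, folded mu, simplified]
  note ge = weighted_carleson_ge[where v = "\<lambda>_. 1", OF int, folded mu, simplified]
  have rho_self: "rho lam j j = 0" for j by (simp add: rho_def blaschke_factor_def)
  show ?thesis
  proof
    assume thin: "thin lam"
    obtain N1 where N1: "N1 \<ge> 1" "upper_bd (\<lambda>n. H2_normalized_kernel (lam n)) N1 (1 + 1)"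
      using thin_imp_bounds[OF int thin, of 1] by auto
    obtain C where C: "upper_bd (\<lambda>n. H2_normalized_kernel (lam n)) 1 C"
      using upper_bd_extend[OF N1(2,1)] H2_normalized_kernel_in_H2 interpolating_disc[OF int]
          by blast
    have "carleson_const (\<mu> N) \<le> ennreal (max 0 C)" if "N \<ge> 1" for N
      using le[of N "max 0 C"] that upper_bd_mono[OF C that, of "max 0 C"] by simp
    then have 1: "\<forall>N\<ge>1. carleson_measure (\<mu> N)"
      unfolding carleson_measure_def
          by (metis ennreal_less_top infinity_ennreal_def order.strict_trans1)
    have "(\<lambda>N. carleson_const (\<mu> N)) \<longlonglongrightarrow> 1"
    proof (rule ennreal_tendsto_1I)
      show "\<forall>\<^sub>F N in sequentially. 1 \<le> carleson_const (\<mu> N)"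
      proof (rule eventually_sequentiallyI[of 1])
        fix N :: nat assume "1 \<le> N"
        then show "1 \<le> carleson_const (\<mu> N)" using ge[of N N "{N}"] by (simp add: rho_self)
      qed
      fix e :: real assume e: "e > 0"
      obtain N0 where N0: "N0 \<ge> 1" "upper_bd (\<lambda>n. H2_normalized_kernel (lam n)) N0 (1 + e)"
        using thin_imp_bounds[OF int thin e] by blast
      show "\<forall>\<^sub>F N in sequentially. carleson_const (\<mu> N) \<le> ennreal (1 + e)"
      proof (rule eventually_sequentiallyI[of N0])
        fix N assume "N0 \<le> N"
        then show "carleson_const (\<mu> N) \<le> ennreal (1 + e)"
          using le[of N "1 + e"] upper_bd_mono[OF N0(2), of N "1 + e"] N0(1) e by simp
      qed
    qed
    then show "(\<forall>N\<ge>1. carleson_measure (\<mu> N)) \<and> (\<lambda>N. carleson_const (\<mu> N)) \<longlonglongrightarrow> 1" using 1 by blast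
  next
    assume "(\<forall>N\<ge>1. carleson_measure (\<mu> N)) \<and> (\<lambda>N. carleson_const (\<mu> N)) \<longlonglongrightarrow> 1"
    then have lim: "(\<lambda>N. carleson_const (\<mu> N)) \<longlonglongrightarrow> 1" by blast
    show "thin lam"
    proof (rule thin_of_row_sums[OF int])
      fix e :: real assume e: "e > 0"
      have "(1::ennreal) < ennreal (1 + e)" using e
          by (metis ennreal_1 ennreal_lessI less_add_same_cancel1 add_pos_pos zero_less_one)
      from order_tendstoD(2)[OF lim this] obtain N0 where N0: "\<And>N. N \<ge> N0 \<Longrightarrow> carleson_const (\<mu> N)
          < ennreal (1 + e)"
        by (auto simp: eventually_sequentially)
      define N where "N = max 1 N0"
      have N: "N \<ge> 1" "carleson_const (\<mu> N) < ennreal (1 + e)" using N0 by (auto simp: N_def)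
      show "\<exists>N\<ge>1. \<forall>j\<ge>N. \<forall>F. finite F \<longrightarrow> F \<subseteq> {N..} - {j} \<longrightarrow> (\<Sum>k\<in>F. 1 - (rho lam j k)\<^sup>2) \<le> e"
      proof (intro exI[of _ N] conjI N(1) allI impI)
        fix j F assume j: "j \<ge> N" and F: "finite F" "F \<subseteq> {N..} - {j}"
        have jF: "finite (insert j F)" "insert j F \<subseteq> {N..}" using j F by auto
        have "ennreal (\<Sum>n\<in>insert j F. 1 - (rho lam j n)\<^sup>2) < ennreal (1 + e)"
          by (rule order.strict_trans1[OF _ N(2)]) (use ge[of N j "insert j F"] N(1) j jF in simp)
        then have "(\<Sum>n\<in>insert j F. 1 - (rho lam j n)\<^sup>2) < 1 + e"
          using e by (metis add_pos_pos ennreal_leI not_le zero_less_one)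
        moreover have "(\<Sum>n\<in>insert j F. 1 - (rho lam j n)\<^sup>2) = 1 + (\<Sum>n\<in>F. 1 - (rho lam j n)\<^sup>2)"
          using F by (subst sum.insert) (auto simp: rho_self)
        ultimately show "(\<Sum>k\<in>F. 1 - (rho lam j k)\<^sup>2) \<le> e" by linarith
      qed
    qed
  qed
qed

text \<open>With v = 1 / delta the single mass at lam j bounds the constant below by 1 / sqrt (delta
  lam j), so a limit of 1 yields thinness without passing through row sums. Conversely, thinness
  makes both the weights and the upper Riesz constants tend to 1.\<close>

lemma kernel_carleson_iff_thin:
  assumes int: "interpolating lam"
  defines "\<nu> \<equiv> point_masses lam (\<lambda>k. (1 - (norm (lam k))\<^sup>2) / delta lam k)"
  shows "((\<forall>N\<ge>1. carleson_measure (\<nu> N)) \<and> (\<lambda>N. kernel_const (\<nu> N)) \<longlonglongrightarrow> 1) \<longleftrightarrow> thin lam"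
proof -
  let ?v = "\<lambda>k. 1 / delta lam k"
  have nu: "\<nu> = point_masses lam (\<lambda>k. (1 - (norm (lam k))\<^sup>2) * ?v k)" by (simp add: \<nu>_def)
  have dp: "0 < delta lam n" "delta lam n \<le> 1" if "n \<ge> 1" for n
    using delta_pos[OF int that] delta_lim(3)[of lam, OF interpolating_disc[OF int] that] by auto
  have v: "0 \<le> ?v n" if "n \<ge> 1" for n using dp[OF that] by simp
  note le = weighted_carleson_le[where v = ?v, OF int v, folded nu, simplified simp_thms
      implies_True_equals True_implies_equals triv_forall_equality]
  note kle = weighted_kernel_const_le[where v = ?v, OF int v, folded nu, simplified simp_thms
      implies_True_equals True_implies_equals triv_forall_equality]
  note kge = weighted_kernel_const_ge[where v = ?v, OF int v, folded nu, simplified simp_thms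
      implies_True_equals True_implies_equals triv_forall_equality]
  show ?thesis
  proof
    assume thin: "thin lam"
    then have dl: "delta lam \<longlonglongrightarrow> 1" by (simp add: thin_def)
    then have "?v \<longlonglongrightarrow> 1 / 1" by (intro tendsto_intros) auto
    then have vl: "?v \<longlonglongrightarrow> 1" by simp
    then have "Bseq ?v" by (rule convergent_imp_Bseq[OF convergentI])
    then obtain V where "\<forall>n. norm (?v n) \<le> V" by (auto elim: BseqE)
    then have V: "?v n \<le> V" for n using abs_ge_self[of "?v n"] by (metis order_trans real_norm_def)
    obtain N1 where N1: "N1 \<ge> 1" "upper_bd (\<lambda>n. H2_normalized_kernel (lam n)) N1 (1 + 1)"
      using thin_imp_bounds[OF int thin, of 1] by auto
    obtain C where C: "upper_bd (\<lambda>n. H2_normalized_kernel (lam n)) 1 C"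
      using upper_bd_extend[OF N1(2,1)] H2_normalized_kernel_in_H2 interpolating_disc[OF int]
          by blast
    have "carleson_const (\<nu> N) \<le> ennreal (V * max 0 C)" if "N \<ge> 1" for N
      by (rule le[OF that upper_bd_mono[OF C that]]) (use V in auto)
    then have 1: "\<forall>N\<ge>1. carleson_measure (\<nu> N)"
      unfolding carleson_measure_def
          by (metis ennreal_less_top infinity_ennreal_def order.strict_trans1)
    have "(\<lambda>N. kernel_const (\<nu> N)) \<longlonglongrightarrow> 1"
    proof (rule ennreal_tendsto_1I)
      show "\<forall>\<^sub>F N in sequentially. 1 \<le> kernel_const (\<nu> N)"
      proof (rule eventually_sequentiallyI[of 1])
        fix N :: nat assume N: "1 \<le> N"
        have "(1::ennreal) = ennreal 1" by simp
        also have "\<dots> \<le> ennreal (sqrt (?v N))" using dp[OF N] by (intro ennreal_leI) simp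
        also have "\<dots> \<le> kernel_const (\<nu> N)" by (rule kge[OF N order_refl])
        finally show "1 \<le> kernel_const (\<nu> N)" .
      qed
      fix e :: real assume e: "e > 0"
      obtain N0 where N0: "N0 \<ge> 1" "upper_bd (\<lambda>n. H2_normalized_kernel (lam n)) N0 (1 + e)"
        using thin_imp_bounds[OF int thin e] by blast
      have "\<forall>\<^sub>F n in sequentially. ?v n < 1 + e" using order_tendstoD(2)[OF vl, of "1 + e"] e
          by simp
      then obtain N1 where N1: "\<And>n. n \<ge> N1 \<Longrightarrow> ?v n < 1 + e" unfolding eventually_sequentially
          by blast
      show "\<forall>\<^sub>F N in sequentially. kernel_const (\<nu> N) \<le> ennreal (1 + e)"
      proof (rule eventually_sequentiallyI[of "max N0 N1"])
        fix N assume N: "max N0 N1 \<le> N"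
        \<comment> \<open>One factor 1 + e bounds the weights and the other is the Riesz constant;
          the constant on kernels is a norm, hence the root.\<close>
        have "kernel_const (\<nu> N) \<le> ennreal (sqrt ((1 + e) * (1 + e)))"
        proof (rule kle)
          show "N \<ge> 1" "upper_bd (\<lambda>n. H2_normalized_kernel (lam n)) N (1 + e)"
            using N N0 upper_bd_mono[OF N0(2), of N "1 + e"] by auto
          show "?v n \<le> 1 + e" if "n \<ge> N" for n using N1[of n] N that by simp
        qed (use e in simp)
        then show "kernel_const (\<nu> N) \<le> ennreal (1 + e)" using e by simp
      qed
    qed
    then show "(\<forall>N\<ge>1. carleson_measure (\<nu> N)) \<and> (\<lambda>N. kernel_const (\<nu> N)) \<longlonglongrightarrow> 1" using 1 by blast
  next
    assume "(\<forall>N\<ge>1. carleson_measure (\<nu> N)) \<and> (\<lambda>N. kernel_const (\<nu> N)) \<longlonglongrightarrow> 1"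
    then have lim: "(\<lambda>N. kernel_const (\<nu> N)) \<longlonglongrightarrow> 1" by blast
    have "(\<lambda>n. sqrt (?v n)) \<longlonglongrightarrow> 1"
    proof (rule tendstoI)
      fix e :: real assume e: "e > 0"
      have "(1::ennreal) < ennreal (1 + e)" using e
          by (metis ennreal_1 ennreal_lessI less_add_same_cancel1 add_pos_pos zero_less_one)
      from order_tendstoD(2)[OF lim this] have "\<forall>\<^sub>F N in sequentially. kernel_const (\<nu> N)
          < ennreal (1 + e)" .
      moreover have "\<forall>\<^sub>F N in sequentially. N \<ge> (1::nat)" by (rule eventually_ge_at_top)
      ultimately show "\<forall>\<^sub>F N in sequentially. dist (sqrt (?v N)) 1 < e"
      proof eventually_elim
        case (elim N)
        have "ennreal (sqrt (?v N)) < ennreal (1 + e)"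
            by (rule order.strict_trans1[OF kge[OF elim(2) order_refl] elim(1)])
        then have "sqrt (?v N) < 1 + e" using e
            by (metis add_pos_pos ennreal_leI not_le zero_less_one)
        moreover have "1 \<le> sqrt (?v N)" using dp[OF elim(2)] by simp
        ultimately show ?case by (simp add: dist_real_def)
      qed
    qed
    then have "(\<lambda>n. inverse ((sqrt (?v n))\<^sup>2)) \<longlonglongrightarrow> inverse (1\<^sup>2)" by (intro tendsto_intros) auto
    then have l: "(\<lambda>n. inverse ((sqrt (?v n))\<^sup>2)) \<longlonglongrightarrow> 1" by simp
    show "thin lam"
      unfolding thin_def
    proof (rule Lim_transform_eventually[OF l], rule eventually_sequentiallyI[of 1])
      fix n :: nat assume "1 \<le> n"
      then show "inverse ((sqrt (?v n))\<^sup>2) = delta lam n" using dp[of n] by simp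
    qed
  qed
qed

section \<open>The equivalence\<close>

theorem theorem3p5:
  fixes lam :: "nat \<Rightarrow> complex" and \<Theta> :: "complex \<Rightarrow> complex"
  assumes "interpolating lam"
    and "inner_function \<Theta>"
    and "(SUP n\<in>{1..}. norm (\<Theta> (lam n))) < 1"
  shows
    "let \<mu> = point_masses lam (\<lambda>k. 1 - (norm (lam k))\<^sup>2);
         \<nu> = point_masses lam (\<lambda>k. (1 - (norm (lam k))\<^sup>2) / delta lam k);
         k\<Theta> = (\<lambda>n. model_normalized_kernel \<Theta> (lam n));
         s1 = EIS H2 H2_norm H2_kernel lam;
         s2 = (interpolating lam \<and> thin lam);
         s3 = (AOB (model_space \<Theta>) H2_norm k\<Theta> \<or>
               (\<exists>p\<ge>2. AOB (model_space \<Theta>) H2_norm (\<lambda>n. k\<Theta> (n + p - 1)) \<and>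
                       complete_in (model_space \<Theta>) H2_norm (\<lambda>n. k\<Theta> (n + p - 1))));
         s4 = AIS H2 H2_norm H2_kernel lam;
         s5 = ((\<forall>N\<ge>1. carleson_measure (\<mu> N)) \<and> (\<lambda>N. carleson_const (\<mu> N)) \<longlonglongrightarrow> 1);
         s6 = ((\<forall>N\<ge>1. carleson_measure (\<nu> N)) \<and> (\<lambda>N. kernel_const (\<nu> N)) \<longlonglongrightarrow> 1);
         s7 = EIS (model_space \<Theta>) H2_norm (model_kernel \<Theta>) lam;
         s8 = AIS (model_space \<Theta>) H2_norm (model_kernel \<Theta>) lam
     in (s1 \<longleftrightarrow> s2) \<and> (s2 \<longleftrightarrow> s3) \<and> (s3 \<longleftrightarrow> s4) \<and> (s4 \<longleftrightarrow> s5) \<and> (s5 \<longleftrightarrow> s6) \<and>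
        (s7 \<longleftrightarrow> s8) \<and>
        (s7 \<longrightarrow> s1 \<and> s2 \<and> s3 \<and> s4 \<and> s5 \<and> s6) \<and>
        (s8 \<longrightarrow> s1 \<and> s2 \<and> s3 \<and> s4 \<and> s5 \<and> s6) \<and>
        ((\<lambda>n. \<Theta> (lam n)) \<longlonglongrightarrow> 0 \<longrightarrow> (s6 \<longleftrightarrow> s7))"
proof -
  define \<kappa> where "\<kappa> = (SUP n\<in>{1..}. norm (\<Theta> (lam n)))"
  \<comment> \<open>Without boundedness the real supremum would say nothing about its members; the
    bound 1 on the disc supplies it.\<close>
  have "bdd_above ((\<lambda>n. norm (\<Theta> (lam n))) ` {1..})"
    by (rule bdd_aboveI2[of _ _ 1]) (use inner_function_le_1[OF assms(2)] interpolating_disc[OF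
        assms(1)] in auto)
  then have le: "norm (\<Theta> (lam n)) \<le> \<kappa>" if "n \<ge> 1" for n
    unfolding \<kappa>_def using that by (intro cSUP_upper) auto
  then have "0 \<le> \<kappa>" using order_trans[OF norm_ge_zero le[of 1]] by simp
  then have "model_sequence \<Theta> lam \<kappa>"
    using model_symbol_inner_function[OF assms(2)] assms(1,3) le
    by (simp add: model_sequence_def model_sequence_axioms_def \<kappa>_def)
  then interpret K: model_sequence \<Theta> lam \<kappa> .
  \<comment> \<open>The symbol 0 turns the results on model spaces into those for
    \<open>H2\<close>.\<close>
  have "model_sequence (\<lambda>_. 0) lam 0"
    using model_symbol_0 assms(1) by (simp add: model_sequence_def model_sequence_axioms_def)
  then interpret H: model_sequence "\<lambda>_. 0" lam 0 .
  note eqs = H.EIS_iff_thin[unfolded model_space_0 model_kernel_0] H.AIS_iff_thin[unfolded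
      model_space_0 model_kernel_0]
    K.EIS_iff_thin K.AIS_iff_thin K.AOB_iff_thin carleson_iff_thin[OF assms(1)]
        kernel_carleson_iff_thin[OF assms(1)]
  show ?thesis unfolding Let_def eqs using assms(1) by blast
qed

end
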